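(* Under Assumption A, let $(X_t)_{t\ge0}$ be the solution of homogenized SGD (hSGD) with deterministic initial value $X_0=x_0\in\mathbb{R}^d$. Then its asymptotic tail-index $\eta$ satisfies \[ \eta\ \le\ \eta^*:=1+\frac{2nB(\lambda_1^2+n\delta)}{\gamma\lambda_1^4}. \]
   Context: Data: $A\in\mathbb{R}^{n\times d}$ (design matrix) and $b\in\mathbb{R}^n$. Assumption A: all singular values $\lambda_1\ge\lambda_2\ge\dots\ge\lambda_d$ of $A$ are strictly positive, and $b$ is not in the column space of $A$. Let $L(x)=\tfrac12\|Ax-b\|^2$ and $f(x)=\tfrac1n L(x)+\tfrac{\delta}{2}\|x\|^2$ with regularization parameter $\delta\ge0$; learning rate $\gamma>0$; batch size $B\ge1$ (an integer). Homogenized SGD is the SDE \[ dX_t=-\gamma\nabla f(X_t)\,dt+\gamma\sqrt{\tfrac{2}{n^2B}L(X_t)\nabla^2L(X_t)}\,dW_t =-\gamma\Big[\tfrac1n A^{\mathrm T}(AX_t-b)+\delta X_t\Big]dt+\gamma\sqrt{\tfrac{1}{n^2B}\|AX_t-b\|^2A^{\mathrm T}A}\,dW_t, \] where $W$ is a $d$-dimensional standard Brownian motion and the square root is the positive semidefinite matrix square root. The asymptotic tail-index of a process $(X_t)_{t\ge0}$ is $\eta:=\sup\{p\ge0:\limsup_{t\to\infty}\mathbb{E}[|X_t|^p]<\infty\}$. *)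

theory Defs
  imports "HOL-Probability.Probability"
begin

definition AtA_eigenvalues :: "real^'d^'n \<Rightarrow> real set" where
  "AtA_eigenvalues A = {\<mu>. \<exists>v. v \<noteq> 0 \<and> (transpose A ** A) *v v = \<mu> *\<^sub>R v}"

definition singular_values :: "real^'d^'n \<Rightarrow> real set" where
  "singular_values A = sqrt ` AtA_eigenvalues A"

definition top_singular_value :: "real^'d^'n \<Rightarrow> real" where
  "top_singular_value A = Max (singular_values A)"

definition psd_sqrt :: "real^'d^'d \<Rightarrow> real^'d^'d" where
  "psd_sqrt Q = (THE S. transpose S = S \<and> (\<forall>v. 0 \<le> v \<bullet> (S *v v)) \<and> S ** S = Q)"

text \<open>Gradient of f(x) = (1/n) 1/2 |Ax-b|^2 + delta/2 |x|^2, with n = CARD('n).\<close>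
definition grad_f :: "real^'d^'n \<Rightarrow> real^'n \<Rightarrow> real \<Rightarrow> real^'d \<Rightarrow> real^'d" where
  "grad_f A b \<delta> x = (1 / real CARD('n)) *\<^sub>R (transpose A *v (A *v x - b)) + \<delta> *\<^sub>R x"

definition hsgd_diffusion :: "real^'d^'n \<Rightarrow> real^'n \<Rightarrow> real \<Rightarrow> nat \<Rightarrow> real^'d \<Rightarrow> real^'d^'d" where
  "hsgd_diffusion A b \<gamma> B x =
     \<gamma> *\<^sub>R psd_sqrt ((norm (A *v x - b) ^ 2 / ((real CARD('n))\<^sup>2 * real B)) *\<^sub>R (transpose A ** A))"

definition filtration_on :: "'a measure \<Rightarrow> (real \<Rightarrow> 'a measure) \<Rightarrow> bool" where
  "filtration_on M F \<longleftrightarrow> (\<forall>t. subalgebra M (F t)) \<and> (\<forall>s t. s \<le> t \<longrightarrow> sets (F s) \<subseteq> sets (F t))"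

definition brownian_motion :: "'a measure \<Rightarrow> (real \<Rightarrow> 'a measure) \<Rightarrow> (real \<Rightarrow> 'a \<Rightarrow> real^'d) \<Rightarrow> bool" where
  "brownian_motion M F W \<longleftrightarrow>
     prob_space M \<and> filtration_on M F \<and>
     (\<forall>t\<ge>0. W t \<in> borel_measurable (F t)) \<and>
     (\<forall>\<omega>\<in>space M. W 0 \<omega> = 0 \<and> continuous_on {0..} (\<lambda>t. W t \<omega>)) \<and>
     (\<forall>s t. 0 \<le> s \<longrightarrow> s < t \<longrightarrow>
        (\<forall>E\<in>sets (F s). \<forall>C\<in>sets borel.
           measure M (E \<inter> ((\<lambda>\<omega>. W t \<omega> - W s \<omega>) -` C \<inter> space M))
             = measure M E * measure M ((\<lambda>\<omega>. W t \<omega> - W s \<omega>) -` C \<inter> space M)) \<and>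
        distr M borel (\<lambda>\<omega>. W t \<omega> - W s \<omega>)
          = density lborel (\<lambda>x. ennreal (\<Prod>i\<in>UNIV. normal_density 0 (sqrt (t - s)) (x $ i))))"

text \<open>Left-point Riemann sums of int_0^t H_s dW_s over the dyadic partition with 2^N pieces.
  For continuous adapted integrands these converge in probability to the Ito integral.\<close>
definition ito_riemann_sum ::
  "(real \<Rightarrow> 'a \<Rightarrow> real^'d) \<Rightarrow> (real \<Rightarrow> 'a \<Rightarrow> real^'d^'d) \<Rightarrow> real \<Rightarrow> nat \<Rightarrow> 'a \<Rightarrow> real^'d" where
  "ito_riemann_sum W H t N \<omega> =
     (\<Sum>k<2^N. H (real k * t / 2^N) \<omega> *v (W (real (Suc k) * t / 2^N) \<omega> - W (real k * t / 2^N) \<omega>))"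

text \<open>X solves homogenized SGD driven by W with X_0 = x0:
  X_t = x0 - gamma int_0^t grad f(X_s) ds + int_0^t sigma(X_s) dW_s  for all t >= 0,
  where the Ito integral is the limit in probability of the left Riemann sums.\<close>
definition hsgd_solution ::
  "'a measure \<Rightarrow> (real \<Rightarrow> 'a measure) \<Rightarrow> (real \<Rightarrow> 'a \<Rightarrow> real^'d) \<Rightarrow> real^'d^'n \<Rightarrow> real^'n
    \<Rightarrow> real \<Rightarrow> real \<Rightarrow> nat \<Rightarrow> real^'d \<Rightarrow> (real \<Rightarrow> 'a \<Rightarrow> real^'d) \<Rightarrow> bool" where
  "hsgd_solution M F W A b \<delta> \<gamma> B x0 X \<longleftrightarrow>
     (\<forall>t\<ge>0. X t \<in> borel_measurable (F t)) \<and>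
     (\<forall>\<omega>\<in>space M. X 0 \<omega> = x0 \<and> continuous_on {0..} (\<lambda>t. X t \<omega>)) \<and>
     (\<forall>t\<ge>0. \<forall>\<epsilon>>0.
        ((\<lambda>N. measure M {\<omega>\<in>space M.
            \<epsilon> < norm (ito_riemann_sum W (\<lambda>s \<omega>. hsgd_diffusion A b \<gamma> B (X s \<omega>)) t N \<omega>
                       - (X t \<omega> - x0 + \<gamma> *\<^sub>R integral {0..t} (\<lambda>s. grad_f A b \<delta> (X s \<omega>))))})
          \<longlongrightarrow> 0) sequentially)"

definition pow_nn :: "real \<Rightarrow> real \<Rightarrow> real" where
  "pow_nn x p = (if p = 0 then 1 else x powr p)"

definition tail_index :: "'a measure \<Rightarrow> (real \<Rightarrow> 'a \<Rightarrow> real^'d) \<Rightarrow> ereal" where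
  "tail_index M X = Sup (ereal ` {p. 0 \<le> p \<and>
     Limsup at_top (\<lambda>t::real. \<integral>\<^sup>+ \<omega>. ennreal (pow_nn (norm (X t \<omega>)) p) \<partial>M) < \<infinity>})"

end

theory Submission
  imports Defs
begin

text \<open>
Let \<open>v\<close> be a unit top right singular vector of \<open>A\<close> and \<open>Y = \<langle>v, X\<rangle> - y\<^sub>0\<close>, centred so that its drift is
\<open>- \<alpha> Y\<close> with \<open>\<alpha> = \<gamma> (\<lambda>\<^sub>1\<^sup>2 / n + \<delta>)\<close>. As \<open>b\<close> has positive distance \<open>\<kappa>\<close> from the column space,
\<open>|A X - b|\<^sup>2 \<ge> (\<lambda>\<^sub>1 Y + d)\<^sup>2 + \<kappa>\<^sup>2\<close>, so the diffusion coefficient of \<open>Y\<close> grows at least linearly and is bounded away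
from \<open>0\<close>. For every \<open>q > \<eta>\<^sup>*\<close> this gives a convex \<open>\<phi>\<close> of growth \<open>|y| powr q\<close> whose image under the generator is at
least some \<open>\<epsilon> > 0\<close>. If the moments of some order \<open>p > q\<close> stayed bounded, then multiplying \<open>\<phi>\<close> by a cutoff with a large
radius would give a bounded function \<open>\<Phi>\<close> with \<open>L \<Phi> \<ge> \<epsilon> - (small) (1 + |x|\<^sup>2) powr (p / 2)\<close>, and by Dynkin's formula
\<open>E \<Phi> (X\<^sub>t)\<close> would grow linearly in \<open>t\<close>, which is absurd.

Dynkin's formula is derived directly from the Riemann sums that define the stochastic integral: on a
dyadic grid, the telescoping sum of \<open>\<Phi> (X\<^sub>t)\<close> minus the generator sum minus a martingale sum tends to \<open>0\<close> in probability,
and all three are bounded in \<open>L\<^sup>2\<close>.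
\<close>

section \<open>Square roots of positive semidefinite matrices\<close>

text \<open>The critical exponent comes from testing the generator on
  \<open>\<bar>y\<bar> powr q\<close>: if the squared diffusion coefficient of \<open>Y\<close> were
  exactly \<open>c2 * lam\<^sup>2 * y\<^sup>2\<close>, the result would be \<open>q * \<bar>y\<bar>
  powr q * ((q - 1) * c2 * lam\<^sup>2 / 2 - \<alpha>)\<close>, and the bracket vanishes at
  \<open>\<eta>\<^sup>*\<close>. But \<open>Y\<close> is not a diffusion of its own: its noise
  depends on all of \<open>X\<close> and is only bounded below. Hence \<open>\<phi>\<close> must be
  convex, and the cutoff must act on all of \<open>X\<close>; its derivatives are paid for by the
  gap between \<open>q\<close> and \<open>p\<close>. The stochastic integral is known only as a
  limit in probability at each single time. Its increments over the cells of a grid are therefore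
  recovered by comparing that grid with finer ones, where the fine level tends to infinity while the
  coarse one is fixed. The matrix root is a definite description, so spectral theory is needed to
  write the noise as a scalar function of the state times one constant matrix.\<close>

lemma inner_matrix_vector_symmetric:
  fixes Q :: "real^'d^'d"
  assumes "transpose Q = Q"
  shows "x \<bullet> (Q *v y) = (Q *v x) \<bullet> y"
  by (metis assms dot_lmul_matrix transpose_matrix_vector)

definition orthonormal_eigenvectors :: "real^'d^'d \<Rightarrow> (real^'d) set \<Rightarrow> bool" where
  "orthonormal_eigenvectors Q E \<longleftrightarrow> pairwise orthogonal E \<and>
     (\<forall>v\<in>E. norm v = 1 \<and> (\<exists>\<mu>. Q *v v = \<mu> *\<^sub>R v))"

lemma orthonormal_eigenvectors_independent:
  assumes "orthonormal_eigenvectors Q E"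
  shows "independent E"
  using assms unfolding orthonormal_eigenvectors_def
  by (intro pairwise_orthogonal_independent) auto

text \<open>A maximiser \<open>u\<close> of the quadratic form over the unit sphere of
  \<open>U\<close> is an eigenvector: the residual \<open>h\<close> of the eigenvalue equation lies
  in \<open>U\<close> by invariance, and moving \<open>u\<close> along \<open>h\<close> would raise
  the Rayleigh quotient to first order unless \<open>h = 0\<close>.\<close>

lemma symmetric_eigenvector_in_invariant_subspace:
  fixes Q :: "real^'d^'d"
  assumes sym: "transpose Q = Q" and U: "subspace U" "U \<noteq> {0}"
    and inv: "\<And>x. x \<in> U \<Longrightarrow> Q *v x \<in> U"
  obtains u \<mu> where "u \<in> U" "norm u = 1" "Q *v u = \<mu> *\<^sub>R u"
proof -
  let ?K = "sphere 0 1 \<inter> U"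
  have "compact ?K"
    using closed_subspace[OF U(1)] by (intro compact_Int_closed) auto
  moreover obtain x where x: "x \<in> U" "x \<noteq> 0"
    using U subspace_0 by blast
  then have "(1 / norm x) *\<^sub>R x \<in> ?K" using U(1) by (auto simp: subspace_scale)
  then have "?K \<noteq> {}" by blast
  moreover have "continuous_on ?K (\<lambda>x. x \<bullet> (Q *v x))"
    by (intro continuous_intros)
  ultimately obtain u where u: "u \<in> ?K" and max: "\<And>y. y \<in> ?K \<Longrightarrow> y \<bullet> (Q *v y) \<le> u \<bullet> (Q *v u)"
    using continuous_attains_sup[of ?K "\<lambda>x. x \<bullet> (Q *v x)"] by blast
  define m where "m = u \<bullet> (Q *v u)"
  have nu: "norm u = 1" "u \<in> U" using u by auto
  have le: "y \<bullet> (Q *v y) \<le> m * (norm y)\<^sup>2" if "y \<in> U" for y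
  proof (cases "y = 0")
    case False
    then have "(1 / norm y) *\<^sub>R y \<in> ?K" using that U(1) by (auto simp: subspace_scale)
    from max[OF this] have "y \<bullet> (Q *v y) / (norm y)\<^sup>2 \<le> m"
      by (simp add: m_def matrix_vector_mult_scaleR power2_eq_square)
    then show ?thesis using False by (simp add: field_simps)
  qed simp
  define h where "h = Q *v u - m *\<^sub>R u"
  have hU: "h \<in> U" unfolding h_def using nu U(1) inv by (simp add: subspace_diff subspace_scale)
  have uu: "u \<bullet> u = 1" using nu by (simp add: dot_square_norm)
  have hu: "u \<bullet> h = 0" unfolding h_def by (simp add: inner_diff_right m_def uu)
  have hQ: "h \<bullet> (Q *v u) = h \<bullet> h"
    unfolding h_def using hu h_def by (metis (no_types, lifting) add.right_neutral diff_eq_eq inner_add_right inner_commute inner_scaleR_right mult_zero_right)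
  define k where "k = m * (h \<bullet> h) - h \<bullet> (Q *v h)"
  \<comment> \<open>Maximality tested at \<open>u + s *\<^sub>R h\<close>: the first-order gain is
    at most a second-order term, for every \<open>s\<close>.\<close>
  have quad: "2 * s * (h \<bullet> h) \<le> s\<^sup>2 * k" for s
  proof -
    have "(u + s *\<^sub>R h) \<bullet> (Q *v (u + s *\<^sub>R h)) \<le> m * (norm (u + s *\<^sub>R h))\<^sup>2"
      using le nu hU U(1) by (simp add: subspace_add subspace_scale)
    moreover have "(u + s *\<^sub>R h) \<bullet> (Q *v (u + s *\<^sub>R h)) = m + 2 * s * (h \<bullet> h) + s\<^sup>2 * (h \<bullet> (Q *v h))"
      using inner_matrix_vector_symmetric[OF sym, of u h] hQ
      by (simp add: matrix_vector_right_distrib matrix_vector_mult_scaleR inner_add_left inner_add_right m_def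
          inner_commute power2_eq_square algebra_simps)
    moreover have "(norm (u + s *\<^sub>R h))\<^sup>2 = 1 + s\<^sup>2 * (h \<bullet> h)"
      using hu uu unfolding power2_norm_eq_inner
      by (simp add: inner_add_left inner_add_right inner_commute power2_eq_square algebra_simps)
    ultimately show ?thesis unfolding k_def by (simp add: algebra_simps)
  qed
  have "h \<bullet> h = 0"
  proof (rule ccontr)
    assume "h \<bullet> h \<noteq> 0"
    then have pos: "h \<bullet> h > 0" by simp
    \<comment> \<open>With \<open>s = h \<bullet> h / (\<bar>k\<bar> + 1)\<close> the right side is
      at most \<open>s * (h \<bullet> h)\<close>, half of the left side.\<close>
    have "2 * (h \<bullet> h / (\<bar>k\<bar> + 1)) * (h \<bullet> h) \<le> (h \<bullet> h / (\<bar>k\<bar> + 1))\<^sup>2 * k" by (rule quad)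
    also have "\<dots> \<le> (h \<bullet> h / (\<bar>k\<bar> + 1))\<^sup>2 * (\<bar>k\<bar> + 1)" by (intro mult_left_mono) auto
    also have "\<dots> = (h \<bullet> h / (\<bar>k\<bar> + 1)) * (h \<bullet> h)" by (simp add: power2_eq_square)
    finally have "(h \<bullet> h / (\<bar>k\<bar> + 1)) * (h \<bullet> h) \<le> 0" by linarith
    moreover have "(h \<bullet> h / (\<bar>k\<bar> + 1)) * (h \<bullet> h) > 0"
      using pos by (intro mult_pos_pos divide_pos_pos) auto
    ultimately show False by linarith
  qed
  then show thesis using that[of u m] nu by (simp add: h_def)
qed

text \<open>Orthonormal sets of eigenvectors are independent, so their size is bounded and one of
  maximal size exists. By symmetry its orthogonal complement is invariant; were the span not
  everything, the complement would contain a further unit eigenvector.\<close>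

theorem symmetric_matrix_eigenbasis:
  fixes Q :: "real^'d^'d"
  assumes sym: "transpose Q = Q"
  obtains E where "orthonormal_eigenvectors Q E" "finite E" "span E = UNIV"
proof -
  let ?P = "\<lambda>E. orthonormal_eigenvectors Q E"
  have bound: "?P E \<Longrightarrow> finite E \<and> card E \<le> DIM(real^'d)" for E
    using orthonormal_eigenvectors_independent independent_bound by blast
  have "?P {}" by (simp add: orthonormal_eigenvectors_def)
  then obtain E where E: "?P E" and mx: "\<And>D. ?P D \<Longrightarrow> card D \<le> card E"
    using ex_has_greatest_nat[of ?P "{}" card "DIM(real^'d) + 1"] bound
    by (metis add.commute less_Suc_eq_le plus_1_eq_Suc)
  have "span E = UNIV"
  proof (rule ccontr)
    assume ne: "span E \<noteq> UNIV"
    define U where "U = {x. \<forall>b\<in>E. b \<bullet> x = 0}"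
    have sub: "subspace U" unfolding U_def subspace_def by (auto simp: inner_add_right)
    from span_not_UNIV_orthogonal[OF ne]
    obtain a where a: "a \<noteq> 0" "\<forall>x\<in>span E. a \<bullet> x = 0" by (elim exE conjE)
    then have "a \<in> U" unfolding U_def using span_base[of _ E] by (auto simp: inner_commute[of _ a])
    then have "U \<noteq> {0}" using a by auto
    moreover have "Q *v x \<in> U" if "x \<in> U" for x
    proof -
      have "b \<bullet> (Q *v x) = 0" if b: "b \<in> E" for b
      proof -
        obtain \<mu> where "Q *v b = \<mu> *\<^sub>R b" using E b unfolding orthonormal_eigenvectors_def by blast
        then show ?thesis using \<open>x \<in> U\<close> b inner_matrix_vector_symmetric[OF sym, of b x] by (auto simp: U_def)
      qed
      then show ?thesis by (simp add: U_def)
    qed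
    ultimately obtain u \<mu> where u: "u \<in> U" "norm u = 1" "Q *v u = \<mu> *\<^sub>R u"
      using symmetric_eigenvector_in_invariant_subspace[OF sym sub] by blast
    have "?P (insert u E)"
      using E u unfolding orthonormal_eigenvectors_def U_def
      by (auto simp: pairwise_insert orthogonal_def inner_commute)
    moreover have "u \<notin> E"
    proof
      assume "u \<in> E"
      then have "u \<bullet> u = 0" using u by (auto simp: U_def)
      then show False using u by simp
    qed
    ultimately show False using mx[of "insert u E"] bound[OF E] by simp
  qed
  then show thesis using that E bound by blast
qed

lemma eigenbasis_eqI:
  fixes S T :: "real^'d^'d"
  assumes "span E = UNIV" "\<And>e. e \<in> E \<Longrightarrow> S *v e = T *v e"
  shows "S = T"
proof -
  have "S *v x = T *v x" for x
    using linear_eq_on_span[of "(*v) S" "(*v) T" E] assms by auto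
  then show ?thesis by (simp add: matrix_eq)
qed

text \<open>The predicate under \<open>THE\<close> in \<open>psd_sqrt\<close>. The description has a
  known value only after existence and uniqueness of such a root.\<close>

definition is_psd_sqrt :: "real^'d^'d \<Rightarrow> real^'d^'d \<Rightarrow> bool" where
  "is_psd_sqrt Q S \<longleftrightarrow> transpose S = S \<and> (\<forall>v. 0 \<le> v \<bullet> (S *v v)) \<and> S ** S = Q"

text \<open>\<open>S\<close> is compared with \<open>T\<close> on an eigenbasis of \<open>T\<close>.
  If \<open>T *v e = \<nu> *\<^sub>R e\<close>, then \<open>w = S *v e - \<nu> *\<^sub>R e\<close>
  satisfies \<open>S *v w = - \<nu> *\<^sub>R w\<close>, because both squares equal
  \<open>Q\<close>. For \<open>\<nu> > 0\<close> positivity of \<open>S\<close> forces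
  \<open>w = 0\<close>; for \<open>\<nu> = 0\<close> the squared norm of \<open>S *v e\<close> is
  the inner product of \<open>e\<close> with \<open>S *v (S *v e) = 0\<close>.\<close>

lemma psd_sqrt_unique:
  fixes Q S T :: "real^'d^'d"
  assumes S: "is_psd_sqrt Q S" and T: "is_psd_sqrt Q T"
  shows "S = T"
proof -
  obtain E where E: "orthonormal_eigenvectors T E" "span E = UNIV"
    using symmetric_matrix_eigenbasis T unfolding is_psd_sqrt_def by metis
  show ?thesis
  proof (rule eigenbasis_eqI[OF E(2)])
    fix e assume "e \<in> E"
    then obtain \<nu> where e: "norm e = 1" "T *v e = \<nu> *\<^sub>R e"
      using E(1) unfolding orthonormal_eigenvectors_def by blast
    have ee: "e \<bullet> e = 1" using e by (simp add: dot_square_norm)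
    have nu: "\<nu> \<ge> 0" using T e ee unfolding is_psd_sqrt_def by (metis inner_scaleR_right mult.right_neutral)
    have "S *v (S *v e) = Q *v e" using S unfolding is_psd_sqrt_def by (metis matrix_vector_mul_assoc)
    also have "\<dots> = T *v (T *v e)" using T unfolding is_psd_sqrt_def by (metis matrix_vector_mul_assoc)
    also have "\<dots> = \<nu>\<^sup>2 *\<^sub>R e" by (simp add: e matrix_vector_mult_scaleR power2_eq_square)
    finally have SS: "S *v (S *v e) = \<nu>\<^sup>2 *\<^sub>R e" .
    define w where "w = S *v e - \<nu> *\<^sub>R e"
    have Sw: "S *v w = - \<nu> *\<^sub>R w"
      unfolding w_def by (simp add: matrix_vector_mult_diff_distrib matrix_vector_mult_scaleR SS power2_eq_square
          scaleR_diff_right)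
    have "0 \<le> w \<bullet> (S *v w)" using S unfolding is_psd_sqrt_def by blast
    then have "\<nu> * (w \<bullet> w) \<le> 0" by (simp add: Sw)
    then have "w = 0"
    proof (cases "\<nu> = 0")
      case True
      have "(S *v e) \<bullet> (S *v e) = e \<bullet> (S *v (S *v e))"
        using inner_matrix_vector_symmetric[of S e "S *v e"] S unfolding is_psd_sqrt_def by simp
      then have "S *v e = 0" using SS True by simp
      then show ?thesis by (simp add: w_def True)
    next
      case False
      then show ?thesis using nu \<open>\<nu> * (w \<bullet> w) \<le> 0\<close>
        by (metis inner_eq_zero_iff inner_ge_zero less_le mult_pos_pos not_le)
    qed
    then show "S *v e = T *v e" by (simp add: w_def e)
  qed
qed

text \<open>In the spectral decomposition of \<open>Q\<close> each eigenvalue, nonnegative by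
  assumption, is replaced by its square root.\<close>

lemma psd_sqrt_exists:
  fixes Q :: "real^'d^'d"
  assumes sym: "transpose Q = Q" and psd: "\<And>v. 0 \<le> v \<bullet> (Q *v v)"
  shows "\<exists>S. is_psd_sqrt Q S"
proof -
  obtain E where E: "orthonormal_eigenvectors Q E" "finite E" "span E = UNIV"
    using symmetric_matrix_eigenbasis[OF sym] by blast
  define \<mu> where "\<mu> e = e \<bullet> (Q *v e)" for e
  have ee: "e \<bullet> e' = (if e = e' then 1 else 0)" if "e \<in> E" "e' \<in> E" for e e'
    using E(1) that unfolding orthonormal_eigenvectors_def
    by (auto simp: pairwise_def orthogonal_def dot_square_norm)
  have mu: "Q *v e = \<mu> e *\<^sub>R e" "\<mu> e \<ge> 0" if e: "e \<in> E" for e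
  proof -
    obtain m where "Q *v e = m *\<^sub>R e" using E(1) e unfolding orthonormal_eigenvectors_def by blast
    moreover from this have "\<mu> e = m" using ee[OF e e] by (simp add: \<mu>_def)
    ultimately show "Q *v e = \<mu> e *\<^sub>R e" by simp
  qed (simp add: \<mu>_def psd)
  define f where "f x = (\<Sum>e\<in>E. (sqrt (\<mu> e) * (e \<bullet> x)) *\<^sub>R e)" for x
  have lin: "linear f"
    unfolding f_def by (intro linearI)
      (auto simp: inner_add_right algebra_simps sum.distrib scaleR_sum_right)
  have f: "matrix f *v x = f x" for x
    by (simp add: matrix_works lin)
  have sa: "x \<bullet> f y = f x \<bullet> y" for x y
    unfolding f_def by (simp add: inner_sum_left inner_sum_right inner_commute mult_ac)
  have fe: "f e = sqrt (\<mu> e) *\<^sub>R e" if e: "e \<in> E" for e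
  proof -
    have "f e = (\<Sum>e'\<in>E. if e' = e then sqrt (\<mu> e) *\<^sub>R e else 0)"
      unfolding f_def using ee e by (intro sum.cong) auto
    then show ?thesis using E(2) e by simp
  qed
  have "transpose (matrix f) = matrix f"
  proof -
    have "(transpose (matrix f) *v x) \<bullet> y = (matrix f *v x) \<bullet> y" for x y
      by (metis dot_lmul_matrix f sa transpose_matrix_vector)
    then show ?thesis by (metis matrix_eq vector_eq_rdot)
  qed
  moreover have "0 \<le> x \<bullet> (matrix f *v x)" for x
  proof -
    have "x \<bullet> (matrix f *v x) = (\<Sum>e\<in>E. sqrt (\<mu> e) * (e \<bullet> x)\<^sup>2)"
      unfolding f unfolding f_def by (simp add: inner_sum_right inner_commute power2_eq_square mult_ac)
    then show ?thesis using mu by (simp add: sum_nonneg)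
  qed
  moreover have "matrix f ** matrix f = Q"
    by (rule eigenbasis_eqI[OF E(3)])
      (simp add: matrix_vector_mul_assoc[symmetric] f fe mu linear_cmul[OF lin])
  ultimately show ?thesis unfolding is_psd_sqrt_def by blast
qed

lemma psd_sqrt_eqI:
  assumes "is_psd_sqrt Q S"
  shows "psd_sqrt Q = S"
  unfolding psd_sqrt_def using psd_sqrt_unique assms
  by (intro the_equality) (auto simp: is_psd_sqrt_def)

section \<open>The Gram matrix and its top singular vector\<close>

lemma inner_gram: "x \<bullet> ((transpose A ** A) *v y) = (A *v x) \<bullet> (A *v y)" for A :: "real^'d^'n"
  by (metis dot_lmul_matrix matrix_vector_mul_assoc transpose_matrix_vector transpose_transpose)

lemma is_psd_sqrt_psd_sqrt_gram: "is_psd_sqrt (transpose A ** A) (psd_sqrt (transpose A ** A))"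
  for A :: "real^'d^'n"
proof -
  have "\<exists>S. is_psd_sqrt (transpose A ** A) S"
    by (rule psd_sqrt_exists) (simp_all add: matrix_transpose_mul inner_gram)
  then show ?thesis using psd_sqrt_eqI by metis
qed

text \<open>Pulls a state-dependent scalar out of the root, so that the diffusion matrix becomes a
  scalar function of the state times one fixed matrix.\<close>

lemma psd_sqrt_scaleR:
  assumes "is_psd_sqrt Q S" "c \<ge> 0"
  shows "psd_sqrt (c\<^sup>2 *\<^sub>R Q) = c *\<^sub>R S"
  using assms
  by (intro psd_sqrt_eqI)
    (auto simp: is_psd_sqrt_def transpose_scalar scaleR_matrix_vector_assoc[symmetric]
      scalar_matrix_assoc matrix_scalar_ac power2_eq_square)

text \<open>\<open>Max\<close> in \<open>top_singular_value\<close> is meaningful only on a finite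
  nonempty set. Any eigenvector has a nonzero inner product with some member of the eigenbasis, and
  by symmetry two non-orthogonal eigenvectors share their eigenvalue; this gives finiteness.\<close>

lemma AtA_eigenvalues_finite_nonempty:
  fixes A :: "real^'d^'n"
  shows "finite (AtA_eigenvalues A)" "AtA_eigenvalues A \<noteq> {}"
proof -
  let ?Q = "transpose A ** A"
  have sym: "transpose ?Q = ?Q" by (simp add: matrix_transpose_mul)
  obtain E where E: "orthonormal_eigenvectors ?Q E" "finite E" "span E = UNIV"
    using symmetric_matrix_eigenbasis[OF sym] by blast
  obtain \<mu> where mu: "\<And>e. e \<in> E \<Longrightarrow> ?Q *v e = \<mu> e *\<^sub>R e"
    using E(1) unfolding orthonormal_eigenvectors_def by metis
  have "AtA_eigenvalues A \<subseteq> \<mu> ` E"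
  proof
    fix m assume "m \<in> AtA_eigenvalues A"
    then obtain x where x: "x \<noteq> 0" "?Q *v x = m *\<^sub>R x" unfolding AtA_eigenvalues_def by blast
    have "\<exists>e\<in>E. e \<bullet> x \<noteq> 0"
    proof (rule ccontr)
      assume "\<not> ?thesis"
      then have "orthogonal x y" if "y \<in> span E" for y
        using orthogonal_to_span[OF that, of x] by (auto simp: orthogonal_def inner_commute)
      then have "orthogonal x x" using E(3) by auto
      then show False using x by (simp add: orthogonal_def)
    qed
    then obtain e where e: "e \<in> E" "e \<bullet> x \<noteq> 0" by blast
    have "e \<bullet> (?Q *v x) = (?Q *v e) \<bullet> x" by (rule inner_matrix_vector_symmetric[OF sym])
    then have "m = \<mu> e" using e x mu by simp
    then show "m \<in> \<mu> ` E" using e by blast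
  qed
  then show "finite (AtA_eigenvalues A)" using E(2) finite_surj by blast
  have "E \<noteq> {}"
  proof
    assume "E = {}"
    then have "(UNIV :: (real^'d) set) = {0}" using E(3) by simp
    then have "axis undefined 1 = (0 :: real^'d)" by blast
    then show False by (simp add: axis_eq_0_iff)
  qed
  then obtain e where "e \<in> E" by blast
  then have "\<mu> e \<in> AtA_eigenvalues A"
    using mu E(1) unfolding AtA_eigenvalues_def orthonormal_eigenvectors_def by (auto intro!: exI[of _ e])
  then show "AtA_eigenvalues A \<noteq> {}" by blast
qed

lemma top_singular_vector:
  fixes A :: "real^'d^'n"
  obtains v where "norm v = 1" "(transpose A ** A) *v v = (top_singular_value A)\<^sup>2 *\<^sub>R v"
    "top_singular_value A \<in> singular_values A"
proof -
  have "top_singular_value A \<in> singular_values A"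
    unfolding top_singular_value_def singular_values_def
    using AtA_eigenvalues_finite_nonempty[of A] by (intro Max_in) auto
  moreover from this obtain \<mu> v where v: "top_singular_value A = sqrt \<mu>" "v \<noteq> 0"
      "(transpose A ** A) *v v = \<mu> *\<^sub>R v"
    unfolding singular_values_def AtA_eigenvalues_def by blast
  \<comment> \<open>The sign of \<open>\<mu>\<close> is what turns the square of
    \<open>sqrt \<mu>\<close> back into \<open>\<mu>\<close>.\<close>
  have "\<mu> * (v \<bullet> v) = (A *v v) \<bullet> (A *v v)" using inner_gram[of v A v] v by simp
  then have "\<mu> \<ge> 0" using v(2) by (metis inner_ge_zero inner_gt_zero_iff mult_less_0_iff not_le)
  then have "(transpose A ** A) *v ((1 / norm v) *\<^sub>R v) = (top_singular_value A)\<^sup>2 *\<^sub>R ((1 / norm v) *\<^sub>R v)"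
    by (simp add: v matrix_vector_mult_scaleR)
  moreover have "norm ((1 / norm v) *\<^sub>R v) = 1" using v by simp
  ultimately show thesis using that by blast
qed

section \<open>Brownian increments\<close>

lemma vec_nth_borel_measurable [measurable]: "(\<lambda>x::real^'d. x $ k) \<in> borel_measurable borel"
  by (intro borel_measurable_continuous_onI continuous_intros)

text \<open>Preimages of Borel sets form an intersection-stable generator, so the product rule on
  them extends to the generated sigma-algebras.\<close>

lemma (in prob_space) indep_varI_prob:
  assumes "X \<in> borel_measurable M" "Y \<in> borel_measurable M"
    and "\<And>A C. A \<in> sets borel \<Longrightarrow> C \<in> sets borel \<Longrightarrow>
      prob ((X -` A \<inter> space M) \<inter> (Y -` C \<inter> space M)) = prob (X -` A \<inter> space M) * prob (Y -` C \<inter> space M)"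
  shows "indep_var borel X borel Y"
proof -
  have st: "Int_stable {Z -` A \<inter> space M |A. A \<in> sets borel}" for Z :: "'a \<Rightarrow> 'z::topological_space"
  proof (rule Int_stableI)
    fix P Q assume "P \<in> {Z -` A \<inter> space M |A. A \<in> sets borel}" "Q \<in> {Z -` A \<inter> space M |A. A \<in> sets borel}"
    then obtain A C where "P = Z -` A \<inter> space M" "Q = Z -` C \<inter> space M" "A \<in> sets borel" "C \<in> sets borel"
      by blast
    then show "P \<inter> Q \<in> {Z -` A \<inter> space M |A. A \<in> sets borel}"
      by (auto intro!: exI[of _ "A \<inter> C"])
  qed
  show ?thesis unfolding indep_var_eq
    using assms st by (intro conjI indep_set_sigma_sets indep_setI) (auto intro: measurable_sets)
qed

lemma nn_integral_normal_density: "\<sigma> > 0 \<Longrightarrow> (\<integral>\<^sup>+x. ennreal (normal_density 0 \<sigma> x) \<partial>lborel) = 1"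
  using prob_space.emeasure_space_1[OF prob_space_normal_density[of \<sigma> 0]]
  by (simp add: emeasure_density)

locale brownian =
  fixes M :: "'a measure" and F :: "real \<Rightarrow> 'a measure" and W :: "real \<Rightarrow> 'a \<Rightarrow> real^'d"
  assumes BM: "brownian_motion M F W"
begin

sublocale prob_space M
  using BM by (simp add: brownian_motion_def)

lemma filtration_space: "space (F s) = space M"
  using BM by (auto simp: brownian_motion_def filtration_on_def subalgebra_def)

lemma filtration_sets_mono: "s \<le> t \<Longrightarrow> sets (F s) \<subseteq> sets (F t)"
  using BM by (auto simp: brownian_motion_def filtration_on_def)

lemma adapted_measurable: "Y \<in> borel_measurable (F s) \<Longrightarrow> Y \<in> borel_measurable M"
  using BM by (auto simp: brownian_motion_def filtration_on_def intro: measurable_from_subalg)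

lemma adapted_mono: "Y \<in> borel_measurable (F s) \<Longrightarrow> s \<le> t \<Longrightarrow> Y \<in> borel_measurable (F t)"
  by (rule measurable_from_subalg[of "F t" "F s"])
    (auto simp: subalgebra_def filtration_space filtration_sets_mono)

lemma brownian_adapted: "0 \<le> t \<Longrightarrow> W t \<in> borel_measurable (F t)"
  using BM by (auto simp: brownian_motion_def)

lemma brownian_measurable [measurable]: "0 \<le> t \<Longrightarrow> W t \<in> borel_measurable M"
  using brownian_adapted adapted_measurable by blast

lemma measurable_increment: "0 \<le> s \<Longrightarrow> s < t \<Longrightarrow> (\<lambda>\<omega>. W t \<omega> - W s \<omega>) \<in> borel_measurable M"
  by (intro borel_measurable_diff brownian_measurable) auto

text \<open>The definition of Brownian motion speaks of single events of \<open>F s\<close>. Applied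
  to preimages under \<open>Y\<close>, it gives independence of real random variables, which lets
  expectations of products factor.\<close>

lemma increment_indep:
  fixes Y :: "'a \<Rightarrow> real" and f :: "real^'d \<Rightarrow> real"
  assumes st: "0 \<le> s" "s < t" and Y: "Y \<in> borel_measurable (F s)" and f[measurable]: "f \<in> borel_measurable borel"
  shows "indep_var borel Y borel (\<lambda>\<omega>. f (W t \<omega> - W s \<omega>))"
proof (rule indep_varI_prob)
  show "Y \<in> borel_measurable M" using Y by (rule adapted_measurable)
  show "(\<lambda>\<omega>. f (W t \<omega> - W s \<omega>)) \<in> borel_measurable M" using st measurable_increment[OF st] by measurable
  fix A C :: "real set" assume A: "A \<in> sets borel" and C: "C \<in> sets borel"
  have "Y -` A \<inter> space M \<in> sets (F s)"
    using measurable_sets[OF Y A] by (simp add: filtration_space)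
  moreover have "f -` C \<in> sets borel" using measurable_sets[OF f C] by simp
  moreover have "(\<lambda>\<omega>. f (W t \<omega> - W s \<omega>)) -` C = (\<lambda>\<omega>. W t \<omega> - W s \<omega>) -` (f -` C)" by auto
  ultimately show "prob ((Y -` A \<inter> space M) \<inter> ((\<lambda>\<omega>. f (W t \<omega> - W s \<omega>)) -` C \<inter> space M)) =
      prob (Y -` A \<inter> space M) * prob ((\<lambda>\<omega>. f (W t \<omega> - W s \<omega>)) -` C \<inter> space M)"
    using BM st unfolding brownian_motion_def by simp
qed

text \<open>Tonelli for the product density. Lebesgue measure on \<open>real^'d\<close> factors over
  \<open>Basis\<close>, whereas the density is indexed by coordinates; \<open>axis\<close> and its
  inverse \<open>ix\<close> translate between the two.\<close>

lemma nn_integral_increment_prod: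
  fixes f :: "'d \<Rightarrow> real \<Rightarrow> ennreal"
  assumes st: "0 \<le> s" "s < t" and [measurable]: "\<And>k. f k \<in> borel_measurable borel"
  shows "(\<integral>\<^sup>+\<omega>. (\<Prod>k\<in>UNIV. f k ((W t \<omega> - W s \<omega>) $ k)) \<partial>M) =
    (\<Prod>k\<in>UNIV. \<integral>\<^sup>+x. normal_density 0 (sqrt (t - s)) x * f k x \<partial>lborel)"
proof -
  let ?n = "normal_density 0 (sqrt (t - s))"
  let ?ax = "\<lambda>k::'d. axis k (1::real)"
  define ix where "ix = inv_into UNIV ?ax"
  have inj: "inj ?ax" by (auto simp: inj_on_def axis_eq_axis)
  have ix: "ix (?ax k) = k" for k unfolding ix_def by (rule inv_f_f[OF inj])
  have B: "(Basis :: (real^'d) set) = range ?ax" by (auto simp: Basis_vec_def)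
  have [measurable]: "(\<lambda>\<omega>. W t \<omega> - W s \<omega>) \<in> borel_measurable M" using st measurable_increment[OF st] by measurable
  have "(\<integral>\<^sup>+\<omega>. (\<Prod>k\<in>UNIV. f k ((W t \<omega> - W s \<omega>) $ k)) \<partial>M) =
      (\<integral>\<^sup>+x. (\<Prod>k\<in>UNIV. f k (x $ k)) \<partial>distr M borel (\<lambda>\<omega>. W t \<omega> - W s \<omega>))"
    by (subst nn_integral_distr) auto
  also have "distr M borel (\<lambda>\<omega>. W t \<omega> - W s \<omega>) = density lborel (\<lambda>x. ennreal (\<Prod>k\<in>UNIV. ?n (x $ k)))"
    using BM st unfolding brownian_motion_def by blast
  also have "(\<integral>\<^sup>+x. (\<Prod>k\<in>UNIV. f k (x $ k)) \<partial>density lborel (\<lambda>x. ennreal (\<Prod>k\<in>UNIV. ?n (x $ k)))) =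
      (\<integral>\<^sup>+x. (\<Prod>k\<in>UNIV. ?n (x $ k) * f k (x $ k)) \<partial>lborel)"
    by (subst nn_integral_density) (auto simp: prod_ennreal[symmetric] prod.distrib)
  also have "\<dots> = (\<integral>\<^sup>+x. (\<Prod>b\<in>Basis. (\<lambda>y. ?n y * f (ix b) y) (x \<bullet> b)) \<partial>lborel)"
    unfolding B by (subst prod.reindex) (auto simp: inj ix inner_axis)
  also have "\<dots> = (\<Prod>b\<in>Basis. \<integral>\<^sup>+y. ?n y * f (ix b) y \<partial>lborel)"
    by (rule nn_integral_lborel_prod) auto
  also have "\<dots> = (\<Prod>k\<in>UNIV. \<integral>\<^sup>+y. ?n y * f k y \<partial>lborel)"
    unfolding B by (subst prod.reindex) (auto simp: inj ix)
  finally show ?thesis .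
qed

lemma increment_component_distr:
  assumes st: "0 \<le> s" "s < t"
  shows "distr M borel (\<lambda>\<omega>. (W t \<omega> - W s \<omega>) $ k) = density lborel (normal_density 0 (sqrt (t - s)))"
proof (rule measure_eqI)
  fix A assume "A \<in> sets (distr M borel (\<lambda>\<omega>. (W t \<omega> - W s \<omega>) $ k))"
  then have A[measurable]: "A \<in> sets borel" by simp
  have [measurable]: "(\<lambda>\<omega>. (W t \<omega> - W s \<omega>) $ k) \<in> borel_measurable M" using st measurable_increment[OF st] by measurable
  let ?f = "\<lambda>l::'d. if l = k then indicator A else (\<lambda>_::real. 1::ennreal)"
  have "emeasure (distr M borel (\<lambda>\<omega>. (W t \<omega> - W s \<omega>) $ k)) A =
      (\<integral>\<^sup>+x. indicator A x \<partial>distr M borel (\<lambda>\<omega>. (W t \<omega> - W s \<omega>) $ k))"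
    by simp
  also have "\<dots> = (\<integral>\<^sup>+\<omega>. indicator A ((W t \<omega> - W s \<omega>) $ k) \<partial>M)"
    by (rule nn_integral_distr) measurable
  also have "\<dots> = (\<integral>\<^sup>+\<omega>. (\<Prod>l\<in>UNIV. ?f l ((W t \<omega> - W s \<omega>) $ l)) \<partial>M)"
    by (intro nn_integral_cong, subst prod.remove[of _ k]) auto
  also have "\<dots> = (\<Prod>l\<in>UNIV. \<integral>\<^sup>+x. normal_density 0 (sqrt (t - s)) x * ?f l x \<partial>lborel)"
    by (rule nn_integral_increment_prod[OF st]) auto
  also have "\<dots> = (\<integral>\<^sup>+x. ennreal (normal_density 0 (sqrt (t - s)) x) * indicator A x \<partial>lborel)"
    using st by (subst prod.remove[of _ k]) (auto simp: nn_integral_normal_density)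
  also have "\<dots> = emeasure (density lborel (normal_density 0 (sqrt (t - s)))) A"
    by (subst emeasure_density) auto
  finally show "emeasure (distr M borel (\<lambda>\<omega>. (W t \<omega> - W s \<omega>) $ k)) A =
      emeasure (density lborel (normal_density 0 (sqrt (t - s)))) A" .
qed simp

lemma increment_components_indep:
  assumes st: "0 \<le> s" "s < t" and kl: "k \<noteq> l"
  shows "indep_var borel (\<lambda>\<omega>. (W t \<omega> - W s \<omega>) $ k) borel (\<lambda>\<omega>. (W t \<omega> - W s \<omega>) $ l)"
proof (rule indep_varI_prob)
  show m: "(\<lambda>\<omega>. (W t \<omega> - W s \<omega>) $ k) \<in> borel_measurable M" "(\<lambda>\<omega>. (W t \<omega> - W s \<omega>) $ l) \<in> borel_measurable M"
    using st measurable_increment[OF st] by measurable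
  fix A C :: "real set" assume A[measurable]: "A \<in> sets borel" and C[measurable]: "C \<in> sets borel"
  note [measurable] = m
  let ?n = "normal_density 0 (sqrt (t - s))"
  let ?f = "\<lambda>A C. \<lambda>j::'d. if j = k then indicator A else if j = l then indicator C else (\<lambda>_::real. 1::ennreal)"
  let ?I = "\<lambda>A. \<integral>\<^sup>+x. ennreal (?n x) * indicator A x \<partial>lborel"
  have *: "emeasure M (((\<lambda>\<omega>. (W t \<omega> - W s \<omega>) $ k) -` A \<inter> space M) \<inter> ((\<lambda>\<omega>. (W t \<omega> - W s \<omega>) $ l) -` C \<inter> space M)) =
      ?I A * ?I C" (is "emeasure M (?E A C) = _")
    if [measurable]: "A \<in> sets borel" "C \<in> sets borel" for A C
  proof -
    have "emeasure M (?E A C) = (\<integral>\<^sup>+\<omega>. indicator A ((W t \<omega> - W s \<omega>) $ k) * indicator C ((W t \<omega> - W s \<omega>) $ l) \<partial>M)"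
      by (subst nn_integral_indicator[symmetric], measurable)
        (auto simp: indicator_def intro!: nn_integral_cong)
    also have "\<dots> = (\<integral>\<^sup>+\<omega>. (\<Prod>j\<in>UNIV. ?f A C j ((W t \<omega> - W s \<omega>) $ j)) \<partial>M)"
      using kl by (intro nn_integral_cong, subst prod.remove[of _ k], simp, simp, subst prod.remove[of _ l]) auto
    also have "\<dots> = (\<Prod>j\<in>UNIV. \<integral>\<^sup>+x. ?n x * ?f A C j x \<partial>lborel)"
      by (rule nn_integral_increment_prod[OF st]) auto
    also have "\<dots> = ?I A * ?I C"
      using kl st
      by (subst prod.remove[of _ k], simp, simp, subst prod.remove[of _ l]) (auto simp: nn_integral_normal_density)
    finally show ?thesis .
  qed
  have U: "?I UNIV = 1" using st by (simp add: nn_integral_normal_density)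
  \<comment> \<open>Taking \<open>UNIV\<close> for one of the two sets identifies each factor as a
    marginal probability.\<close>
  have "emeasure M (?E A C) = emeasure M (?E A UNIV) * emeasure M (?E UNIV C)"
    using *[of A C] *[of A UNIV] *[of UNIV C] U by simp
  then show "prob (?E A C) = prob ((\<lambda>\<omega>. (W t \<omega> - W s \<omega>) $ k) -` A \<inter> space M) * prob ((\<lambda>\<omega>. (W t \<omega> - W s \<omega>) $ l) -` C \<inter> space M)"
    by (simp add: measure_def enn2real_mult Int_absorb1 del: vector_minus_component)
qed

lemma increment_component_moment:
  assumes st: "0 \<le> s" "s < t"
  shows "integrable M (\<lambda>\<omega>. ((W t \<omega> - W s \<omega>) $ k) ^ j)"
    and "expectation (\<lambda>\<omega>. ((W t \<omega> - W s \<omega>) $ k) ^ j) = (\<integral>x. normal_density 0 (sqrt (t - s)) x * x ^ j \<partial>lborel)"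
proof -
  have [measurable]: "(\<lambda>\<omega>. (W t \<omega> - W s \<omega>) $ k) \<in> borel_measurable M" using st measurable_increment[OF st] by measurable
  have "integrable (density lborel (normal_density 0 (sqrt (t - s)))) (\<lambda>x. x ^ j)"
    using integrable_normal_moment[of "sqrt (t - s)" 0 j] st by (subst integrable_density) auto
  then show "integrable M (\<lambda>\<omega>. ((W t \<omega> - W s \<omega>) $ k) ^ j)"
    unfolding increment_component_distr[OF st, symmetric, of k]
    by (subst (asm) integrable_distr_eq) (auto simp del: vector_minus_component)
  have "expectation (\<lambda>\<omega>. ((W t \<omega> - W s \<omega>) $ k) ^ j) =
      (\<integral>x. x ^ j \<partial>distr M borel (\<lambda>\<omega>. (W t \<omega> - W s \<omega>) $ k))"
    by (subst integral_distr) (auto simp del: vector_minus_component)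
  then show "expectation (\<lambda>\<omega>. ((W t \<omega> - W s \<omega>) $ k) ^ j) = (\<integral>x. normal_density 0 (sqrt (t - s)) x * x ^ j \<partial>lborel)"
    unfolding increment_component_distr[OF st] by (subst (asm) integral_density) auto
qed

lemma increment_component_moments:
  assumes st: "0 \<le> s" "s < t"
  shows "expectation (\<lambda>\<omega>. (W t \<omega> - W s \<omega>) $ k) = 0"
    and "expectation (\<lambda>\<omega>. ((W t \<omega> - W s \<omega>) $ k)\<^sup>2) = t - s"
    and "expectation (\<lambda>\<omega>. ((W t \<omega> - W s \<omega>) $ k) ^ 4) = 3 * (t - s)\<^sup>2"
proof -
  have p: "0 < sqrt (t - s)" using st by simp
  show "expectation (\<lambda>\<omega>. (W t \<omega> - W s \<omega>) $ k) = 0"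
    using increment_component_moment(2)[OF st, of k 1] integral_normal_moment_odd[OF p, of 0 0] by simp
  show "expectation (\<lambda>\<omega>. ((W t \<omega> - W s \<omega>) $ k)\<^sup>2) = t - s"
    using increment_component_moment(2)[OF st, of k 2] integral_normal_moment_even[OF p, of 0 1] st by simp
  show "expectation (\<lambda>\<omega>. ((W t \<omega> - W s \<omega>) $ k) ^ 4) = 3 * (t - s)\<^sup>2"
    using increment_component_moment(2)[OF st, of k 4] integral_normal_moment_even[OF p, of 0 2] st
    by (simp add: fact_numeral power_divide field_simps)
qed

section \<open>Grid increments and martingale sums\<close>

definition dW :: "real \<Rightarrow> nat \<Rightarrow> 'a \<Rightarrow> real^'d" where
  "dW h j \<omega> = W (real (Suc j) * h) \<omega> - W (real j * h) \<omega>"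

text \<open>Covers both noises that occur: a component of an increment, with variance
  \<open>h\<close>, and a product of two components minus its mean, with variance of order
  \<open>h\<^sup>2\<close>. \<open>v\<close> is an upper bound for the variance, not its
  value.\<close>

definition centred_noise :: "real \<Rightarrow> (real^'d \<Rightarrow> real) \<Rightarrow> real \<Rightarrow> bool" where
  "centred_noise h z v \<longleftrightarrow> h > 0 \<and> v \<ge> 0 \<and> z \<in> borel_measurable borel \<and>
     (\<forall>j. integrable M (\<lambda>\<omega>. (z (dW h j \<omega>))\<^sup>2) \<and> expectation (\<lambda>\<omega>. z (dW h j \<omega>)) = 0 \<and>
        expectation (\<lambda>\<omega>. (z (dW h j \<omega>))\<^sup>2) \<le> v)"

lemma dW_measurable [measurable]: "h \<ge> 0 \<Longrightarrow> dW h j \<in> borel_measurable M"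
  unfolding dW_def by measurable

lemma dW_adapted: "h \<ge> 0 \<Longrightarrow> dW h j \<in> borel_measurable (F (real (Suc j) * h))"
  unfolding dW_def
  by (intro borel_measurable_diff brownian_adapted adapted_mono[OF brownian_adapted, of "real j * h"])
    (auto intro!: mult_right_mono)

lemma dW_times: "h > 0 \<Longrightarrow> 0 \<le> real j * h" "h > 0 \<Longrightarrow> real j * h < real (Suc j) * h"
  "real (Suc j) * h - real j * h = h"
  by (auto simp: algebra_simps)

lemma centred_noise_component:
  assumes "h > 0"
  shows "centred_noise h (\<lambda>x. x $ k) h"
  unfolding centred_noise_def dW_def
  using assms increment_component_moments(1,2)[OF dW_times(1,2)[OF assms]]
    increment_component_moment(1)[OF dW_times(1,2)[OF assms], of _ k 2]
  by (simp add: dW_times(3) del: of_nat_Suc)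

text \<open>The constant 8: \<open>(x * y - c)\<^sup>2 \<le> x ^ 4 + y ^ 4 + 2 * h\<^sup>2\<close>,
  and a centred Gaussian of variance \<open>h\<close> has fourth moment
  \<open>3 * h\<^sup>2\<close>. Off the diagonal the mean vanishes because distinct components are
  independent.\<close>

lemma centred_noise_product:
  assumes h: "h > 0"
  shows "centred_noise h (\<lambda>x. x $ k * x $ l - (if k = l then h else 0)) (8 * h\<^sup>2)"
proof -
  have "integrable M (\<lambda>\<omega>. (dW h j \<omega> $ k * dW h j \<omega> $ l - (if k = l then h else 0))\<^sup>2) \<and>
     expectation (\<lambda>\<omega>. dW h j \<omega> $ k * dW h j \<omega> $ l - (if k = l then h else 0)) = 0 \<and>
     expectation (\<lambda>\<omega>. (dW h j \<omega> $ k * dW h j \<omega> $ l - (if k = l then h else 0))\<^sup>2) \<le> 8 * h\<^sup>2" for j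
  proof -
    note st = dW_times(1,2)[OF h, of j]
    have [measurable]: "dW h j \<in> borel_measurable M" using h by simp
    define x where "x \<omega> = dW h j \<omega> $ k" for \<omega>
    define y where "y \<omega> = dW h j \<omega> $ l" for \<omega>
    define c where "c = (if k = l then h else 0)"
    have [measurable]: "x \<in> borel_measurable M" "y \<in> borel_measurable M" unfolding x_def y_def by measurable
    have c: "0 \<le> c" "c\<^sup>2 \<le> h\<^sup>2" using h by (auto simp: c_def)
    have mom: "integrable M (\<lambda>\<omega>. x \<omega> ^ i)" "integrable M (\<lambda>\<omega>. y \<omega> ^ i)"
      "expectation x = 0" "expectation y = 0" "expectation (\<lambda>\<omega>. (x \<omega>)\<^sup>2) = h"
      "expectation (\<lambda>\<omega>. x \<omega> ^ 4) = 3 * h\<^sup>2" "expectation (\<lambda>\<omega>. y \<omega> ^ 4) = 3 * h\<^sup>2" for i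
      unfolding x_def y_def dW_def
      using increment_component_moment(1)[OF st] increment_component_moments[OF st] by (simp_all only: dW_times(3))
    have b4: "(x \<omega> * y \<omega>)\<^sup>2 \<le> (x \<omega> ^ 4 + y \<omega> ^ 4) / 2" for \<omega>
      using sum_squares_bound[of "(x \<omega>)\<^sup>2" "(y \<omega>)\<^sup>2"] by (simp add: power_mult_distrib flip: power_mult)
    have bd: "(x \<omega> * y \<omega> - c)\<^sup>2 \<le> x \<omega> ^ 4 + y \<omega> ^ 4 + 2 * h\<^sup>2" for \<omega>
    proof -
      have "(x \<omega> * y \<omega> - c)\<^sup>2 \<le> 2 * (x \<omega> * y \<omega>)\<^sup>2 + 2 * c\<^sup>2"
        using sum_squares_bound[of "x \<omega> * y \<omega>" "- c"] by (simp add: power2_diff)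
      also have "\<dots> \<le> (x \<omega> ^ 4 + y \<omega> ^ 4) + 2 * h\<^sup>2"
        by (rule add_mono) (use b4[of \<omega>] c in auto)
      finally show ?thesis .
    qed
    have ib: "integrable M (\<lambda>\<omega>. x \<omega> ^ 4 + y \<omega> ^ 4 + 2 * h\<^sup>2)" using mom by simp
    have i2: "integrable M (\<lambda>\<omega>. (x \<omega> * y \<omega> - c)\<^sup>2)"
      by (rule Bochner_Integration.integrable_bound[OF ib]) (use bd in \<open>auto intro: order_trans[OF bd]\<close>)
    have "expectation (\<lambda>\<omega>. (x \<omega> * y \<omega> - c)\<^sup>2) \<le> expectation (\<lambda>\<omega>. x \<omega> ^ 4 + y \<omega> ^ 4 + 2 * h\<^sup>2)"
      by (rule integral_mono[OF i2 ib]) (rule bd)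
    also have "\<dots> = 8 * h\<^sup>2" using mom by (simp add: prob_space)
    finally have e2: "expectation (\<lambda>\<omega>. (x \<omega> * y \<omega> - c)\<^sup>2) \<le> 8 * h\<^sup>2" .
    have "expectation (\<lambda>\<omega>. x \<omega> * y \<omega> - c) = 0"
    proof (cases "k = l")
      case True
      then have "x = y" by (simp add: x_def y_def fun_eq_iff)
      then show ?thesis using mom(1)[of 2] mom(5) True by (simp add: c_def prob_space power2_eq_square)
    next
      case False
      have "indep_var borel x borel y"
        unfolding x_def y_def dW_def using increment_components_indep[OF st False] .
      from indep_var_lebesgue_integral[OF this] show ?thesis
        using mom(1)[of 1] mom(2)[of 1] mom(3,4) False by (simp add: c_def)
    qed
    then show ?thesis using i2 e2 unfolding x_def y_def c_def by blast
  qed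
  then show ?thesis unfolding centred_noise_def using h by auto
qed

text \<open>The Ito isometry in discrete form. The coefficient and the partial sum are known at the
  left end of a cell, hence independent of the noise in that cell; so the cross term has mean zero
  and the variances add. The bound \<open>K\<close> makes all products integrable. Adaptedness of
  the partial sum is part of the claim because the induction step uses it.\<close>

lemma martingale_sum_second_moment:
  fixes c :: "nat \<Rightarrow> 'a \<Rightarrow> real"
  assumes z: "centred_noise h z v" and c: "\<And>j. c j \<in> borel_measurable (F (real j * h))"
    and K: "\<And>j \<omega>. \<bar>c j \<omega>\<bar> \<le> K" and ab: "a \<le> b"
  defines "S \<equiv> \<lambda>b \<omega>. \<Sum>j=a..<b. c j \<omega> * z (dW h j \<omega>)"
  shows "S b \<in> borel_measurable (F (real b * h)) \<and> integrable M (\<lambda>\<omega>. (S b \<omega>)\<^sup>2) \<and>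
     expectation (S b) = 0 \<and> expectation (\<lambda>\<omega>. (S b \<omega>)\<^sup>2) \<le> real (b - a) * (K\<^sup>2 * v)"
  using ab
proof (induction b rule: dec_induct)
  case base
  then show ?case by (simp add: S_def)
next
  case (step b)
  from z have h: "h > 0" and v: "v \<ge> 0" and zm[measurable]: "z \<in> borel_measurable borel" by (auto simp: centred_noise_def)
  have cM[measurable]: "c j \<in> borel_measurable M" for j using c adapted_measurable by blast
  have dm[measurable]: "dW h j \<in> borel_measurable M" for j using h by simp
  let ?\<zeta> = "\<lambda>\<omega>. z (dW h b \<omega>)"
  have zz: "integrable M (\<lambda>\<omega>. (?\<zeta> \<omega>)\<^sup>2)" "expectation ?\<zeta> = 0" "expectation (\<lambda>\<omega>. (?\<zeta> \<omega>)\<^sup>2) \<le> v"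
    using z by (auto simp: centred_noise_def)
  have iz: "integrable M ?\<zeta>" by (rule square_integrable_imp_integrable) (use zz in auto)
  have Sm: "S b \<in> borel_measurable (F (real b * h))" and SM[measurable]: "S b \<in> borel_measurable M"
    using step.IH adapted_measurable by blast+
  have iS: "integrable M (S b)" by (rule square_integrable_imp_integrable) (use step.IH in auto)
  have SS: "S (Suc b) \<omega> = S b \<omega> + c b \<omega> * ?\<zeta> \<omega>" for \<omega>
    unfolding S_def using step.hyps by simp
  have K0: "K \<ge> 0" using K[of 0] by (meson abs_ge_zero order_trans)
  have isc: "integrable M (\<lambda>\<omega>. S b \<omega> * c b \<omega>)"
    by (rule Bochner_Integration.integrable_bound[where f="\<lambda>\<omega>. K * S b \<omega>"])
      (use iS K K0 in \<open>auto simp: abs_mult mult.commute[of K] intro!: mult_left_mono\<close>)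
  have ic: "integrable M (c b)"
    by (rule integrable_const_bound[of _ K]) (use K in auto)
  have ind: "indep_var borel Y borel ?\<zeta>" if "Y \<in> borel_measurable (F (real b * h))" for Y :: "'a \<Rightarrow> real"
    unfolding dW_def using increment_indep[OF dW_times(1,2)[OF h] that zm] .
  have scm: "(\<lambda>\<omega>. S b \<omega> * c b \<omega>) \<in> borel_measurable (F (real b * h))"
    using Sm c by (intro borel_measurable_times)
  have cross: "expectation (\<lambda>\<omega>. (S b \<omega> * c b \<omega>) * ?\<zeta> \<omega>) = 0" "integrable M (\<lambda>\<omega>. (S b \<omega> * c b \<omega>) * ?\<zeta> \<omega>)"
    using indep_var_lebesgue_integral[OF ind[OF scm] isc iz] indep_var_integrable[OF ind[OF scm] isc iz] zz by auto
  have lin: "expectation (\<lambda>\<omega>. c b \<omega> * ?\<zeta> \<omega>) = 0" "integrable M (\<lambda>\<omega>. c b \<omega> * ?\<zeta> \<omega>)"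
    using indep_var_lebesgue_integral[OF ind[OF c] ic iz] indep_var_integrable[OF ind[OF c] ic iz] zz by auto
  have cz: "(c b \<omega> * ?\<zeta> \<omega>)\<^sup>2 \<le> K\<^sup>2 * (?\<zeta> \<omega>)\<^sup>2" for \<omega>
  proof -
    have "(c b \<omega>)\<^sup>2 \<le> K\<^sup>2" using K[of b \<omega>] K0 abs_le_square_iff[of "c b \<omega>" K] by simp
    then show ?thesis by (simp add: power_mult_distrib mult_right_mono)
  qed
  have icz: "integrable M (\<lambda>\<omega>. (c b \<omega> * ?\<zeta> \<omega>)\<^sup>2)"
    by (rule Bochner_Integration.integrable_bound[where f="\<lambda>\<omega>. K\<^sup>2 * (?\<zeta> \<omega>)\<^sup>2"]) (use zz cz in auto)
  have "expectation (\<lambda>\<omega>. (c b \<omega> * ?\<zeta> \<omega>)\<^sup>2) \<le> expectation (\<lambda>\<omega>. K\<^sup>2 * (?\<zeta> \<omega>)\<^sup>2)"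
    by (rule integral_mono[OF icz]) (use zz cz in auto)
  also have "\<dots> \<le> K\<^sup>2 * v" using zz by (simp add: mult_left_mono)
  finally have ecz: "expectation (\<lambda>\<omega>. (c b \<omega> * ?\<zeta> \<omega>)\<^sup>2) \<le> K\<^sup>2 * v" .
  \<comment> \<open>The middle term is the cross term with mean zero; the last one is bounded
    through \<open>K\<close>.\<close>
  have sq: "(S (Suc b) \<omega>)\<^sup>2 = (S b \<omega>)\<^sup>2 + 2 * ((S b \<omega> * c b \<omega>) * ?\<zeta> \<omega>) + (c b \<omega> * ?\<zeta> \<omega>)\<^sup>2" for \<omega>
    unfolding SS by (simp add: power2_sum algebra_simps)
  have "S (Suc b) \<in> borel_measurable (F (real (Suc b) * h))"
  proof (subst SS[abs_def], intro borel_measurable_add borel_measurable_times)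
    have le: "real b * h \<le> real (Suc b) * h" using dW_times(2)[OF h] by (rule less_imp_le)
    show "S b \<in> borel_measurable (F (real (Suc b) * h))" "c b \<in> borel_measurable (F (real (Suc b) * h))"
      using adapted_mono[OF Sm le] adapted_mono[OF c le] by auto
    show "?\<zeta> \<in> borel_measurable (F (real (Suc b) * h))"
      by (rule measurable_compose[OF dW_adapted zm]) (use h in auto)
  qed
  moreover have "integrable M (\<lambda>\<omega>. (S (Suc b) \<omega>)\<^sup>2)"
    unfolding sq using step.IH cross icz by (intro Bochner_Integration.integrable_add) auto
  moreover have "expectation (S (Suc b)) = 0"
    by (subst SS[abs_def]) (use step.IH iS lin in simp)
  moreover have "expectation (\<lambda>\<omega>. (S (Suc b) \<omega>)\<^sup>2) \<le> real (Suc b - a) * (K\<^sup>2 * v)"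
  proof -
    have "expectation (\<lambda>\<omega>. (S (Suc b) \<omega>)\<^sup>2) = expectation (\<lambda>\<omega>. (S b \<omega>)\<^sup>2) + expectation (\<lambda>\<omega>. (c b \<omega> * ?\<zeta> \<omega>)\<^sup>2)"
      unfolding sq using step.IH cross icz by simp
    also have "\<dots> \<le> real (b - a) * (K\<^sup>2 * v) + K\<^sup>2 * v" using step.IH ecz by linarith
    also have "\<dots> = real (Suc b - a) * (K\<^sup>2 * v)" using step.hyps by (simp add: Suc_diff_le algebra_simps)
    finally show ?thesis .
  qed
  ultimately show ?case by blast
qed

end

section \<open>Convergence in probability and Riemann sums\<close>

context prob_space begin

text \<open>\<open>dP (Y n)\<close> tends to \<open>0\<close> iff \<open>Y n\<close> tends to \<open>0\<close> in probability; unlike the tail probabilities,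
  \<open>dP\<close> is subadditive.\<close>

definition dP :: "('a \<Rightarrow> real) \<Rightarrow> real" where
  "dP Y = expectation (\<lambda>\<omega>. min 1 \<bar>Y \<omega>\<bar>)"

lemma dP_integrable: "(Y :: 'a \<Rightarrow> real) \<in> borel_measurable M \<Longrightarrow> integrable M (\<lambda>\<omega>. min 1 \<bar>Y \<omega>\<bar>)"
  by (rule integrable_const_bound[where B=1]) auto

lemma dP_nonneg: "0 \<le> dP Y"
  unfolding dP_def by (rule integral_nonneg_AE) auto

lemma dP_mono:
  assumes "Y \<in> borel_measurable M" "Z \<in> borel_measurable M"
    and "\<And>\<omega>. \<omega> \<in> space M \<Longrightarrow> \<bar>Y \<omega>\<bar> \<le> \<bar>Z \<omega>\<bar>"
  shows "dP Y \<le> dP Z"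
  unfolding dP_def
  by (intro integral_mono dP_integrable assms) (use assms(3) in \<open>auto simp: min.coboundedI2\<close>)

lemma dP_triangle:
  assumes [measurable]: "Y \<in> borel_measurable M" "Z \<in> borel_measurable M" "U \<in> borel_measurable M"
    and le: "\<And>\<omega>. \<omega> \<in> space M \<Longrightarrow> \<bar>Y \<omega>\<bar> \<le> \<bar>Z \<omega>\<bar> + \<bar>U \<omega>\<bar>"
  shows "dP Y \<le> dP Z + dP U"
proof -
  have "dP Y \<le> expectation (\<lambda>\<omega>. min 1 \<bar>Z \<omega>\<bar> + min 1 \<bar>U \<omega>\<bar>)"
    unfolding dP_def
    by (intro integral_mono Bochner_Integration.integrable_add dP_integrable) (use le in \<open>force+\<close>)
  also have "\<dots> = dP Z + dP U" unfolding dP_def by (simp add: dP_integrable)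
  finally show ?thesis .
qed

lemma dP_sum:
  assumes "finite I" "\<And>i. i \<in> I \<Longrightarrow> Y i \<in> borel_measurable M"
  shows "dP (\<lambda>\<omega>. \<Sum>i\<in>I. Y i \<omega>) \<le> (\<Sum>i\<in>I. dP (Y i))"
  using assms
proof (induction I rule: finite_induct)
  case (insert i I)
  have "dP (\<lambda>\<omega>. \<Sum>i\<in>insert i I. Y i \<omega>) \<le> dP (Y i) + dP (\<lambda>\<omega>. \<Sum>i\<in>I. Y i \<omega>)"
    using insert by (intro dP_triangle borel_measurable_sum) auto
  then show ?case using insert by auto
qed (simp add: dP_def)

lemma dP_scale:
  assumes [measurable]: "Y \<in> borel_measurable M"
  shows "dP (\<lambda>\<omega>. c * Y \<omega>) \<le> max 1 \<bar>c\<bar> * dP Y"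
proof -
  have "min 1 \<bar>c * y\<bar> \<le> max 1 \<bar>c\<bar> * min 1 \<bar>y\<bar>" for y
  proof (cases "\<bar>y\<bar> \<le> 1")
    case True
    then have "min 1 \<bar>c * y\<bar> \<le> \<bar>c\<bar> * \<bar>y\<bar>" by (simp add: abs_mult)
    also have "\<dots> \<le> max 1 \<bar>c\<bar> * \<bar>y\<bar>" by (intro mult_right_mono) auto
    finally show ?thesis using True by simp
  qed auto
  then have "dP (\<lambda>\<omega>. c * Y \<omega>) \<le> expectation (\<lambda>\<omega>. max 1 \<bar>c\<bar> * min 1 \<bar>Y \<omega>\<bar>)"
    unfolding dP_def by (intro integral_mono integrable_mult_right dP_integrable) auto
  then show ?thesis by (simp add: dP_def)
qed

lemma dP_le_expectation:
  assumes [measurable]: "Y \<in> borel_measurable M" and "integrable M Z"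
    and "\<And>\<omega>. \<omega> \<in> space M \<Longrightarrow> \<bar>Y \<omega>\<bar> \<le> Z \<omega>"
  shows "dP Y \<le> expectation Z"
  unfolding dP_def by (intro integral_mono dP_integrable assms) (use assms(3) in \<open>auto simp: min.coboundedI2\<close>)

text \<open>Localisation: an exceptional event costs its probability and no more, since the
  integrand of \<open>dP\<close> is at most 1.\<close>

lemma dP_event:
  assumes [measurable]: "Y \<in> borel_measurable M" "Z \<in> borel_measurable M" "A \<in> events"
    and le: "\<And>\<omega>. \<omega> \<in> space M \<Longrightarrow> \<omega> \<notin> A \<Longrightarrow> \<bar>Y \<omega>\<bar> \<le> \<bar>Z \<omega>\<bar>"
  shows "dP Y \<le> prob A + dP Z"
proof -
  have "dP Y \<le> expectation (\<lambda>\<omega>. indicator A \<omega> + min 1 \<bar>Z \<omega>\<bar>)"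
    unfolding dP_def
  proof (intro integral_mono Bochner_Integration.integrable_add dP_integrable)
    show "integrable M (indicat_real A)" by (simp add: emeasure_eq_measure)
    show "min 1 \<bar>Y \<omega>\<bar> \<le> indicat_real A \<omega> + min 1 \<bar>Z \<omega>\<bar>" if "\<omega> \<in> space M" for \<omega>
      using le[OF that] by (cases "\<omega> \<in> A") (auto simp: min_def)
  qed auto
  also have "\<dots> = prob A + dP Z" unfolding dP_def by (simp add: dP_integrable emeasure_eq_measure)
  finally show ?thesis .
qed

lemma dP_le_prob:
  assumes [measurable]: "Y \<in> borel_measurable M" and "0 \<le> e"
  shows "dP Y \<le> e + prob {\<omega>\<in>space M. e < \<bar>Y \<omega>\<bar>}"
proof -
  have "dP Y \<le> prob {\<omega>\<in>space M. e < \<bar>Y \<omega>\<bar>} + dP (\<lambda>_. e)"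
    by (rule dP_event) (use assms in auto)
  moreover have "dP (\<lambda>_. e) \<le> e" using assms by (simp add: dP_def prob_space)
  ultimately show ?thesis by simp
qed

lemma dP_tendsto_pathwise:
  assumes [measurable]: "\<And>n. Y n \<in> borel_measurable M"
    and lim: "\<And>\<omega>. \<omega> \<in> space M \<Longrightarrow> (\<lambda>n. Y n \<omega>) \<longlonglongrightarrow> 0"
  shows "(\<lambda>n. dP (Y n)) \<longlonglongrightarrow> 0"
proof -
  have "(\<lambda>n. expectation (\<lambda>\<omega>. min 1 \<bar>Y n \<omega>\<bar>)) \<longlonglongrightarrow> expectation (\<lambda>\<omega>. min 1 \<bar>0\<bar>)"
  proof (rule integral_dominated_convergence[where w="\<lambda>_. 1"])
    show "AE \<omega> in M. (\<lambda>n. min 1 \<bar>Y n \<omega>\<bar>) \<longlonglongrightarrow> min 1 \<bar>0\<bar>"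
      using lim by (intro AE_I2 tendsto_min tendsto_const tendsto_rabs) auto
  qed auto
  then show ?thesis by (simp add: dP_def)
qed

lemma prob_tendsto_0_pathwise:
  assumes [measurable]: "\<And>n. A n \<in> events"
    and ev: "\<And>\<omega>. \<omega> \<in> space M \<Longrightarrow> eventually (\<lambda>n. \<omega> \<notin> A n) sequentially"
  shows "(\<lambda>n. prob (A n)) \<longlonglongrightarrow> 0"
proof -
  have "(\<lambda>n. dP (indicator (A n))) \<longlonglongrightarrow> 0"
    by (rule dP_tendsto_pathwise)
      (auto intro!: tendsto_eventually elim!: eventually_mono[OF ev] simp: indicator_def)
  moreover have "dP (indicator (A n)) = prob (A n)" for n
  proof -
    have "dP (indicator (A n)) = expectation (indicator (A n))"
      unfolding dP_def by (intro Bochner_Integration.integral_cong) (auto simp: indicator_def)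
    then show ?thesis by simp
  qed
  ultimately show ?thesis by simp
qed

lemma dP_le_sqrt_second_moment:
  assumes [measurable]: "Y \<in> borel_measurable M" and i: "integrable M (\<lambda>\<omega>. (Y \<omega>)\<^sup>2)"
    and v: "expectation (\<lambda>\<omega>. (Y \<omega>)\<^sup>2) \<le> v"
  shows "dP Y \<le> sqrt v"
proof -
  have iY: "integrable M Y" by (rule square_integrable_imp_integrable) (use i in auto)
  have "(expectation (\<lambda>\<omega>. \<bar>Y \<omega>\<bar>))\<^sup>2 \<le> expectation (\<lambda>\<omega>. \<bar>Y \<omega>\<bar>\<^sup>2)"
    by (rule jensens_inequality[where q="\<lambda>x. x\<^sup>2" and I=UNIV])
      (use iY i convex_power2 in \<open>auto intro: convex_on_subset\<close>)
  then have "(expectation (\<lambda>\<omega>. \<bar>Y \<omega>\<bar>))\<^sup>2 \<le> v" using v by simp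
  then have "expectation (\<lambda>\<omega>. \<bar>Y \<omega>\<bar>) \<le> sqrt v" by (rule real_le_rsqrt)
  moreover have "dP Y \<le> expectation (\<lambda>\<omega>. \<bar>Y \<omega>\<bar>)"
    by (rule dP_le_expectation) (use iY in auto)
  ultimately show ?thesis by simp
qed

text \<open>A bound in \<open>L\<^sup>2\<close> gives uniform integrability, which upgrades
  convergence in probability to convergence of means. The quantitative form is the pointwise
  inequality \<open>\<bar>y\<bar> \<le> K * min 1 \<bar>y\<bar> + y\<^sup>2 / K\<close>.\<close>

lemma tendsto_expectation_of_dP:
  assumes [measurable]: "\<And>n. Y n \<in> borel_measurable M"
    and i: "\<And>n. integrable M (\<lambda>\<omega>. (Y n \<omega>)\<^sup>2)" and v: "\<And>n. expectation (\<lambda>\<omega>. (Y n \<omega>)\<^sup>2) \<le> v"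
    and lim: "(\<lambda>n. dP (Y n)) \<longlonglongrightarrow> 0"
  shows "(\<lambda>n. expectation (Y n)) \<longlonglongrightarrow> 0"
proof (rule LIMSEQ_I)
  fix e :: real assume e: "e > 0"
  have iY: "integrable M (Y n)" for n by (rule square_integrable_imp_integrable) (use i in auto)
  have v0: "0 \<le> v" using v[of 0] by (smt (verit) integral_nonneg_AE AE_I2 zero_le_power2)
  \<comment> \<open>Makes the tail term \<open>v / K\<close> strictly smaller than
    \<open>e / 2\<close>.\<close>
  define K where "K = 1 + 2 * v / e"
  have K: "K \<ge> 1" using v0 e by (simp add: K_def)
  have vK: "v / K < e / 2"
    using e v0 K by (simp add: K_def field_simps)
  obtain n0 where n0: "\<And>n. n \<ge> n0 \<Longrightarrow> dP (Y n) < e / 2 / K"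
    using order_tendstoD(2)[OF lim, of "e / 2 / K"] e K by (auto simp: eventually_sequentially)
  show "\<exists>n0. \<forall>n\<ge>n0. norm (expectation (Y n) - 0) < e"
  proof (intro exI[of _ n0] allI impI)
    fix n assume n: "n \<ge> n0"
    have pt: "\<bar>y\<bar> \<le> K * min 1 \<bar>y\<bar> + y\<^sup>2 / K" for y
    proof (cases "\<bar>y\<bar> \<le> K")
      case True
      have "\<bar>y\<bar> \<le> K * min 1 \<bar>y\<bar>"
      proof (cases "\<bar>y\<bar> \<le> 1")
        case True
        then show ?thesis using K mult_right_mono[of 1 K "\<bar>y\<bar>"] by simp
      qed (use True in auto)
      moreover have "0 \<le> y\<^sup>2 / K" using K by simp
      ultimately show ?thesis by linarith
    next
      case False
      then have "K * \<bar>y\<bar> \<le> \<bar>y\<bar> * \<bar>y\<bar>" by (intro mult_right_mono) auto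
      then have "\<bar>y\<bar> \<le> y\<^sup>2 / K" using K by (simp add: field_simps power2_eq_square)
      moreover have "0 \<le> K * min 1 \<bar>y\<bar>" using K by simp
      ultimately show ?thesis by linarith
    qed
    have "\<bar>expectation (Y n)\<bar> \<le> expectation (\<lambda>\<omega>. \<bar>Y n \<omega>\<bar>)" by (rule integral_abs_bound)
    also have "\<dots> \<le> expectation (\<lambda>\<omega>. K * min 1 \<bar>Y n \<omega>\<bar> + (Y n \<omega>)\<^sup>2 / K)"
      using iY i dP_integrable[of "Y n"] pt by (intro integral_mono) auto
    also have "\<dots> = K * dP (Y n) + expectation (\<lambda>\<omega>. (Y n \<omega>)\<^sup>2) / K"
      using i dP_integrable[of "Y n"] by (simp add: dP_def)
    also have "\<dots> \<le> K * dP (Y n) + v / K" using v[of n] K by (simp add: divide_right_mono)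
    also have "\<dots> < e"
    proof -
      have "K * dP (Y n) < e / 2" using n0[OF n] K by (simp add: field_simps)
      then show ?thesis using vK by linarith
    qed
    finally show "norm (expectation (Y n) - 0) < e" by simp
  qed
qed

end

section \<open>Martingale sums with unbounded coefficients\<close>

context brownian begin

lemma noise_sum_truncated:
  fixes c :: "nat \<Rightarrow> 'a \<Rightarrow> real"
  assumes c: "\<And>j. c j \<in> borel_measurable (F (real j * h))"
  shows "(\<lambda>\<omega>. if \<bar>c j \<omega>\<bar> \<le> K then c j \<omega> else 0) \<in> borel_measurable (F (real j * h))"
  using c[of j] by measurable

text \<open>Truncation at \<open>K\<close> keeps the coefficients adapted and changes the sum only
  on the event where some coefficient exceeds \<open>K\<close>. The truncated sum is controlled by
  its second moment.\<close>

lemma noise_sum_dP: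
  fixes c :: "nat \<Rightarrow> 'a \<Rightarrow> real"
  assumes z: "centred_noise h z v" and c: "\<And>j. c j \<in> borel_measurable (F (real j * h))"
    and K: "K \<ge> 0" and ab: "a \<le> b"
  shows "dP (\<lambda>\<omega>. \<Sum>j=a..<b. c j \<omega> * z (dW h j \<omega>)) \<le>
    prob {\<omega>\<in>space M. \<exists>j\<in>{a..<b}. K < \<bar>c j \<omega>\<bar>} + K * sqrt (real (b - a) * v)"
proof -
  define c' where "c' j \<omega> = (if \<bar>c j \<omega>\<bar> \<le> K then c j \<omega> else 0)" for j \<omega>
  have c': "c' j \<in> borel_measurable (F (real j * h))" for j
    unfolding c'_def by (rule noise_sum_truncated[OF c])
  have [measurable]: "c j \<in> borel_measurable M" "c' j \<in> borel_measurable M" for j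
    using c c' adapted_measurable by blast+
  have [measurable]: "z \<in> borel_measurable borel" "dW h j \<in> borel_measurable M" for j
    using z by (auto simp: centred_noise_def)
  have sm: "integrable M (\<lambda>\<omega>. (\<Sum>j=a..<b. c' j \<omega> * z (dW h j \<omega>))\<^sup>2)"
     "expectation (\<lambda>\<omega>. (\<Sum>j=a..<b. c' j \<omega> * z (dW h j \<omega>))\<^sup>2) \<le> real (b - a) * (K\<^sup>2 * v)"
    using martingale_sum_second_moment[OF z c' _ ab, of K] K by (auto simp: c'_def)
  have "dP (\<lambda>\<omega>. \<Sum>j=a..<b. c j \<omega> * z (dW h j \<omega>)) \<le>
    prob {\<omega>\<in>space M. \<exists>j\<in>{a..<b}. K < \<bar>c j \<omega>\<bar>} + dP (\<lambda>\<omega>. \<Sum>j=a..<b. c' j \<omega> * z (dW h j \<omega>))"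
  proof (rule dP_event)
    fix \<omega> assume "\<omega> \<in> space M" "\<omega> \<notin> {\<omega> \<in> space M. \<exists>j\<in>{a..<b}. K < \<bar>c j \<omega>\<bar>}"
    then have "(\<Sum>j=a..<b. c j \<omega> * z (dW h j \<omega>)) = (\<Sum>j=a..<b. c' j \<omega> * z (dW h j \<omega>))"
      by (intro sum.cong) (auto simp: c'_def not_less)
    then show "\<bar>\<Sum>j=a..<b. c j \<omega> * z (dW h j \<omega>)\<bar> \<le> \<bar>\<Sum>j=a..<b. c' j \<omega> * z (dW h j \<omega>)\<bar>" by simp
  qed measurable
  also have "dP (\<lambda>\<omega>. \<Sum>j=a..<b. c' j \<omega> * z (dW h j \<omega>)) \<le> sqrt (real (b - a) * (K\<^sup>2 * v))"
    by (rule dP_le_sqrt_second_moment) (use sm in auto)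
  also have "\<dots> = K * sqrt (real (b - a) * v)" using K by (simp add: real_sqrt_mult)
  finally show ?thesis by simp
qed

end

section \<open>Left-point Riemann sums on uniform grids\<close>

lemma integral_left_point_error:
  fixes f :: "real \<Rightarrow> 'b::euclidean_space"
  assumes "a \<le> b" "continuous_on {a..b} f" "\<And>s. s \<in> {a..b} \<Longrightarrow> norm (f s - f a) \<le> e"
  shows "norm (integral {a..b} f - (b - a) *\<^sub>R f a) \<le> (b - a) * e"
proof -
  have "integral {a..b} (\<lambda>s. f s - f a) = integral {a..b} f - (b - a) *\<^sub>R f a"
    using assms by (subst Henstock_Kurzweil_Integration.integral_diff)
      (auto intro: integrable_continuous_real)
  moreover have "norm (integral {a..b} (\<lambda>s. f s - f a)) \<le> e * (b - a)"
    using assms by (intro integral_bound) (auto intro!: continuous_intros)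
  ultimately show ?thesis by (simp add: mult.commute)
qed

lemma integral_grid_sum:
  fixes f :: "real \<Rightarrow> 'b::euclidean_space"
  assumes "0 \<le> h" "continuous_on {0..real m * h} f"
  shows "integral {0..real m * h} f = (\<Sum>i<m. integral {real i * h..real (Suc i) * h} f)"
  using assms(2)
proof (induction m)
  case (Suc m)
  have le: "real m * h \<le> real (Suc m) * h" using assms(1) by (intro mult_right_mono) auto
  have "integral {0..real m * h} f + integral {real m * h..real (Suc m) * h} f = integral {0..real (Suc m) * h} f"
    using assms(1) Suc.prems le
    by (intro Henstock_Kurzweil_Integration.integral_combine integrable_continuous_real) auto
  moreover have "continuous_on {0..real m * h} f"
    by (rule continuous_on_subset[OF Suc.prems]) (use le in auto)
  ultimately show ?case using Suc.IH by simp
qed simp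

lemma riemann_sum_error:
  fixes f :: "real \<Rightarrow> 'b::euclidean_space"
  assumes "0 \<le> h" "continuous_on {0..real m * h} f"
    and "\<And>i s. i < m \<Longrightarrow> s \<in> {real i * h..real (Suc i) * h} \<Longrightarrow> norm (f s - f (real i * h)) \<le> e"
  shows "norm (integral {0..real m * h} f - (\<Sum>i<m. h *\<^sub>R f (real i * h))) \<le> real m * h * e"
proof -
  have "norm (\<Sum>i<m. integral {real i * h..real (Suc i) * h} f - h *\<^sub>R f (real i * h)) \<le> (\<Sum>i<m. h * e)"
  proof (rule sum_norm_le)
    fix i assume i: "i \<in> {..<m}"
    have le: "real i * h \<le> real (Suc i) * h" "real (Suc i) * h \<le> real m * h" "0 \<le> real i * h"
      using assms(1) i by (auto intro!: mult_right_mono)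
    have "continuous_on {real i * h..real (Suc i) * h} f"
      by (rule continuous_on_subset[OF assms(2)]) (use le in auto)
    from integral_left_point_error[OF le(1) this, of e] assms(3) i
    show "norm (integral {real i * h..real (Suc i) * h} f - h *\<^sub>R f (real i * h)) \<le> h * e"
      by (simp add: algebra_simps)
  qed
  then show ?thesis using assms by (simp add: integral_grid_sum sum_subtractf)
qed

text \<open>Heine-Cantor, phrased for times whose distance is a fixed multiple of a dyadic
  mesh.\<close>

lemma uniform_grid_modulus:
  fixes f :: "real \<Rightarrow> 'b::metric_space"
  assumes "continuous_on {0..t} f" "e > 0" "t > 0"
  obtains n0 where "\<And>n s s'. n \<ge> n0 \<Longrightarrow> s \<in> {0..t} \<Longrightarrow> s' \<in> {0..t} \<Longrightarrow> \<bar>s - s'\<bar> \<le> c * t / 2 ^ n \<Longrightarrow> dist (f s) (f s') < e"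
proof -
  have "uniformly_continuous_on {0..t} f" using assms by (intro compact_uniformly_continuous) auto
  then obtain d where d: "d > 0" "\<And>s s'. s \<in> {0..t} \<Longrightarrow> s' \<in> {0..t} \<Longrightarrow> dist s' s < d \<Longrightarrow> dist (f s') (f s) < e"
    using assms(2) unfolding uniformly_continuous_on_def by metis
  have "(\<lambda>n. c * t * (1 / 2) ^ n) \<longlonglongrightarrow> c * t * 0"
    by (intro tendsto_mult tendsto_const LIMSEQ_realpow_zero) auto
  then have "eventually (\<lambda>n. c * t * (1 / 2) ^ n < d) sequentially"
    using d(1) by (intro order_tendstoD(2)) auto
  then obtain n0 where "\<And>n. n \<ge> n0 \<Longrightarrow> c * t / 2 ^ n < d"
    by (auto simp: eventually_sequentially power_divide)
  then show thesis using d(2) that by (metis abs_minus_commute dist_commute dist_real_def order_le_less_trans)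
qed

lemma riemann_sum_tendsto:
  fixes f :: "real \<Rightarrow> 'b::euclidean_space"
  assumes t: "t > 0" and f: "continuous_on {0..t} f"
  shows "(\<lambda>n. \<Sum>i<2^n. (t / 2^n) *\<^sub>R f (real i * (t / 2^n))) \<longlonglongrightarrow> integral {0..t} f"
proof (rule LIMSEQ_I)
  fix e :: real assume e: "e > 0"
  obtain n0 where n0: "\<And>n s s'. n \<ge> n0 \<Longrightarrow> s \<in> {0..t} \<Longrightarrow> s' \<in> {0..t} \<Longrightarrow> \<bar>s - s'\<bar> \<le> 1 * t / 2 ^ n \<Longrightarrow> dist (f s) (f s') < e / (2 * t)"
    using uniform_grid_modulus[OF f _ t, of "e / (2 * t)" 1] e t by auto
  have "norm (integral {0..t} f - (\<Sum>i<2^n. (t / 2^n) *\<^sub>R f (real i * (t / 2^n)))) \<le> e / 2" if n: "n \<ge> n0" for n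
  proof -
    let ?h = "t / 2 ^ n"
    have m: "real (2 ^ n) * ?h = t" by simp
    have "norm (integral {0..real (2 ^ n) * ?h} f - (\<Sum>i<2^n. ?h *\<^sub>R f (real i * ?h))) \<le> real (2 ^ n) * ?h * (e / (2 * t))"
    proof (rule riemann_sum_error)
      show "continuous_on {0..real (2 ^ n) * ?h} f" using f m by simp
      fix i s assume i: "i < (2::nat) ^ n" and s: "s \<in> {real i * ?h..real (Suc i) * ?h}"
      have "0 \<le> real i * ?h" "real (Suc i) * ?h \<le> real (2 ^ n) * ?h"
        using t i by (auto intro!: divide_right_mono mult_right_mono simp del: of_nat_Suc of_nat_power)
      then have "0 \<le> real i * ?h" "real (Suc i) * ?h \<le> t" using m by auto
      moreover have "real (Suc i) * ?h = real i * ?h + ?h" by (simp add: field_simps)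
      moreover have "0 < ?h" using t by simp
      moreover define a where "a = real i * ?h"
      ultimately have "s \<in> {0..t}" "a \<in> {0..t}" "\<bar>s - a\<bar> \<le> ?h"
        using s unfolding atLeastAtMost_iff a_def[symmetric] by linarith+
      then have "dist (f s) (f (real i * ?h)) < e / (2 * t)"
        unfolding a_def by (intro n0[OF n]) auto
      then show "norm (f s - f (real i * ?h)) \<le> e / (2 * t)" by (simp add: dist_norm)
    qed (use t in auto)
    then show ?thesis using t m by simp
  qed
  then show "\<exists>n0. \<forall>n\<ge>n0. norm ((\<Sum>i<2^n. (t / 2^n) *\<^sub>R f (real i * (t / 2^n))) - integral {0..t} f) < e"
    using e by (intro exI[of _ n0]) (smt (verit) field_sum_of_halves norm_minus_commute)
qed

section \<open>Equations driven by scalar multiples of Brownian motion\<close>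

lemma matrix_vector_norm_bound:
  fixes S :: "real^'d^'n"
  obtains CS where "CS \<ge> 0" "\<And>x. norm (S *v x) \<le> CS * norm x"
proof -
  obtain K where "K > 0" "\<And>x. norm (S *v x) \<le> norm x * K"
    using bounded_linear.pos_bounded[OF matrix_vector_mul_bounded_linear[of S]] by blast
  then show thesis using that[of K] by (auto simp: mult.commute)
qed

lemma matrix_vector_measurable:
  fixes S :: "real^'d^'n"
  shows
  "Y \<in> borel_measurable M \<Longrightarrow> (\<lambda>\<omega>. S *v Y \<omega>) \<in> borel_measurable M"
  by (erule measurable_compose)
    (intro borel_measurable_continuous_onI linear_continuous_on matrix_vector_mul_bounded_linear)

lemma norm_measurable: "Y \<in> borel_measurable M \<Longrightarrow> (\<lambda>\<omega>. norm (Y \<omega> :: real^'d)) \<in> borel_measurable M"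
  by measurable

text \<open>The equation \<open>dX = G(X) dt + r(X) S dW\<close>. The stochastic integral is present
  only through \<open>sde\<close>, a limit in probability for each single \<open>t\<close>; the
  constant matrix \<open>S\<close> has already been moved outside the Riemann sums.\<close>

locale scalar_noise_sde = brownian M F W
  for M :: "'a measure" and F :: "real \<Rightarrow> 'a measure" and W :: "real \<Rightarrow> 'a \<Rightarrow> real^'d" +
  fixes X :: "real \<Rightarrow> 'a \<Rightarrow> real^'d" and G :: "real^'d \<Rightarrow> real^'d" and r :: "real^'d \<Rightarrow> real"
    and S :: "real^'d^'d" and x0 :: "real^'d"
  assumes X_adapted: "\<And>t. 0 \<le> t \<Longrightarrow> X t \<in> borel_measurable (F t)"
    and X_init: "\<And>\<omega>. \<omega> \<in> space M \<Longrightarrow> X 0 \<omega> = x0"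
    and X_cont: "\<And>\<omega>. \<omega> \<in> space M \<Longrightarrow> continuous_on {0..} (\<lambda>t. X t \<omega>)"
    and G_cont: "continuous_on UNIV G"
    and r_cont: "continuous_on UNIV r"
    and sde: "\<And>t e. 0 \<le> t \<Longrightarrow> 0 < e \<Longrightarrow>
      (\<lambda>N. prob {\<omega>\<in>space M. e < norm (S *v (\<Sum>k<2^N. r (X (real k * t / 2^N) \<omega>) *\<^sub>R
          (W (real (Suc k) * t / 2^N) \<omega> - W (real k * t / 2^N) \<omega>))
        - (X t \<omega> - x0 - integral {0..t} (\<lambda>s. G (X s \<omega>))))}) \<longlonglongrightarrow> 0"
begin

lemma X_measurable: "0 \<le> t \<Longrightarrow> X t \<in> borel_measurable M"
  using X_adapted adapted_measurable by blast

lemma fX_adapted: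
  assumes "continuous_on UNIV f" "0 \<le> s" "s \<le> t"
  shows "(\<lambda>\<omega>. f (X s \<omega>)) \<in> borel_measurable (F t)"
  by (rule measurable_compose[OF adapted_mono[OF X_adapted[OF assms(2)] assms(3)] borel_measurable_continuous_onI[OF assms(1)]])

lemma fX_measurable:
  assumes "continuous_on UNIV f" "0 \<le> s"
  shows "(\<lambda>\<omega>. f (X s \<omega>)) \<in> borel_measurable M"
  using fX_adapted[OF assms order_refl] by (rule adapted_measurable)

lemma fX_cont:
  assumes "continuous_on UNIV f" "\<omega> \<in> space M"
  shows "continuous_on {0..} (\<lambda>s. f (X s \<omega>))"
  by (rule continuous_on_compose2[OF assms(1) X_cont[OF assms(2)]]) auto

lemma fX_cont': "continuous_on UNIV f \<Longrightarrow> \<omega> \<in> space M \<Longrightarrow> 0 \<le> a \<Longrightarrow> continuous_on {a..t} (\<lambda>s. f (X s \<omega>))"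
  by (rule continuous_on_subset[OF fX_cont]) auto

lemma integral_fX_measurable:
  fixes f :: "real^'d \<Rightarrow> 'z::euclidean_space"
  assumes f: "continuous_on UNIV f" and t: "0 \<le> t"
  shows "(\<lambda>\<omega>. integral {0..t} (\<lambda>s. f (X s \<omega>))) \<in> borel_measurable M"
proof (cases "t = 0")
  case False
  then have t: "t > 0" using t by simp
  show ?thesis
  proof (rule borel_measurable_LIMSEQ_metric)
    show "(\<lambda>\<omega>. \<Sum>i<2^n. (t / 2^n) *\<^sub>R f (X (real i * (t / 2^n)) \<omega>)) \<in> borel_measurable M" for n
      using t by (intro borel_measurable_sum borel_measurable_scaleR borel_measurable_const fX_measurable[OF f]) auto
    show "(\<lambda>n. \<Sum>i<2^n. (t / 2^n) *\<^sub>R f (X (real i * (t / 2^n)) \<omega>)) \<longlonglongrightarrow> integral {0..t} (\<lambda>s. f (X s \<omega>))"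
      if "\<omega> \<in> space M" for \<omega>
      by (rule riemann_sum_tendsto[OF t]) (use fX_cont'[OF f that] in auto)
  qed
qed simp

text \<open>The value of \<open>S\<close> times the Ito integral of \<open>r(X)\<close>, read off
  from the equation, so that no integral has to be constructed and every path has a definite
  value.\<close>

definition noise :: "real \<Rightarrow> 'a \<Rightarrow> real^'d" where
  "noise t \<omega> = X t \<omega> - x0 - integral {0..t} (\<lambda>s. G (X s \<omega>))"

lemma noise_measurable: "0 \<le> t \<Longrightarrow> noise t \<in> borel_measurable M"
  unfolding noise_def
  by (intro borel_measurable_diff borel_measurable_const X_measurable integral_fX_measurable G_cont)

lemma noise_riemann_dP:
  assumes t: "0 \<le> t"
  shows "(\<lambda>N. dP (\<lambda>\<omega>. norm (S *v (\<Sum>k<2^N. r (X (real k * t / 2^N) \<omega>) *\<^sub>R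
      (W (real (Suc k) * t / 2^N) \<omega> - W (real k * t / 2^N) \<omega>)) - noise t \<omega>))) \<longlonglongrightarrow> 0"
  (is "(\<lambda>N. dP (?Y N)) \<longlonglongrightarrow> 0")
proof (rule LIMSEQ_I)
  fix e :: real assume e: "e > 0"
  have Ym: "?Y N \<in> borel_measurable M" for N
    using t by (intro norm_measurable borel_measurable_diff matrix_vector_measurable borel_measurable_sum
      borel_measurable_scaleR fX_measurable[OF r_cont] noise_measurable brownian_measurable) auto
  have "(\<lambda>N. prob {\<omega>\<in>space M. e / 2 < \<bar>?Y N \<omega>\<bar>}) \<longlonglongrightarrow> 0"
    using sde[OF t, of "e / 2"] e by (simp add: noise_def)
  then have "eventually (\<lambda>N. prob {\<omega>\<in>space M. e / 2 < \<bar>?Y N \<omega>\<bar>} < e / 2) sequentially"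
    using e by (intro order_tendstoD(2)) auto
  then obtain n0 where n0: "\<And>N. N \<ge> n0 \<Longrightarrow> prob {\<omega>\<in>space M. e / 2 < \<bar>?Y N \<omega>\<bar>} < e / 2"
    by (auto simp: eventually_sequentially)
  show "\<exists>n0. \<forall>N\<ge>n0. norm (dP (?Y N) - 0) < e"
  proof (intro exI[of _ n0] allI impI)
    fix N assume "N \<ge> n0"
    have "dP (?Y N) \<le> e / 2 + prob {\<omega>\<in>space M. e / 2 < \<bar>?Y N \<omega>\<bar>}"
      by (rule dP_le_prob[OF Ym]) (use e in simp)
    with n0[OF \<open>N \<ge> n0\<close>] have "dP (?Y N) < e" by linarith
    then show "norm (dP (?Y N) - 0) < e" using dP_nonneg[of "?Y N"] by simp
  qed
qed

lemma dW_telescope: "W (real (a + m) * h) \<omega> - W (real a * h) \<omega> = (\<Sum>j=a..<a+m. dW h j \<omega>)"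
  by (induction m) (simp_all add: dW_def algebra_simps)

text \<open>Along each path the function is uniformly continuous on \<open>{0..t}\<close>, so from
  some level on no pair of times this close violates the bound. Eventual absence on every path gives
  vanishing probability.\<close>

lemma prob_path_oscillation_tendsto_0:
  fixes m :: "nat \<Rightarrow> nat" and f :: "real^'d \<Rightarrow> real"
  assumes f: "continuous_on UNIV f" and t: "t > 0" and e: "e > 0"
    and q: "\<And>N j. j < m N \<Longrightarrow> u N j \<in> {0..t} \<and> w N j \<in> {0..t} \<and> \<bar>u N j - w N j\<bar> \<le> c * t / 2 ^ N"
  shows "(\<lambda>N. prob {\<omega>\<in>space M. \<exists>j\<in>{0..<m N}. e < \<bar>f (X (u N j) \<omega>) - f (X (w N j) \<omega>)\<bar>}) \<longlonglongrightarrow> 0"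
proof (rule prob_tendsto_0_pathwise)
  fix N
  have *: "(\<lambda>\<omega>. f (X (u N j) \<omega>)) \<in> borel_measurable M" "(\<lambda>\<omega>. f (X (w N j) \<omega>)) \<in> borel_measurable M" if "j \<in> {0..<m N}" for j
    using q[of j N] that by (auto intro!: fX_measurable[OF f])
  show "{\<omega>\<in>space M. \<exists>j\<in>{0..<m N}. e < \<bar>f (X (u N j) \<omega>) - f (X (w N j) \<omega>)\<bar>} \<in> events"
    using * by (intro sets.sets_Collect_finite_Ex) (auto intro!: borel_measurable_less borel_measurable_abs)
next
  fix \<omega> assume w: "\<omega> \<in> space M"
  from uniform_grid_modulus[OF fX_cont'[OF f w order_refl] e t, of c]
  obtain n0 where n0: "\<And>n s s'. n \<ge> n0 \<Longrightarrow> s \<in> {0..t} \<Longrightarrow> s' \<in> {0..t} \<Longrightarrow> \<bar>s - s'\<bar> \<le> c * t / 2 ^ n \<Longrightarrow>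
      dist (f (X s \<omega>)) (f (X s' \<omega>)) < e" by blast
  have "\<omega> \<notin> {\<omega>\<in>space M. \<exists>j\<in>{0..<m N}. e < \<bar>f (X (u N j) \<omega>) - f (X (w N j) \<omega>)\<bar>}" if "N \<ge> n0" for N
  proof
    assume "\<omega> \<in> {\<omega>\<in>space M. \<exists>j\<in>{0..<m N}. e < \<bar>f (X (u N j) \<omega>) - f (X (w N j) \<omega>)\<bar>}"
    then obtain j where j: "j < m N" "e < \<bar>f (X (u N j) \<omega>) - f (X (w N j) \<omega>)\<bar>" by auto
    then have "dist (f (X (u N j) \<omega>)) (f (X (w N j) \<omega>)) < e" using q[OF j(1)] by (intro n0[OF that]) auto
    then show False using j(2) unfolding dist_real_def by linarith
  qed
  then show "eventually (\<lambda>N. \<omega> \<notin> {\<omega>\<in>space M. \<exists>j\<in>{0..<m N}. e < \<bar>f (X (u N j) \<omega>) - f (X (w N j) \<omega>)\<bar>}) sequentially"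
    by (auto simp: eventually_sequentially)
qed

text \<open>The Riemann sums defining the noise at time \<open>i t / 2^n\<close> only use every \<open>i\<close>-th point of the
  dyadic grid of level \<open>n + N\<close> on \<open>[0, t]\<close>.\<close>

lemma noise_fine_grid_dP:
  assumes t: "t > 0"
  shows "(\<lambda>N. dP (\<lambda>\<omega>. norm (noise (real i * (t / 2^n)) \<omega> -
      S *v (\<Sum>j=0..<i*2^N. r (X (real j * (t / 2^(n+N))) \<omega>) *\<^sub>R dW (t / 2^(n+N)) j \<omega>)))) \<longlonglongrightarrow> 0"
proof (cases "i = 0")
  case True
  have "dP (\<lambda>\<omega>. norm (noise 0 \<omega>)) = expectation (\<lambda>\<omega>. 0)"
    unfolding dP_def by (intro Bochner_Integration.integral_cong) (auto simp: noise_def X_init)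
  then show ?thesis using True by simp
next
  case False
  define t' where "t' = real i * (t / 2^n)"
  have t': "t' > 0" using False t by (simp add: t'_def)
  obtain CS where CS: "CS \<ge> 0" "\<And>x. norm (S *v x) \<le> CS * norm x" using matrix_vector_norm_bound by blast
  let ?h = "\<lambda>N. t / 2^(n+N)"
  have h: "?h N > 0" for N using t by simp
  let ?A = "\<lambda>N \<omega>. \<Sum>j=0..<i*2^N. r (X (real j * ?h N) \<omega>) *\<^sub>R dW (?h N) j \<omega>"
  let ?B = "\<lambda>N \<omega>. \<Sum>k<2^N. r (X (real k * t' / 2^N) \<omega>) *\<^sub>R
      (W (real (Suc k) * t' / 2^N) \<omega> - W (real k * t' / 2^N) \<omega>)"
  let ?c = "\<lambda>N j \<omega>. r (X (real (i * (j div i)) * ?h N) \<omega>) - r (X (real j * ?h N) \<omega>)"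
  have grid: "real k * t' / 2^N = real (i * k) * ?h N" for k N
    by (simp add: t'_def power_add)
  \<comment> \<open>A cell of the level-\<open>N\<close> grid on \<open>[0, t']\<close> consists of
    \<open>i\<close> fine cells. Its increment is telescoped into fine ones, with \<open>r\<close>
    frozen at index \<open>i * (j div i)\<close>, the start of the block that contains
    \<open>j\<close>.\<close>
  have B: "?B N \<omega> = (\<Sum>j=0..<i*2^N. r (X (real (i * (j div i)) * ?h N) \<omega>) *\<^sub>R dW (?h N) j \<omega>)" for N \<omega>
  proof -
    have "?B N \<omega> = (\<Sum>k<2^N. \<Sum>j=k*i..<k*i+i. r (X (real (i * (j div i)) * ?h N) \<omega>) *\<^sub>R dW (?h N) j \<omega>)"
    proof (rule sum.cong)
      fix k assume "k \<in> {..<(2::nat)^N}"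
      have dv: "j div i = k" if "j \<in> {k*i..<k*i+i}" for j
        using that by (intro div_nat_eqI) (auto simp: algebra_simps)
      have "(\<Sum>j=k*i..<k*i+i. r (X (real (i * (j div i)) * ?h N) \<omega>) *\<^sub>R dW (?h N) j \<omega>) =
          (\<Sum>j=k*i..<k*i+i. r (X (real (i * k) * ?h N) \<omega>) *\<^sub>R dW (?h N) j \<omega>)"
        by (intro sum.cong) (auto simp: dv)
      also have "\<dots> = r (X (real (i * k) * ?h N) \<omega>) *\<^sub>R (W (real (k * i + i) * ?h N) \<omega> - W (real (k * i) * ?h N) \<omega>)"
        unfolding dW_telescope by (simp add: scaleR_sum_right)
      finally show "r (X (real k * t' / 2^N) \<omega>) *\<^sub>R (W (real (Suc k) * t' / 2^N) \<omega> - W (real k * t' / 2^N) \<omega>) =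
          (\<Sum>j=k*i..<k*i+i. r (X (real (i * (j div i)) * ?h N) \<omega>) *\<^sub>R dW (?h N) j \<omega>)"
        unfolding grid by (simp add: algebra_simps)
    qed simp
    also have "\<dots> = (\<Sum>j<2^N*i. r (X (real (i * (j div i)) * ?h N) \<omega>) *\<^sub>R dW (?h N) j \<omega>)"
      by (rule sum.nat_group)
    finally show ?thesis by (simp add: lessThan_atLeast0 mult.commute)
  qed
  have cm: "?c N j \<in> borel_measurable (F (real j * ?h N))" for N j
  proof -
    have "real (i * (j div i)) \<le> real j" by (simp only: of_nat_le_iff times_div_less_eq_dividend)
    then have "real (i * (j div i)) * ?h N \<le> real j * ?h N" using h[of N] by (intro mult_right_mono) auto
    then show ?thesis using t by (intro borel_measurable_diff fX_adapted[OF r_cont]) auto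
  qed
  have Am[measurable]: "?A N \<in> borel_measurable M" for N
    using t by (intro borel_measurable_sum borel_measurable_scaleR fX_measurable[OF r_cont] dW_measurable) auto
  have Bm[measurable]: "?B N \<in> borel_measurable M" for N
    unfolding B using t by (intro borel_measurable_sum borel_measurable_scaleR fX_measurable[OF r_cont] dW_measurable) auto
  have nm[measurable]: "noise t' \<in> borel_measurable M" using t' by (intro noise_measurable) auto
  have diff: "(\<lambda>N. dP (\<lambda>\<omega>. \<Sum>j=0..<i*2^N. ?c N j \<omega> * dW (?h N) j \<omega> $ k)) \<longlonglongrightarrow> 0" for k
  proof (rule LIMSEQ_I)
    fix e :: real assume e: "e > 0"
    \<comment> \<open>A sum over \<open>[0, t']\<close> with coefficients below
      \<open>\<eta>\<close> has \<open>L\<^sup>2\<close> size at most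
      \<open>\<eta> * sqrt t'\<close>, here \<open>e / 2\<close>.\<close>
    define \<eta> where "\<eta> = e / (2 * sqrt t')"
    have \<eta>: "\<eta> > 0" using e t' by (simp add: \<eta>_def)
    have "(\<lambda>N. prob {\<omega>\<in>space M. \<exists>j\<in>{0..<i*2^N}. \<eta> < \<bar>?c N j \<omega>\<bar>}) \<longlonglongrightarrow> 0"
    proof (rule prob_path_oscillation_tendsto_0[OF r_cont t' \<eta>, where c=1])
      fix N j assume j: "j < i * 2 ^ N"
      have T: "t' = real (i * 2^N) * ?h N" by (simp add: t'_def power_add)
      have iN: "1 * t' / 2 ^ N = real i * ?h N" by (simp add: t'_def power_add)
      have "real j \<le> real (i * 2 ^ N)" using j by (simp only: of_nat_le_iff)
      then have "real j * ?h N \<le> t'" unfolding T using h[of N] by (intro mult_right_mono) auto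
      moreover have ij: "real (i * (j div i)) \<le> real j" by (simp only: of_nat_le_iff times_div_less_eq_dividend)
      then have le: "real (i * (j div i)) * ?h N \<le> real j * ?h N" using h[of N] by (intro mult_right_mono) auto
      moreover have "real j - real (i * (j div i)) \<le> real i"
      proof -
        have "j = i * (j div i) + j mod i" by simp
        then have "real j = real (i * (j div i)) + real (j mod i)" by (metis of_nat_add)
        moreover have "real (j mod i) \<le> real i" using False by (simp add: less_imp_le)
        ultimately show ?thesis by linarith
      qed
      then have "(real j - real (i * (j div i))) * ?h N \<le> real i * ?h N"
        using h[of N] by (intro mult_right_mono) auto
      then have "real j * ?h N - real (i * (j div i)) * ?h N \<le> real i * ?h N"
        unfolding left_diff_distrib .
      moreover have "0 \<le> real (i * (j div i)) * ?h N" "0 \<le> real j * ?h N"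
        using t by (auto intro!: mult_nonneg_nonneg)
      moreover have "\<And>a b c T::real. b \<le> T \<Longrightarrow> a \<le> b \<Longrightarrow> b - a \<le> c \<Longrightarrow> 0 \<le> a \<Longrightarrow> 0 \<le> b \<Longrightarrow>
          a \<in> {0..T} \<and> b \<in> {0..T} \<and> \<bar>a - b\<bar> \<le> c" by auto
      moreover note le
      ultimately show "real (i * (j div i)) * ?h N \<in> {0..t'} \<and> real j * ?h N \<in> {0..t'} \<and>
          \<bar>real (i * (j div i)) * ?h N - real j * ?h N\<bar> \<le> 1 * t' / 2 ^ N"
        unfolding iN by blast
    qed
    then have "eventually (\<lambda>N. prob {\<omega>\<in>space M. \<exists>j\<in>{0..<i*2^N}. \<eta> < \<bar>?c N j \<omega>\<bar>} < e / 2) sequentially"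
      using e by (intro order_tendstoD(2)) auto
    then obtain n0 where n0: "\<And>N. N \<ge> n0 \<Longrightarrow> prob {\<omega>\<in>space M. \<exists>j\<in>{0..<i*2^N}. \<eta> < \<bar>?c N j \<omega>\<bar>} < e / 2"
      by (auto simp: eventually_sequentially)
    show "\<exists>n0. \<forall>N\<ge>n0. norm (dP (\<lambda>\<omega>. \<Sum>j=0..<i*2^N. ?c N j \<omega> * dW (?h N) j \<omega> $ k) - 0) < e"
    proof (intro exI[of _ n0] allI impI)
      fix N assume N: "N \<ge> n0"
      have "dP (\<lambda>\<omega>. \<Sum>j=0..<i*2^N. ?c N j \<omega> * dW (?h N) j \<omega> $ k) \<le>
          prob {\<omega>\<in>space M. \<exists>j\<in>{0..<i*2^N}. \<eta> < \<bar>?c N j \<omega>\<bar>} + \<eta> * sqrt (real (i*2^N - 0) * ?h N)"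
        by (rule noise_sum_dP[OF centred_noise_component[OF h] cm]) (use \<eta> in auto)
      also have "real (i*2^N - 0) * ?h N = t'" by (simp add: t'_def power_add)
      also have "\<eta> * sqrt t' = e / 2" using t' by (simp add: \<eta>_def)
      finally show "norm (dP (\<lambda>\<omega>. \<Sum>j=0..<i*2^N. ?c N j \<omega> * dW (?h N) j \<omega> $ k) - 0) < e"
        using n0[OF N] dP_nonneg[of "\<lambda>\<omega>. \<Sum>j=0..<i*2^N. ?c N j \<omega> * dW (?h N) j \<omega> $ k"] by simp
    qed
  qed
  define Z where "Z N k \<omega> = (\<Sum>j=0..<i*2^N. ?c N j \<omega> * dW (?h N) j \<omega> $ k)" for N k \<omega>
  define A where "A N \<omega> = ?A N \<omega>" for N \<omega>
  define BB where "BB N \<omega> = ?B N \<omega>" for N \<omega>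
  have Zm[measurable]: "Z N k \<in> borel_measurable M" for N k
    unfolding Z_def using h[of N] adapted_measurable[OF cm]
    by (intro borel_measurable_sum borel_measurable_times measurable_compose[OF dW_measurable vec_nth_borel_measurable]) auto
  have Am'[measurable]: "A N \<in> borel_measurable M" for N unfolding A_def by (rule Am)
  have Bm'[measurable]: "BB N \<in> borel_measurable M" for N unfolding BB_def by (rule Bm)
  have BA: "BB N \<omega> - A N \<omega> = (\<Sum>j=0..<i*2^N. ?c N j \<omega> *\<^sub>R dW (?h N) j \<omega>)" for N \<omega>
    unfolding BB_def A_def B by (simp add: sum_subtractf scaleR_diff_left)
  have BAk: "(BB N \<omega> - A N \<omega>) $ k = Z N k \<omega>" for N k \<omega>
    unfolding BA Z_def by (simp only: sum_component vector_scaleR_component real_scaleR_def)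
  have bound: "dP (\<lambda>\<omega>. norm (noise t' \<omega> - S *v A N \<omega>)) \<le>
      dP (\<lambda>\<omega>. norm (S *v BB N \<omega> - noise t' \<omega>)) + max 1 \<bar>CS\<bar> * (\<Sum>k\<in>UNIV. dP (Z N k))" for N
  proof -
    have "dP (\<lambda>\<omega>. norm (noise t' \<omega> - S *v A N \<omega>)) \<le> dP (\<lambda>\<omega>. norm (S *v BB N \<omega> - noise t' \<omega>)) +
        dP (\<lambda>\<omega>. CS * (\<Sum>k\<in>UNIV. \<bar>Z N k \<omega>\<bar>))"
    proof (rule dP_triangle)
      show "(\<lambda>\<omega>. CS * (\<Sum>k\<in>UNIV. \<bar>Z N k \<omega>\<bar>)) \<in> borel_measurable M" by measurable
    next
      fix \<omega> assume "\<omega> \<in> space M"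
      have "norm (BB N \<omega> - A N \<omega>) \<le> (\<Sum>k\<in>UNIV. \<bar>Z N k \<omega>\<bar>)"
        using norm_le_l1_cart[of "BB N \<omega> - A N \<omega>"] unfolding BAk .
      then have "CS * norm (BB N \<omega> - A N \<omega>) \<le> CS * (\<Sum>k\<in>UNIV. \<bar>Z N k \<omega>\<bar>)"
        using CS(1) by (rule mult_left_mono)
      moreover have "norm (S *v BB N \<omega> - S *v A N \<omega>) \<le> CS * norm (BB N \<omega> - A N \<omega>)"
        using CS(2)[of "BB N \<omega> - A N \<omega>"] by (simp add: matrix_vector_mult_diff_distrib)
      moreover have "norm (noise t' \<omega> - S *v A N \<omega>) \<le> norm (S *v BB N \<omega> - noise t' \<omega>) + norm (S *v BB N \<omega> - S *v A N \<omega>)"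
        using norm_triangle_ineq4[of "S *v BB N \<omega> - S *v A N \<omega>" "S *v BB N \<omega> - noise t' \<omega>"] by simp
      ultimately show "\<bar>norm (noise t' \<omega> - S *v A N \<omega>)\<bar> \<le> \<bar>norm (S *v BB N \<omega> - noise t' \<omega>)\<bar> +
          \<bar>CS * (\<Sum>k\<in>UNIV. \<bar>Z N k \<omega>\<bar>)\<bar>" unfolding abs_norm_cancel by linarith
    qed (intro norm_measurable borel_measurable_diff matrix_vector_measurable Am' Bm' nm)+
    also have "dP (\<lambda>\<omega>. CS * (\<Sum>k\<in>UNIV. \<bar>Z N k \<omega>\<bar>)) \<le> max 1 \<bar>CS\<bar> * dP (\<lambda>\<omega>. \<Sum>k\<in>UNIV. \<bar>Z N k \<omega>\<bar>)"
      by (rule dP_scale) measurable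
    also have "dP (\<lambda>\<omega>. \<Sum>k\<in>UNIV. \<bar>Z N k \<omega>\<bar>) \<le> (\<Sum>k\<in>UNIV. dP (\<lambda>\<omega>. \<bar>Z N k \<omega>\<bar>))"
      by (rule dP_sum) auto
    finally show ?thesis by (simp add: dP_def mult_left_mono)
  qed
  have lim: "(\<lambda>N. dP (\<lambda>\<omega>. norm (S *v BB N \<omega> - noise t' \<omega>)) + max 1 \<bar>CS\<bar> * (\<Sum>k\<in>UNIV. dP (Z N k))) \<longlonglongrightarrow>
      0 + max 1 \<bar>CS\<bar> * (\<Sum>k\<in>(UNIV::'d set). 0)"
    using t' diff noise_riemann_dP[of t'] unfolding BB_def Z_def[abs_def]
    by (intro tendsto_add tendsto_mult tendsto_const tendsto_sum) auto
  have "(\<lambda>N. dP (\<lambda>\<omega>. norm (noise t' \<omega> - S *v A N \<omega>))) \<longlonglongrightarrow> 0"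
    by (rule tendsto_sandwich[OF _ _ tendsto_const lim[simplified]])
      (auto intro!: always_eventually dP_nonneg bound)
  then show ?thesis unfolding A_def t'_def .
qed

end

section \<open>Coarse cells compared with finer grids\<close>

lemma sum_block_regroup:
  fixes f :: "nat \<Rightarrow> nat \<Rightarrow> 'b::comm_monoid_add"
  assumes "m > 0"
  shows "(\<Sum>i<k. \<Sum>j=i*m..<Suc i*m. f i j) = (\<Sum>j=0..<k*m. f (j div m) j)"
proof -
  have "(\<Sum>i<k. \<Sum>j=i*m..<Suc i*m. f i j) = (\<Sum>i<k. \<Sum>j=i*m..<i*m+m. f (j div m) j)"
  proof (intro sum.cong refl)
    fix i j assume "j \<in> {i*m..<i*m+m}"
    then have "j div m = i" by (intro div_nat_eqI) (auto simp: algebra_simps)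
    then show "f i j = f (j div m) j" by simp
  qed (simp add: algebra_simps)
  also have "\<dots> = (\<Sum>j<k*m. f (j div m) j)" by (rule sum.nat_group)
  finally show ?thesis by (simp add: lessThan_atLeast0)
qed

lemma block_div: "j \<in> {i*m..<Suc i*m} \<Longrightarrow> m > 0 \<Longrightarrow> j div m = (i::nat)"
  by (intro div_nat_eqI) (auto simp: algebra_simps)

lemma (in prob_space) dP_square:
  assumes [measurable]: "Y \<in> borel_measurable M"
  shows "dP (\<lambda>\<omega>. (Y \<omega>)\<^sup>2) \<le> dP Y"
proof -
  have "min 1 (y\<^sup>2) \<le> min 1 \<bar>y\<bar>" for y :: real
  proof (cases "\<bar>y\<bar> \<le> 1")
    case True
    then have "y\<^sup>2 \<le> \<bar>y\<bar>" using mult_left_le[of "\<bar>y\<bar>" "\<bar>y\<bar>"] by (simp add: power2_eq_square abs_mult_self_eq)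
    then show ?thesis by simp
  qed simp
  then show ?thesis unfolding dP_def
    using dP_integrable[of Y] dP_integrable[of "\<lambda>\<omega>. (Y \<omega>)\<^sup>2"] by (intro integral_mono) auto
qed

context scalar_noise_sde begin

definition gp :: "real \<Rightarrow> nat \<Rightarrow> nat \<Rightarrow> real" where
  "gp t n i = real i * (t / 2 ^ n)"

lemma gp_simps: "gp t n 0 = 0" "gp t n (2 ^ n) = t" "gp t (n + N) (i * 2 ^ N) = gp t n i"
  "gp t n (Suc i) = gp t n i + t / 2 ^ n"
  by (simp_all add: gp_def power_add field_simps)

lemma gp_mono: "t \<ge> 0 \<Longrightarrow> i \<le> j \<Longrightarrow> gp t n i \<le> gp t n j"
  by (auto simp: gp_def intro!: divide_right_mono mult_right_mono)

lemma gp_nonneg: "t \<ge> 0 \<Longrightarrow> 0 \<le> gp t n i"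
  by (simp add: gp_def)

lemma gp_le: "t \<ge> 0 \<Longrightarrow> i \<le> 2 ^ n \<Longrightarrow> gp t n i \<le> t"
  using gp_mono[of t i "2 ^ n" n] by (simp add: gp_simps)

lemma gp_block:
  assumes "t \<ge> 0"
  shows "gp t n (j div 2 ^ N) \<le> gp t (n + N) j" "gp t (n + N) j \<le> gp t n (j div 2 ^ N) + t / 2 ^ n"
proof -
  have "gp t (n + N) (j div 2 ^ N * 2 ^ N) \<le> gp t (n + N) j"
    using assms by (intro gp_mono) auto
  then show "gp t n (j div 2 ^ N) \<le> gp t (n + N) j" by (simp add: gp_simps)
  have "j \<le> Suc (j div 2 ^ N) * 2 ^ N"
    by (metis Suc_times_mod_eq dividend_less_div_times less_imp_le_nat mult_Suc add.commute zero_less_numeral zero_less_power)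
  then have "gp t (n + N) j \<le> gp t (n + N) (Suc (j div 2 ^ N) * 2 ^ N)"
    using assms by (intro gp_mono) auto
  then show "gp t (n + N) j \<le> gp t n (j div 2 ^ N) + t / 2 ^ n" by (simp only: gp_simps)
qed

definition dWg :: "real \<Rightarrow> nat \<Rightarrow> nat \<Rightarrow> 'a \<Rightarrow> real^'d" where
  "dWg t n i = dW (t / 2 ^ n) i"

lemma dWg_measurable [measurable]: "t > 0 \<Longrightarrow> dWg t n i \<in> borel_measurable M"
  unfolding dWg_def by (rule dW_measurable) simp

lemma dWg_block: "dWg t n i \<omega> = (\<Sum>j=i*2^N..<Suc i*2^N. dWg t (n + N) j \<omega>)"
proof -
  have "dWg t n i \<omega> = W (gp t n (Suc i)) \<omega> - W (gp t n i) \<omega>" by (simp only: dWg_def dW_def gp_def)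
  also have "\<dots> = W (gp t (n + N) (Suc i * 2 ^ N)) \<omega> - W (gp t (n + N) (i * 2 ^ N)) \<omega>" by (simp only: gp_simps(3))
  also have "Suc i * 2 ^ N = i * 2 ^ N + 2 ^ N" by simp
  also have "W (gp t (n + N) (i * 2 ^ N + 2 ^ N)) \<omega> - W (gp t (n + N) (i * 2 ^ N)) \<omega> =
      (\<Sum>j=i*2^N..<i*2^N+2^N. dWg t (n + N) j \<omega>)"
    unfolding gp_def dWg_def by (rule dW_telescope)
  finally show ?thesis by (simp add: add.commute)
qed

definition rX :: "real \<Rightarrow> nat \<Rightarrow> nat \<Rightarrow> 'a \<Rightarrow> real" where
  "rX t n i \<omega> = r (X (gp t n i) \<omega>)"

lemma rX_measurable [measurable]: "t > 0 \<Longrightarrow> rX t n i \<in> borel_measurable M"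
  unfolding rX_def[abs_def] by (rule fX_measurable[OF r_cont]) (simp add: gp_nonneg)

text \<open>\<open>mart_err\<close> compares the noise over one coarse cell with its one-step Euler approximation;
  \<open>osc_sum\<close> is its approximation on the grid that is \<open>N\<close> levels finer.\<close>

definition mart_err :: "real \<Rightarrow> nat \<Rightarrow> nat \<Rightarrow> 'a \<Rightarrow> real^'d" where
  "mart_err t n i \<omega> = noise (gp t n (Suc i)) \<omega> - noise (gp t n i) \<omega> - S *v (rX t n i \<omega> *\<^sub>R dWg t n i \<omega>)"

definition osc_sum :: "real \<Rightarrow> nat \<Rightarrow> nat \<Rightarrow> nat \<Rightarrow> 'a \<Rightarrow> real^'d" where
  "osc_sum t n N i \<omega> = (\<Sum>j=i*2^N..<Suc i*2^N. (rX t (n + N) j \<omega> - rX t n i \<omega>) *\<^sub>R dWg t (n + N) j \<omega>)"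

lemma mart_err_measurable [measurable]: "t > 0 \<Longrightarrow> mart_err t n i \<in> borel_measurable M"
  unfolding mart_err_def[abs_def]
  by (intro borel_measurable_diff matrix_vector_measurable noise_measurable borel_measurable_scaleR
      rX_measurable dWg_measurable gp_nonneg) auto

lemma osc_sum_measurable [measurable]: "t > 0 \<Longrightarrow> osc_sum t n N i \<in> borel_measurable M"
  unfolding osc_sum_def[abs_def]
  by (intro borel_measurable_sum borel_measurable_scaleR borel_measurable_diff rX_measurable dWg_measurable) auto

lemma mart_err_approx:
  assumes t: "t > 0"
  shows "(\<lambda>N. dP (\<lambda>\<omega>. norm (mart_err t n i \<omega> - S *v osc_sum t n N i \<omega>))) \<longlonglongrightarrow> 0"
proof -
  define A where "A k N \<omega> = (\<Sum>j=0..<k*2^N. rX t (n + N) j \<omega> *\<^sub>R dWg t (n + N) j \<omega>)" for k N \<omega>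
  define Z where "Z k N \<omega> = noise (gp t n k) \<omega> - S *v A k N \<omega>" for k N \<omega>
  have Zm[measurable]: "Z k N \<in> borel_measurable M" for k N
    unfolding Z_def[abs_def] A_def using t
    by (intro borel_measurable_diff matrix_vector_measurable noise_measurable borel_measurable_sum borel_measurable_scaleR
      rX_measurable dWg_measurable gp_nonneg) auto
  have lim: "(\<lambda>N. dP (\<lambda>\<omega>. norm (Z k N \<omega>))) \<longlonglongrightarrow> 0" for k
    using noise_fine_grid_dP[OF t, of k n] by (simp add: Z_def A_def rX_def gp_def dWg_def)
  have eq: "mart_err t n i \<omega> - S *v osc_sum t n N i \<omega> = Z (Suc i) N \<omega> - Z i N \<omega>" for N \<omega>
  proof -
    have "A (Suc i) N \<omega> = A i N \<omega> + (\<Sum>j=i*2^N..<Suc i*2^N. rX t (n + N) j \<omega> *\<^sub>R dWg t (n + N) j \<omega>)"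
      unfolding A_def by (rule sum.atLeastLessThan_concat[symmetric]) auto
    moreover have "osc_sum t n N i \<omega> = (\<Sum>j=i*2^N..<Suc i*2^N. rX t (n + N) j \<omega> *\<^sub>R dWg t (n + N) j \<omega>)
        - rX t n i \<omega> *\<^sub>R dWg t n i \<omega>"
      unfolding osc_sum_def dWg_block[of t n i \<omega> N] by (simp add: scaleR_diff_left sum_subtractf scaleR_sum_right)
    ultimately have "osc_sum t n N i \<omega> = A (Suc i) N \<omega> - A i N \<omega> - rX t n i \<omega> *\<^sub>R dWg t n i \<omega>" by simp
    then show ?thesis by (simp add: mart_err_def Z_def matrix_vector_mult_diff_distrib)
  qed
  have le: "dP (\<lambda>\<omega>. norm (mart_err t n i \<omega> - S *v osc_sum t n N i \<omega>)) \<le> dP (\<lambda>\<omega>. norm (Z (Suc i) N \<omega>)) + dP (\<lambda>\<omega>. norm (Z i N \<omega>))" for N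
    unfolding eq by (rule dP_triangle) (measurable, simp add: norm_triangle_ineq4)
  have lim2: "(\<lambda>N. dP (\<lambda>\<omega>. norm (Z (Suc i) N \<omega>)) + dP (\<lambda>\<omega>. norm (Z i N \<omega>))) \<longlonglongrightarrow> 0"
    using tendsto_add[OF lim lim] by simp
  show ?thesis
    by (rule tendsto_sandwich[OF always_eventually always_eventually tendsto_const lim2])
      (use le dP_nonneg in auto)
qed

text \<open>All refinements \<open>N\<close> are included at once, so that the event stays the same
  while \<open>N\<close> tends to infinity with \<open>n\<close> fixed.\<close>

definition osc_event :: "real \<Rightarrow> nat \<Rightarrow> real \<Rightarrow> 'a set" where
  "osc_event t n \<eta> = {\<omega>\<in>space M. \<exists>N. \<exists>j\<in>{0..<2^n*2^N}. \<eta> < \<bar>rX t (n + N) j \<omega> - rX t n (j div 2^N) \<omega>\<bar>}"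

lemma osc_event_measurable [measurable]: "t > 0 \<Longrightarrow> osc_event t n \<eta> \<in> events"
  unfolding osc_event_def by measurable

lemma prob_osc_event_tendsto_0:
  assumes t: "t > 0" and \<eta>: "\<eta> > 0"
  shows "(\<lambda>n. prob (osc_event t n \<eta>)) \<longlonglongrightarrow> 0"
proof (rule prob_tendsto_0_pathwise)
  fix \<omega> assume w: "\<omega> \<in> space M"
  from uniform_grid_modulus[OF fX_cont'[OF r_cont w order_refl] \<eta> t, of 1]
  obtain n0 where n0: "\<And>n s s'. n \<ge> n0 \<Longrightarrow> s \<in> {0..t} \<Longrightarrow> s' \<in> {0..t} \<Longrightarrow> \<bar>s - s'\<bar> \<le> 1 * t / 2 ^ n \<Longrightarrow>
      dist (r (X s \<omega>)) (r (X s' \<omega>)) < \<eta>" by blast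
  have "\<omega> \<notin> osc_event t n \<eta>" if n: "n \<ge> n0" for n
  proof
    assume "\<omega> \<in> osc_event t n \<eta>"
    then obtain N j where j: "j < 2^n*2^N" "\<eta> < \<bar>rX t (n + N) j \<omega> - rX t n (j div 2^N) \<omega>\<bar>"
      unfolding osc_event_def by auto
    have "gp t (n + N) j \<le> t" using t j(1) by (intro gp_le) (auto simp: power_add)
    then have "dist (r (X (gp t (n + N) j) \<omega>)) (r (X (gp t n (j div 2^N)) \<omega>)) < \<eta>"
      using gp_block(1)[of t n j N] gp_block(2)[of t n N j] gp_nonneg[of t n "j div 2^N"] t by (intro n0[OF n]) auto
    then show False using j(2) unfolding rX_def dist_real_def by linarith
  qed
  then show "eventually (\<lambda>n. \<omega> \<notin> osc_event t n \<eta>) sequentially" by (auto simp: eventually_sequentially)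
qed (use t in measurable)

lemma fX_grid_adapted:
  assumes "continuous_on UNIV f" "t > 0"
  shows "(\<lambda>\<omega>. f (X (gp t n (j div 2^N)) \<omega>)) \<in> borel_measurable (F (real j * (t / 2^(n + N))))"
  using fX_adapted[OF assms(1) gp_nonneg, of t n "j div 2^N" "gp t (n + N) j"] gp_block(1)[of t n j N] assms(2)
  by (simp add: gp_def)

text \<open>Estimating the \<open>2^n\<close> cells one by one would lose too much. Over all cells,
  the weighted \<open>osc_sum\<close> terms form one martingale sum per component on the fine grid.
  Off \<open>osc_event\<close> its coefficients are at most \<open>K * \<eta>\<close>, so its
  \<open>L\<^sup>2\<close> size is of order \<open>\<eta> * sqrt t\<close>, uniformly in both
  levels. The approximation errors of the single cells vanish as \<open>N\<close> grows with
  \<open>n\<close> fixed.\<close>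

lemma mart_err_weighted_tendsto_0:
  fixes g :: "real^'d \<Rightarrow> real^'d"
  assumes t: "t > 0" and gc: "continuous_on UNIV g" and gb: "\<And>x. norm (g x) \<le> C"
  shows "(\<lambda>n. dP (\<lambda>\<omega>. \<Sum>i<2^n. g (X (gp t n i) \<omega>) \<bullet> mart_err t n i \<omega>)) \<longlonglongrightarrow> 0"
proof (rule LIMSEQ_I)
  fix e :: real assume e: "e > 0"
  have C: "C \<ge> 0" using gb[of 0] norm_ge_zero order_trans by blast
  obtain KS where KS: "KS > 0" "\<And>x. norm (transpose S *v x) \<le> norm x * KS"
    using bounded_linear.pos_bounded[OF matrix_vector_mul_bounded_linear[of "transpose S"]] by blast
  define K where "K = C * KS + 1"
  have K: "K > 0" using C KS by (simp add: K_def add_nonneg_pos)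
  define gS where "gS x = transpose S *v g x" for x
  have gSb: "\<bar>gS x $ k\<bar> \<le> K" for x k
  proof -
    have "\<bar>gS x $ k\<bar> \<le> norm (gS x)" by (rule component_le_norm_cart)
    also have "\<dots> \<le> norm (g x) * KS" unfolding gS_def by (rule KS)
    also have "\<dots> \<le> C * KS" using gb KS(1) by (intro mult_right_mono) auto
    finally show ?thesis by (simp add: K_def)
  qed
  have "continuous_on UNIV gS"
    unfolding gS_def[abs_def]
    by (rule continuous_on_compose2[OF linear_continuous_on[OF matrix_vector_mul_bounded_linear, of UNIV] gc]) auto
  then have gSc: "continuous_on UNIV (\<lambda>x. gS x $ k)" for k
    by (intro continuous_intros)
  define dd where "dd = real CARD('d)"
  have dd: "dd > 0" by (simp add: dd_def)
  \<comment> \<open>Chosen so that the \<open>L\<^sup>2\<close> contributions of all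
    \<open>dd\<close> components add up to \<open>e / 4\<close>.\<close>
  define \<eta> where "\<eta> = e / (4 * dd * K * sqrt t)"
  have \<eta>: "\<eta> > 0" using e K dd t by (simp add: \<eta>_def)
  define gg where "gg n i \<omega> = g (X (gp t n i) \<omega>)" for n i \<omega>
  have ggm[measurable]: "gg n i \<in> borel_measurable M" for n i
    unfolding gg_def[abs_def] using t by (intro fX_measurable[OF gc] gp_nonneg) auto
  note [measurable] = mart_err_measurable[OF t] osc_sum_measurable[OF t]
  define Z where "Z n N k \<omega> = (\<Sum>j=0..<2^n*2^N. (gS (X (gp t n (j div 2^N)) \<omega>) $ k * (rX t (n + N) j \<omega> - rX t n (j div 2^N) \<omega>)) * dWg t (n + N) j \<omega> $ k)" for n N k \<omega>
  have cm: "(\<lambda>\<omega>. gS (X (gp t n (j div 2^N)) \<omega>) $ k * (rX t (n + N) j \<omega> - rX t n (j div 2^N) \<omega>)) \<in> borel_measurable (F (real j * (t / 2^(n + N))))"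
    for n N k j
    using fX_grid_adapted[OF gSc[of k] t, of n j N] fX_grid_adapted[OF r_cont t, of n j N] fX_grid_adapted[OF r_cont t, of "n + N" j 0]
    by (simp add: rX_def)
  have Zm[measurable]: "Z n N k \<in> borel_measurable M" for n N k
    unfolding Z_def[abs_def] using t adapted_measurable[OF cm]
    by (intro borel_measurable_sum borel_measurable_times[OF _ measurable_compose[OF dWg_measurable vec_nth_borel_measurable]]) auto
  have Zb: "dP (Z n N k) \<le> prob (osc_event t n \<eta>) + K * \<eta> * sqrt t" for n N k
  proof -
    let ?h = "t / 2^(n + N)"
    have "dP (Z n N k) \<le> prob {\<omega>\<in>space M. \<exists>j\<in>{0..<2^n*2^N}. K * \<eta> <
        \<bar>gS (X (gp t n (j div 2^N)) \<omega>) $ k * (rX t (n + N) j \<omega> - rX t n (j div 2^N) \<omega>)\<bar>} + K * \<eta> * sqrt (real (2^n*2^N - 0) * ?h)"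
      unfolding Z_def[abs_def] dWg_def
      by (rule noise_sum_dP[OF centred_noise_component cm]) (use t K \<eta> in auto)
    also have "real (2^n*2^N - 0) * ?h = t" by (simp add: power_add)
    also have "prob {\<omega>\<in>space M. \<exists>j\<in>{0..<2^n*2^N}. K * \<eta> <
        \<bar>gS (X (gp t n (j div 2^N)) \<omega>) $ k * (rX t (n + N) j \<omega> - rX t n (j div 2^N) \<omega>)\<bar>} \<le> prob (osc_event t n \<eta>)"
    proof (rule finite_measure_mono)
      show "{\<omega>\<in>space M. \<exists>j\<in>{0..<2^n*2^N}. K * \<eta> <
        \<bar>gS (X (gp t n (j div 2^N)) \<omega>) $ k * (rX t (n + N) j \<omega> - rX t n (j div 2^N) \<omega>)\<bar>} \<subseteq> osc_event t n \<eta>"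
      proof
        fix \<omega> assume "\<omega> \<in> {\<omega>\<in>space M. \<exists>j\<in>{0..<2^n*2^N}. K * \<eta> <
          \<bar>gS (X (gp t n (j div 2^N)) \<omega>) $ k * (rX t (n + N) j \<omega> - rX t n (j div 2^N) \<omega>)\<bar>}"
        then obtain j where w: "\<omega> \<in> space M" and j: "j \<in> {0..<2^n*2^N}" and
          lt: "K * \<eta> < \<bar>gS (X (gp t n (j div 2^N)) \<omega>) $ k * (rX t (n + N) j \<omega> - rX t n (j div 2^N) \<omega>)\<bar>" by blast
        note lt
        also have "\<bar>gS (X (gp t n (j div 2^N)) \<omega>) $ k * (rX t (n + N) j \<omega> - rX t n (j div 2^N) \<omega>)\<bar> \<le>
            K * \<bar>rX t (n + N) j \<omega> - rX t n (j div 2^N) \<omega>\<bar>"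
          unfolding abs_mult by (intro mult_right_mono gSb) auto
        finally have "\<eta> < \<bar>rX t (n + N) j \<omega> - rX t n (j div 2^N) \<omega>\<bar>" using K by simp
        then show "\<omega> \<in> osc_event t n \<eta>" unfolding osc_event_def using w j by blast
      qed
    qed (use t in measurable)
    finally show ?thesis by simp
  qed
  \<comment> \<open>Moving \<open>S\<close> onto \<open>g\<close> as a transpose and regrouping the
    cells leaves, for each component, a single sum over fine increments with adapted
    coefficients.\<close>
  have split: "(\<Sum>i<2^n. gg n i \<omega> \<bullet> (S *v osc_sum t n N i \<omega>)) = (\<Sum>k\<in>UNIV. Z n N k \<omega>)" for n N \<omega>
  proof -
    have "gg n i \<omega> \<bullet> (S *v osc_sum t n N i \<omega>) = (\<Sum>j=i*2^N..<Suc i*2^N. \<Sum>k\<in>UNIV.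
        (gS (X (gp t n i) \<omega>) $ k * (rX t (n + N) j \<omega> - rX t n i \<omega>)) * dWg t (n + N) j \<omega> $ k)" for i
    proof -
      have "gg n i \<omega> \<bullet> (S *v osc_sum t n N i \<omega>) = gS (X (gp t n i) \<omega>) \<bullet> osc_sum t n N i \<omega>"
        unfolding gS_def gg_def by (metis dot_lmul_matrix transpose_matrix_vector)
      also have "\<dots> = (\<Sum>j=i*2^N..<Suc i*2^N. (rX t (n + N) j \<omega> - rX t n i \<omega>) * (gS (X (gp t n i) \<omega>) \<bullet> dWg t (n + N) j \<omega>))"
        unfolding osc_sum_def inner_sum_right inner_scaleR_right ..
      also have "\<dots> = (\<Sum>j=i*2^N..<Suc i*2^N. \<Sum>k\<in>UNIV.
        (gS (X (gp t n i) \<omega>) $ k * (rX t (n + N) j \<omega> - rX t n i \<omega>)) * dWg t (n + N) j \<omega> $ k)"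
        by (intro sum.cong refl) (simp add: inner_vec_def sum_distrib_left mult_ac)
      finally show ?thesis .
    qed
    then have "(\<Sum>i<2^n. gg n i \<omega> \<bullet> (S *v osc_sum t n N i \<omega>)) = (\<Sum>j=0..<2^n*2^N. \<Sum>k\<in>UNIV.
        (gS (X (gp t n (j div 2^N)) \<omega>) $ k * (rX t (n + N) j \<omega> - rX t n (j div 2^N) \<omega>)) * dWg t (n + N) j \<omega> $ k)"
      using sum_block_regroup[of "2^N" "\<lambda>i j. \<Sum>k\<in>UNIV. (gS (X (gp t n i) \<omega>) $ k * (rX t (n + N) j \<omega> - rX t n i \<omega>)) * dWg t (n + N) j \<omega> $ k" "2^n"]
      by simp
    also have "\<dots> = (\<Sum>k\<in>UNIV. Z n N k \<omega>)" unfolding Z_def by (rule sum.swap)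
    finally show ?thesis .
  qed
  have bound: "dP (\<lambda>\<omega>. \<Sum>i<2^n. gg n i \<omega> \<bullet> mart_err t n i \<omega>) \<le> dd * (prob (osc_event t n \<eta>) + K * \<eta> * sqrt t)" for n
  proof -
    define Y where "Y N i \<omega> = norm (mart_err t n i \<omega> - S *v osc_sum t n N i \<omega>)" for N i \<omega>
    have Ym[measurable]: "Y N i \<in> borel_measurable M" for N i
      unfolding Y_def[abs_def] by (intro norm_measurable borel_measurable_diff matrix_vector_measurable) measurable
    have "dP (\<lambda>\<omega>. \<Sum>i<2^n. gg n i \<omega> \<bullet> mart_err t n i \<omega>) \<le>
        (\<Sum>i<2^n. max 1 \<bar>C\<bar> * dP (Y N i)) + dd * (prob (osc_event t n \<eta>) + K * \<eta> * sqrt t)" for N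
    proof -
      have "dP (\<lambda>\<omega>. \<Sum>i<2^n. gg n i \<omega> \<bullet> mart_err t n i \<omega>) \<le> dP (\<lambda>\<omega>. \<Sum>i<2^n. C * Y N i \<omega>) + dP (\<lambda>\<omega>. \<Sum>k\<in>UNIV. Z n N k \<omega>)"
      proof (rule dP_triangle)
        fix \<omega>
        have "(\<Sum>i<2^n. gg n i \<omega> \<bullet> mart_err t n i \<omega>) =
            (\<Sum>i<2^n. gg n i \<omega> \<bullet> (mart_err t n i \<omega> - S *v osc_sum t n N i \<omega>)) + (\<Sum>k\<in>UNIV. Z n N k \<omega>)"
          unfolding split[symmetric] by (simp add: inner_diff_right sum_subtractf)
        moreover have "\<bar>\<Sum>i<2^n. gg n i \<omega> \<bullet> (mart_err t n i \<omega> - S *v osc_sum t n N i \<omega>)\<bar> \<le> (\<Sum>i<2^n. C * Y N i \<omega>)"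
        proof (rule order_trans[OF sum_abs sum_mono])
          fix i
          have "\<bar>gg n i \<omega> \<bullet> (mart_err t n i \<omega> - S *v osc_sum t n N i \<omega>)\<bar> \<le> norm (gg n i \<omega>) * Y N i \<omega>"
            unfolding Y_def by (rule Cauchy_Schwarz_ineq2)
          also have "\<dots> \<le> C * Y N i \<omega>" unfolding gg_def Y_def by (intro mult_right_mono gb) auto
          finally show "\<bar>gg n i \<omega> \<bullet> (mart_err t n i \<omega> - S *v osc_sum t n N i \<omega>)\<bar> \<le> C * Y N i \<omega>" .
        qed
        ultimately show "\<bar>\<Sum>i<2^n. gg n i \<omega> \<bullet> mart_err t n i \<omega>\<bar> \<le> \<bar>\<Sum>i<2^n. C * Y N i \<omega>\<bar> + \<bar>\<Sum>k\<in>UNIV. Z n N k \<omega>\<bar>"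
          by linarith
      qed measurable
      also have "dP (\<lambda>\<omega>. \<Sum>i<2^n. C * Y N i \<omega>) \<le> (\<Sum>i<2^n. dP (\<lambda>\<omega>. C * Y N i \<omega>))"
        by (rule dP_sum) auto
      also have "\<dots> \<le> (\<Sum>i<2^n. max 1 \<bar>C\<bar> * dP (Y N i))"
        by (intro sum_mono dP_scale) auto
      also have "dP (\<lambda>\<omega>. \<Sum>k\<in>UNIV. Z n N k \<omega>) \<le> (\<Sum>k\<in>UNIV. dP (Z n N k))"
        by (rule dP_sum) auto
      also have "\<dots> \<le> (\<Sum>k\<in>(UNIV::'d set). prob (osc_event t n \<eta>) + K * \<eta> * sqrt t)" by (intro sum_mono Zb)
      also have "\<dots> = dd * (prob (osc_event t n \<eta>) + K * \<eta> * sqrt t)" by (simp add: dd_def)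
      finally show ?thesis by simp
    qed
    \<comment> \<open>The limit in the fine level: with \<open>n\<close> fixed there are finitely
      many cell errors, and each disappears.\<close>
    moreover have "(\<lambda>N. (\<Sum>i<2^n. max 1 \<bar>C\<bar> * dP (Y N i)) + dd * (prob (osc_event t n \<eta>) + K * \<eta> * sqrt t)) \<longlonglongrightarrow>
        (\<Sum>i<(2::nat)^n. max 1 \<bar>C\<bar> * 0) + dd * (prob (osc_event t n \<eta>) + K * \<eta> * sqrt t)"
      using mart_err_approx[OF t, of n] unfolding Y_def[abs_def]
      by (intro tendsto_add tendsto_mult tendsto_const tendsto_sum) auto
    ultimately show ?thesis by (intro LIMSEQ_le_const[where X="\<lambda>N. _ N"]) auto
  qed
  have "eventually (\<lambda>n. prob (osc_event t n \<eta>) < e / (2 * dd)) sequentially"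
    using e dd by (intro order_tendstoD(2)[OF prob_osc_event_tendsto_0[OF t \<eta>]]) auto
  then obtain n0 where n0: "\<And>n. n \<ge> n0 \<Longrightarrow> prob (osc_event t n \<eta>) < e / (2 * dd)" by (auto simp: eventually_sequentially)
  show "\<exists>n0. \<forall>n\<ge>n0. norm (dP (\<lambda>\<omega>. \<Sum>i<2^n. g (X (gp t n i) \<omega>) \<bullet> mart_err t n i \<omega>) - 0) < e"
  proof (intro exI[of _ n0] allI impI)
    fix n assume n: "n \<ge> n0"
    have "dd * (K * \<eta> * sqrt t) = e / 4" using dd K t by (simp add: \<eta>_def)
    moreover have "dd * prob (osc_event t n \<eta>) < e / 2" using n0[OF n] dd by (simp add: field_simps)
    ultimately have "dP (\<lambda>\<omega>. \<Sum>i<2^n. gg n i \<omega> \<bullet> mart_err t n i \<omega>) < e"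
      using bound[of n] e by (simp add: distrib_left)
    then show "norm (dP (\<lambda>\<omega>. \<Sum>i<2^n. g (X (gp t n i) \<omega>) \<bullet> mart_err t n i \<omega>) - 0) < e"
      unfolding gg_def using dP_nonneg by simp
  qed
qed

end

lemma norm_power2_components: "(norm (x::real^'d))\<^sup>2 = (\<Sum>k\<in>UNIV. (x $ k)\<^sup>2)"
  unfolding power2_norm_eq_inner by (simp add: inner_vec_def power2_eq_square)

context scalar_noise_sde begin

lemma dWg_component_second_moment:
  assumes t: "t > 0"
  shows "integrable M (\<lambda>\<omega>. (dWg t n i \<omega> $ k)\<^sup>2)" "expectation (\<lambda>\<omega>. (dWg t n i \<omega> $ k)\<^sup>2) \<le> t / 2 ^ n"
  using centred_noise_component[of "t / 2 ^ n" k] t unfolding centred_noise_def dWg_def by auto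

text \<open>After truncation each component of \<open>osc_sum\<close> over one cell has second
  moment at most \<open>\<eta>\<^sup>2 * (t / 2^n)\<close>, so the \<open>2^n\<close> cells together
  are of order \<open>\<eta>\<^sup>2\<close>. Here too the fine level tends to infinity for fixed
  \<open>n\<close>.\<close>

lemma mart_err_squares_tendsto_0:
  assumes t: "t > 0"
  shows "(\<lambda>n. dP (\<lambda>\<omega>. \<Sum>i<2^n. (norm (mart_err t n i \<omega>))\<^sup>2)) \<longlonglongrightarrow> 0"
proof (rule LIMSEQ_I)
  fix e :: real assume e: "e > 0"
  obtain CS where CS: "CS \<ge> 0" "\<And>x. norm (S *v x) \<le> CS * norm x" using matrix_vector_norm_bound by blast
  define dd where "dd = real CARD('d)"
  define c0 where "c0 = 2 * CS\<^sup>2 * dd * t"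
  have c0: "c0 \<ge> 0" using t by (simp add: c0_def dd_def)
  define \<eta> where "\<eta> = sqrt (e / (2 * (c0 + 1)))"
  have \<eta>: "\<eta> > 0" "\<eta>\<^sup>2 = e / (2 * (c0 + 1))" using e c0 by (auto simp: \<eta>_def)
  have c\<eta>: "c0 * \<eta>\<^sup>2 \<le> e / 2" using e c0 unfolding \<eta>(2) by (simp add: field_simps)
  note [measurable] = mart_err_measurable[OF t] osc_sum_measurable[OF t] osc_event_measurable[OF t]
    dWg_measurable[OF t] rX_measurable[OF t]
  have bound: "dP (\<lambda>\<omega>. \<Sum>i<2^n. (norm (mart_err t n i \<omega>))\<^sup>2) \<le> prob (osc_event t n \<eta>) + e / 2" for n
  proof -
    define Y where "Y N i \<omega> = norm (mart_err t n i \<omega> - S *v osc_sum t n N i \<omega>)" for N i \<omega>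
    have Ym[measurable]: "Y N i \<in> borel_measurable M" for N i
      unfolding Y_def[abs_def] by (intro norm_measurable borel_measurable_diff matrix_vector_measurable) measurable
    define c where "c N j \<omega> = rX t (n + N) j \<omega> - rX t n (j div 2^N) \<omega>" for N j \<omega>
    \<comment> \<open>Truncation supplies the uniform bound that the second moment estimate
      requires; off \<open>osc_event\<close> it changes nothing.\<close>
    define c' where "c' N j \<omega> = (if \<bar>c N j \<omega>\<bar> \<le> \<eta> then c N j \<omega> else 0)" for N j \<omega>
    have cm: "c N j \<in> borel_measurable (F (real j * (t / 2^(n + N))))" for N j
      unfolding c_def[abs_def] rX_def
      using fX_grid_adapted[OF r_cont t, of n j N] fX_grid_adapted[OF r_cont t, of "n + N" j 0] by simp
    have c'm: "c' N j \<in> borel_measurable (F (real j * (t / 2^(n + N))))" for N j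
      unfolding c'_def[abs_def] by (rule noise_sum_truncated[OF cm])
    define E where "E N i k \<omega> = (\<Sum>j=i*2^N..<Suc i*2^N. c' N j \<omega> * dWg t (n + N) j \<omega> $ k)" for N i k \<omega>
    have Em2: "integrable M (\<lambda>\<omega>. (E N i k \<omega>)\<^sup>2)" "expectation (\<lambda>\<omega>. (E N i k \<omega>)\<^sup>2) \<le> \<eta>\<^sup>2 * (t / 2^n)" and
      Em[measurable]: "E N i k \<in> borel_measurable M" for N i k
    proof -
      have h: "t / 2^(n + N) > 0" using t by simp
      have ab: "i * 2^N \<le> Suc i * 2^N" by simp
      have c'b: "\<bar>c' N j \<omega>\<bar> \<le> \<eta>" for j \<omega> using \<eta> by (simp add: c'_def)
      from martingale_sum_second_moment[OF centred_noise_component[OF h, of k] c'm c'b ab]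
      have *: "E N i k \<in> borel_measurable (F (real (Suc i * 2 ^ N) * (t / 2 ^ (n + N))))" "integrable M (\<lambda>\<omega>. (E N i k \<omega>)\<^sup>2)"
        "expectation (\<lambda>\<omega>. (E N i k \<omega>)\<^sup>2) \<le> real (Suc i * 2^N - i * 2^N) * (\<eta>\<^sup>2 * (t / 2^(n + N)))"
        unfolding E_def[abs_def] dWg_def by blast+
      then show "integrable M (\<lambda>\<omega>. (E N i k \<omega>)\<^sup>2)" by blast
      have "real (Suc i * 2^N - i * 2^N) * (\<eta>\<^sup>2 * (t / 2^(n + N))) = \<eta>\<^sup>2 * (t / 2^n)"
        by (simp add: power_add)
      then show "expectation (\<lambda>\<omega>. (E N i k \<omega>)\<^sup>2) \<le> \<eta>\<^sup>2 * (t / 2^n)" using *(3) by simp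
      show "E N i k \<in> borel_measurable M" using *(1) by (rule adapted_measurable)
    qed
    define Q where "Q N \<omega> = 2 * CS\<^sup>2 * (\<Sum>i<2^n. \<Sum>k\<in>UNIV. (E N i k \<omega>)\<^sup>2)" for N \<omega>
    have Qm[measurable]: "Q N \<in> borel_measurable M" for N unfolding Q_def[abs_def] by measurable
    have Qi: "integrable M (Q N)" for N unfolding Q_def[abs_def] using Em2 by auto
    have Q0: "Q N \<omega> \<ge> 0" for N \<omega> unfolding Q_def by (intro mult_nonneg_nonneg sum_nonneg) auto
    have "expectation (Q N) = 2 * CS\<^sup>2 * (\<Sum>i<2^n. \<Sum>k\<in>UNIV. expectation (\<lambda>\<omega>. (E N i k \<omega>)\<^sup>2))" for N
      unfolding Q_def[abs_def] using Em2 by simp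
    moreover have "2 * CS\<^sup>2 * (\<Sum>i<2^n. \<Sum>k\<in>UNIV. expectation (\<lambda>\<omega>. (E N i k \<omega>)\<^sup>2)) \<le>
        2 * CS\<^sup>2 * (\<Sum>i<(2::nat)^n. \<Sum>k\<in>(UNIV::'d set). \<eta>\<^sup>2 * (t / 2^n))" for N
      by (intro mult_left_mono sum_mono Em2) auto
    moreover have "2 * CS\<^sup>2 * (\<Sum>i<(2::nat)^n. \<Sum>k\<in>(UNIV::'d set). \<eta>\<^sup>2 * (t / 2^n)) = c0 * \<eta>\<^sup>2"
      by (simp add: c0_def dd_def)
    ultimately have QE: "expectation (Q N) \<le> e / 2" for N using c\<eta> by (metis order_trans)
    have Qd: "dP (Q N) \<le> e / 2" for N
    proof -
      have "dP (Q N) \<le> expectation (Q N)" by (rule dP_le_expectation) (use Qi Q0 in auto)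
      then show ?thesis using QE[of N] by linarith
    qed
    have "dP (\<lambda>\<omega>. \<Sum>i<2^n. (norm (mart_err t n i \<omega>))\<^sup>2) \<le> (\<Sum>i<2^n. 2 * dP (Y N i)) + (prob (osc_event t n \<eta>) + e / 2)" for N
    proof -
      have "dP (\<lambda>\<omega>. \<Sum>i<2^n. (norm (mart_err t n i \<omega>))\<^sup>2) \<le> dP (\<lambda>\<omega>. \<Sum>i<2^n. 2 * (Y N i \<omega>)\<^sup>2) +
          dP (\<lambda>\<omega>. 2 * CS\<^sup>2 * (\<Sum>i<2^n. (norm (osc_sum t n N i \<omega>))\<^sup>2))"
      proof (rule dP_triangle)
        fix \<omega>
        have "(norm (mart_err t n i \<omega>))\<^sup>2 \<le> 2 * (Y N i \<omega>)\<^sup>2 + 2 * CS\<^sup>2 * (norm (osc_sum t n N i \<omega>))\<^sup>2" for i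
        proof -
          have "norm (mart_err t n i \<omega>) \<le> Y N i \<omega> + norm (S *v osc_sum t n N i \<omega>)"
            unfolding Y_def using norm_triangle_ineq[of "mart_err t n i \<omega> - S *v osc_sum t n N i \<omega>" "S *v osc_sum t n N i \<omega>"] by simp
          then have "norm (mart_err t n i \<omega>) \<le> Y N i \<omega> + CS * norm (osc_sum t n N i \<omega>)"
            using CS(2)[of "osc_sum t n N i \<omega>"] by linarith
          then have "(norm (mart_err t n i \<omega>))\<^sup>2 \<le> (Y N i \<omega> + CS * norm (osc_sum t n N i \<omega>))\<^sup>2"
            by (intro power_mono) auto
          also have "\<dots> \<le> 2 * (Y N i \<omega>)\<^sup>2 + 2 * (CS * norm (osc_sum t n N i \<omega>))\<^sup>2"
            using sum_squares_bound[of "Y N i \<omega>" "CS * norm (osc_sum t n N i \<omega>)"] by (simp add: power2_sum)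
          finally show ?thesis by (simp add: power_mult_distrib)
        qed
        then have "(\<Sum>i<2^n. (norm (mart_err t n i \<omega>))\<^sup>2) \<le> (\<Sum>i<2^n. 2 * (Y N i \<omega>)\<^sup>2 + 2 * CS\<^sup>2 * (norm (osc_sum t n N i \<omega>))\<^sup>2)"
          by (intro sum_mono)
        moreover have "\<dots> = (\<Sum>i<2^n. 2 * (Y N i \<omega>)\<^sup>2) + 2 * CS\<^sup>2 * (\<Sum>i<2^n. (norm (osc_sum t n N i \<omega>))\<^sup>2)"
          by (simp only: sum.distrib sum_distrib_left)
        moreover have "(\<Sum>i<2^n. (norm (mart_err t n i \<omega>))\<^sup>2) \<ge> 0" by (intro sum_nonneg) auto
        ultimately show "\<bar>\<Sum>i<2^n. (norm (mart_err t n i \<omega>))\<^sup>2\<bar> \<le> \<bar>\<Sum>i<2^n. 2 * (Y N i \<omega>)\<^sup>2\<bar> +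
            \<bar>2 * CS\<^sup>2 * (\<Sum>i<2^n. (norm (osc_sum t n N i \<omega>))\<^sup>2)\<bar>" by linarith
      qed measurable
      also have "dP (\<lambda>\<omega>. \<Sum>i<2^n. 2 * (Y N i \<omega>)\<^sup>2) \<le> (\<Sum>i<2^n. dP (\<lambda>\<omega>. 2 * (Y N i \<omega>)\<^sup>2))"
        by (rule dP_sum) auto
      also have "\<dots> \<le> (\<Sum>i<2^n. 2 * dP (Y N i))"
      proof (rule sum_mono)
        fix i
        have "dP (\<lambda>\<omega>. 2 * (Y N i \<omega>)\<^sup>2) \<le> 2 * dP (\<lambda>\<omega>. (Y N i \<omega>)\<^sup>2)"
          using dP_scale[of "\<lambda>\<omega>. (Y N i \<omega>)\<^sup>2" 2] by simp
        then show "dP (\<lambda>\<omega>. 2 * (Y N i \<omega>)\<^sup>2) \<le> 2 * dP (Y N i)" using dP_square[OF Ym, of N i] by linarith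
      qed
      also have "dP (\<lambda>\<omega>. 2 * CS\<^sup>2 * (\<Sum>i<2^n. (norm (osc_sum t n N i \<omega>))\<^sup>2)) \<le> prob (osc_event t n \<eta>) + dP (Q N)"
      proof (rule dP_event)
        fix \<omega> assume w: "\<omega> \<in> space M" "\<omega> \<notin> osc_event t n \<eta>"
        have "osc_sum t n N i \<omega> $ k = E N i k \<omega>" if i: "i < 2^n" for i k
        proof -
          have "osc_sum t n N i \<omega> $ k = (\<Sum>j=i*2^N..<Suc i*2^N. (rX t (n + N) j \<omega> - rX t n i \<omega>) * dWg t (n + N) j \<omega> $ k)"
            unfolding osc_sum_def by (simp only: sum_component vector_scaleR_component real_scaleR_def)
          also have "\<dots> = E N i k \<omega>" unfolding E_def
          proof (rule sum.cong)
            fix j assume j: "j \<in> {i*2^N..<Suc i*2^N}"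
            have d: "j div 2^N = i" by (rule block_div[OF j]) simp
            have "Suc i * 2^N \<le> 2^n * 2^N" using i by (intro mult_right_mono) auto
            then have "j \<in> {0..<2^n * 2^N}" using j by auto
            then have "\<not> \<eta> < \<bar>c N j \<omega>\<bar>" using w unfolding osc_event_def c_def by blast
            then show "(rX t (n + N) j \<omega> - rX t n i \<omega>) * dWg t (n + N) j \<omega> $ k = c' N j \<omega> * dWg t (n + N) j \<omega> $ k"
              by (simp add: c'_def c_def d)
          qed simp
          finally show ?thesis .
        qed
        then have "2 * CS\<^sup>2 * (\<Sum>i<2^n. (norm (osc_sum t n N i \<omega>))\<^sup>2) = Q N \<omega>"
          unfolding Q_def norm_power2_components by simp
        then show "\<bar>2 * CS\<^sup>2 * (\<Sum>i<2^n. (norm (osc_sum t n N i \<omega>))\<^sup>2)\<bar> \<le> \<bar>Q N \<omega>\<bar>" by simp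
      qed measurable
      finally show ?thesis using Qd[of N] by simp
    qed
    moreover have "(\<lambda>N. (\<Sum>i<2^n. 2 * dP (Y N i)) + (prob (osc_event t n \<eta>) + e / 2)) \<longlonglongrightarrow>
        (\<Sum>i<(2::nat)^n. 2 * 0) + (prob (osc_event t n \<eta>) + e / 2)"
      using mart_err_approx[OF t, of n] unfolding Y_def[abs_def]
      by (intro tendsto_add tendsto_mult tendsto_const tendsto_sum) auto
    ultimately show ?thesis by (intro LIMSEQ_le_const[where X="\<lambda>N. _ N"]) auto
  qed
  have "eventually (\<lambda>n. prob (osc_event t n \<eta>) < e / 2) sequentially"
    using e by (intro order_tendstoD(2)[OF prob_osc_event_tendsto_0[OF t \<eta>(1)]]) auto
  then obtain n0 where n0: "\<And>n. n \<ge> n0 \<Longrightarrow> prob (osc_event t n \<eta>) < e / 2" by (auto simp: eventually_sequentially)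
  show "\<exists>n0. \<forall>n\<ge>n0. norm (dP (\<lambda>\<omega>. \<Sum>i<2^n. (norm (mart_err t n i \<omega>))\<^sup>2) - 0) < e"
  proof (intro exI[of _ n0] allI impI)
    fix n assume n: "n \<ge> n0"
    show "norm (dP (\<lambda>\<omega>. \<Sum>i<2^n. (norm (mart_err t n i \<omega>))\<^sup>2) - 0) < e"
      using bound[of n] n0[OF n] dP_nonneg[of "\<lambda>\<omega>. \<Sum>i<2^n. (norm (mart_err t n i \<omega>))\<^sup>2"] by simp
  qed
qed

definition euler_noise :: "real \<Rightarrow> nat \<Rightarrow> nat \<Rightarrow> 'a \<Rightarrow> real^'d" where
  "euler_noise t n i \<omega> = S *v (rX t n i \<omega> *\<^sub>R dWg t n i \<omega>)"

lemma euler_noise_measurable [measurable]: "t > 0 \<Longrightarrow> euler_noise t n i \<in> borel_measurable M"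
  unfolding euler_noise_def[abs_def]
  by (intro matrix_vector_measurable borel_measurable_scaleR rX_measurable dWg_measurable)

lemma path_bounded:
  assumes f: "continuous_on UNIV (f :: real^'d \<Rightarrow> 'z::real_normed_vector)" and w: "\<omega> \<in> space M"
  obtains K where "K > 0" "\<And>s. s \<in> {0..t} \<Longrightarrow> norm (f (X s \<omega>)) \<le> K"
proof -
  have "compact ((\<lambda>s. f (X s \<omega>)) ` {0..t})"
    by (rule compact_continuous_image[OF fX_cont'[OF f w]]) auto
  then have "bounded ((\<lambda>s. f (X s \<omega>)) ` {0..t})" by (rule compact_imp_bounded)
  then show thesis using that unfolding bounded_pos by blast
qed

text \<open>Off the unlikely event \<open>BK K\<close> the function \<open>r\<close> is bounded by
  \<open>K\<close> along the grid, and the resulting bound on the sum has an expectation independent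
  of \<open>n\<close>. Tightness is what can be expected here: these squares carry the quadratic
  variation and do not vanish, but they will be multiplied by an arbitrarily small factor.\<close>

lemma euler_noise_squares_tight:
  assumes t: "t > 0" and e: "e > 0"
  shows "\<exists>\<eta>>0. \<forall>n. dP (\<lambda>\<omega>. \<eta> * (\<Sum>i<2^n. (norm (euler_noise t n i \<omega>))\<^sup>2)) \<le> e"
proof -
  note [measurable] = euler_noise_measurable[OF t] dWg_measurable[OF t] rX_measurable[OF t]
  obtain CS where CS: "CS \<ge> 0" "\<And>x. norm (S *v x) \<le> CS * norm x" using matrix_vector_norm_bound by blast
  define dd where "dd = real CARD('d)"
  define BK where "BK K = {\<omega>\<in>space M. \<exists>n. \<exists>i\<in>{0..<2^n}. real K < \<bar>rX t n i \<omega>\<bar>}" for K :: nat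
  have BKm[measurable]: "BK K \<in> events" for K unfolding BK_def by measurable
  have "(\<lambda>K. prob (BK K)) \<longlonglongrightarrow> 0"
  proof (rule prob_tendsto_0_pathwise[OF BKm])
    fix \<omega> assume w: "\<omega> \<in> space M"
    obtain K where K: "K > 0" "\<And>s. s \<in> {0..t} \<Longrightarrow> norm (r (X s \<omega>)) \<le> K" using path_bounded[OF r_cont w] by blast
    have "\<omega> \<notin> BK k" if "real k \<ge> K" for k
    proof
      assume "\<omega> \<in> BK k"
      then obtain n i where i: "i < 2^n" "real k < \<bar>rX t n i \<omega>\<bar>" unfolding BK_def by auto
      have "gp t n i \<in> {0..t}" using t i by (auto intro: gp_nonneg gp_le)
      from K(2)[OF this] i(2) that show False unfolding rX_def by simp
    qed
    moreover obtain k0 where "K \<le> real k0" using real_arch_simple by blast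
    ultimately show "eventually (\<lambda>K. \<omega> \<notin> BK K) sequentially"
      unfolding eventually_sequentially by (intro exI[of _ k0]) (meson of_nat_mono order_trans)
  qed
  then have "eventually (\<lambda>K. prob (BK K) < e / 2) sequentially" using e by (intro order_tendstoD(2)) auto
  then obtain K where K: "prob (BK K) < e / 2" by (auto simp: eventually_sequentially)
  define c0 where "c0 = CS\<^sup>2 * (real K)\<^sup>2 * (dd * t)"
  have c0: "c0 \<ge> 0" using t by (simp add: c0_def dd_def)
  define \<eta> where "\<eta> = e / (2 * (c0 + 1))"
  have \<eta>: "\<eta> > 0" using e c0 by (simp add: \<eta>_def)
  have c\<eta>: "\<eta> * c0 \<le> e / 2" using e c0 unfolding \<eta>_def by (simp add: field_simps)
  have "dP (\<lambda>\<omega>. \<eta> * (\<Sum>i<2^n. (norm (euler_noise t n i \<omega>))\<^sup>2)) \<le> e" for n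
  proof -
    define Z where "Z \<omega> = \<eta> * (CS\<^sup>2 * (real K)\<^sup>2 * (\<Sum>i<2^n. \<Sum>k\<in>UNIV. (dWg t n i \<omega> $ k)\<^sup>2))" for \<omega>
    note m2 = dWg_component_second_moment[OF t]
    have Zm[measurable]: "Z \<in> borel_measurable M" unfolding Z_def[abs_def] by measurable
    have Zi: "integrable M Z" unfolding Z_def[abs_def] using m2 by auto
    have Z0: "Z \<omega> \<ge> 0" for \<omega> unfolding Z_def using \<eta> by (intro mult_nonneg_nonneg sum_nonneg) auto
    have "expectation Z = \<eta> * (CS\<^sup>2 * (real K)\<^sup>2 * (\<Sum>i<2^n. \<Sum>k\<in>UNIV. expectation (\<lambda>\<omega>. (dWg t n i \<omega> $ k)\<^sup>2)))"
      unfolding Z_def[abs_def] using m2 by simp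
    also have "\<dots> \<le> \<eta> * (CS\<^sup>2 * (real K)\<^sup>2 * (\<Sum>i<(2::nat)^n. \<Sum>k\<in>(UNIV::'d set). t / 2^n))"
      using \<eta> by (intro mult_left_mono sum_mono m2) auto
    also have "\<dots> = \<eta> * c0" by (simp add: c0_def dd_def)
    finally have ZE: "expectation Z \<le> e / 2" using c\<eta> by linarith
    have "dP (\<lambda>\<omega>. \<eta> * (\<Sum>i<2^n. (norm (euler_noise t n i \<omega>))\<^sup>2)) \<le> prob (BK K) + dP Z"
    proof (rule dP_event)
      fix \<omega> assume w: "\<omega> \<in> space M" "\<omega> \<notin> BK K"
      have "(\<Sum>i<2^n. (norm (euler_noise t n i \<omega>))\<^sup>2) \<le> (\<Sum>i<2^n. CS\<^sup>2 * (real K)\<^sup>2 * (\<Sum>k\<in>UNIV. (dWg t n i \<omega> $ k)\<^sup>2))"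
      proof (rule sum_mono)
        fix i assume i: "i \<in> {..<(2::nat)^n}"
        have rK: "\<bar>rX t n i \<omega>\<bar> \<le> real K" using w i unfolding BK_def by (force simp: not_less)
        have "norm (euler_noise t n i \<omega>) \<le> CS * (\<bar>rX t n i \<omega>\<bar> * norm (dWg t n i \<omega>))"
          unfolding euler_noise_def using CS(2)[of "rX t n i \<omega> *\<^sub>R dWg t n i \<omega>"] by simp
        also have "\<dots> \<le> CS * (real K * norm (dWg t n i \<omega>))"
          using CS(1) rK by (intro mult_left_mono mult_right_mono) auto
        finally have "(norm (euler_noise t n i \<omega>))\<^sup>2 \<le> (CS * (real K * norm (dWg t n i \<omega>)))\<^sup>2" by (intro power_mono) auto
        then show "(norm (euler_noise t n i \<omega>))\<^sup>2 \<le> CS\<^sup>2 * (real K)\<^sup>2 * (\<Sum>k\<in>UNIV. (dWg t n i \<omega> $ k)\<^sup>2)"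
          by (simp add: power_mult_distrib norm_power2_components[symmetric] mult.assoc)
      qed
      then have "\<eta> * (\<Sum>i<2^n. (norm (euler_noise t n i \<omega>))\<^sup>2) \<le> Z \<omega>"
        unfolding Z_def sum_distrib_left[symmetric] using \<eta> by (intro mult_left_mono) auto
      moreover have "0 \<le> \<eta> * (\<Sum>i<2^n. (norm (euler_noise t n i \<omega>))\<^sup>2)"
        using \<eta> by (intro mult_nonneg_nonneg sum_nonneg) auto
      ultimately show "\<bar>\<eta> * (\<Sum>i<2^n. (norm (euler_noise t n i \<omega>))\<^sup>2)\<bar> \<le> \<bar>Z \<omega>\<bar>" by linarith
    qed measurable
    moreover have "dP Z \<le> expectation Z" by (rule dP_le_expectation) (use Zi Z0 in auto)
    ultimately show ?thesis using K ZE by linarith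
  qed
  then show ?thesis using \<eta> by blast
qed

end

text \<open>Maclaurin's formula for the restriction of \<open>\<Phi>\<close> to a segment, so
  derivatives are required along lines only. \<open>e\<close> bounds the oscillation of the second
  derivatives on the segment, and each pair of indices contributes at most
  \<open>e * (norm u)\<^sup>2\<close>.\<close>

lemma second_order_taylor:
  fixes \<Phi> :: "real^'d \<Rightarrow> real"
  assumes d1: "\<And>s. ((\<lambda>s. \<Phi> (x + s *\<^sub>R u)) has_real_derivative g (x + s *\<^sub>R u) \<bullet> u) (at s)"
    and d2: "\<And>s. ((\<lambda>s. g (x + s *\<^sub>R u) \<bullet> u) has_real_derivative
        (\<Sum>k\<in>UNIV. \<Sum>l\<in>UNIV. D k l (x + s *\<^sub>R u) * u $ k * u $ l)) (at s)"
    and e: "\<And>k l s. 0 < s \<Longrightarrow> s < 1 \<Longrightarrow> \<bar>D k l (x + s *\<^sub>R u) - D k l x\<bar> \<le> e"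
  shows "\<bar>\<Phi> (x + u) - \<Phi> x - g x \<bullet> u - (\<Sum>k\<in>UNIV. \<Sum>l\<in>UNIV. D k l x * u $ k * u $ l) / 2\<bar>
    \<le> (real CARD('d))\<^sup>2 * e * (norm u)\<^sup>2"
proof -
  define q where "q s = (\<Sum>k\<in>UNIV. \<Sum>l\<in>UNIV. D k l (x + s *\<^sub>R u) * u $ k * u $ l)" for s
  define diff where "diff m = (if m = (0::nat) then (\<lambda>s. \<Phi> (x + s *\<^sub>R u)) else if m = 1 then (\<lambda>s. g (x + s *\<^sub>R u) \<bullet> u) else q)" for m
  have "\<exists>s>0. s < 1 \<and> \<Phi> (x + 1 *\<^sub>R u) = (\<Sum>m<2. diff m 0 / fact m * 1 ^ m) + diff 2 s / fact 2 * 1 ^ 2"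
  proof (rule Maclaurin)
    show "\<forall>m s. m < 2 \<and> 0 \<le> s \<and> s \<le> 1 \<longrightarrow> (diff m has_real_derivative diff (Suc m) s) (at s)"
      using d1 d2 by (auto simp: diff_def q_def less_2_cases_iff)
  qed (auto simp: diff_def)
  then obtain s where s: "0 < s" "s < 1" "\<Phi> (x + u) = \<Phi> x + g x \<bullet> u + q s / 2"
    by (auto simp: diff_def numeral_2_eq_2)
  have "\<bar>q s - q 0\<bar> = \<bar>\<Sum>k\<in>UNIV. \<Sum>l\<in>UNIV. (D k l (x + s *\<^sub>R u) - D k l x) * (u $ k * u $ l)\<bar>"
    unfolding q_def by (simp add: sum_subtractf[symmetric] algebra_simps)
  also have "\<dots> \<le> (\<Sum>k\<in>(UNIV::'d set). \<Sum>l\<in>(UNIV::'d set). e * (norm u)\<^sup>2)"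
  proof (intro order_trans[OF sum_abs] sum_mono)
    fix k l
    have "\<bar>u $ k * u $ l\<bar> \<le> norm u * norm u" unfolding abs_mult by (intro mult_mono component_le_norm_cart) auto
    then show "\<bar>(D k l (x + s *\<^sub>R u) - D k l x) * (u $ k * u $ l)\<bar> \<le> e * (norm u)\<^sup>2"
      unfolding abs_mult[of "_ - _"] power2_eq_square using e[OF s(1,2), of k l] by (intro mult_mono) auto
  qed
  also have "\<dots> = (real CARD('d))\<^sup>2 * e * (norm u)\<^sup>2" by (simp add: power2_eq_square)
  finally have "\<bar>q s - q 0\<bar> \<le> (real CARD('d))\<^sup>2 * e * (norm u)\<^sup>2" .
  moreover have "0 \<le> \<bar>q s - q 0\<bar>" by simp
  moreover have "\<Phi> (x + u) - \<Phi> x - g x \<bullet> u - q 0 / 2 = (q s - q 0) / 2" using s(3) by (simp add: diff_divide_distrib)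
  ultimately have "\<bar>\<Phi> (x + u) - \<Phi> x - g x \<bullet> u - q 0 / 2\<bar> \<le> (real CARD('d))\<^sup>2 * e * (norm u)\<^sup>2" by simp
  then show ?thesis by (simp add: q_def)
qed

section \<open>Dynkin's formula\<close>

text \<open>The bound on the product of \<open>r\<close> and \<open>g\<close> gives the martingale
  part bounded coefficients although \<open>r\<close> itself may be unbounded; the bound on
  \<open>L\<close> plays the same part for the generator. \<open>D\<close> matters only through its
  quadratic form and its contraction with \<open>S ** transpose S\<close>.\<close>

locale sde_test_function = scalar_noise_sde M F W X G r S x0
  for M :: "'a measure" and F :: "real \<Rightarrow> 'a measure" and W X :: "real \<Rightarrow> 'a \<Rightarrow> real^'d"
    and G :: "real^'d \<Rightarrow> real^'d" and r :: "real^'d \<Rightarrow> real" and S :: "real^'d^'d" and x0 :: "real^'d" +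
  fixes \<Phi> :: "real^'d \<Rightarrow> real" and g :: "real^'d \<Rightarrow> real^'d" and D :: "'d \<Rightarrow> 'd \<Rightarrow> real^'d \<Rightarrow> real" and C :: real
    and L :: "real^'d \<Rightarrow> real"
  assumes d1: "\<And>x u s. ((\<lambda>s. \<Phi> (x + s *\<^sub>R u)) has_real_derivative g (x + s *\<^sub>R u) \<bullet> u) (at s)"
    and d2: "\<And>x u s. ((\<lambda>s. g (x + s *\<^sub>R u) \<bullet> u) has_real_derivative
        (\<Sum>k\<in>UNIV. \<Sum>l\<in>UNIV. D k l (x + s *\<^sub>R u) * u $ k * u $ l)) (at s)"
    and \<Phi>_cont: "continuous_on UNIV \<Phi>" and g_cont: "continuous_on UNIV g"
    and D_cont: "\<And>k l. continuous_on UNIV (D k l)"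
    and L_def: "\<And>x. L x = G x \<bullet> g x + (r x)\<^sup>2 / 2 * (\<Sum>k\<in>UNIV. \<Sum>l\<in>UNIV. D k l x * (S ** transpose S) $ k $ l)"
    and \<Phi>_bound: "\<And>x. \<bar>\<Phi> x\<bar> \<le> C" and g_bound: "\<And>x. norm (g x) \<le> C" and D_bound: "\<And>k l x. \<bar>D k l x\<bar> \<le> C"
    and rg_bound: "\<And>x. \<bar>r x\<bar> * norm (g x) \<le> C" and L_bound: "\<And>x. \<bar>L x\<bar> \<le> C"
begin

lemma C_nonneg: "C \<ge> 0"
  using \<Phi>_bound[of 0] by linarith

lemma L_cont: "continuous_on UNIV L"
  unfolding L_def[abs_def] by (intro continuous_intros G_cont g_cont r_cont D_cont) auto

definition qf :: "real^'d \<Rightarrow> real^'d \<Rightarrow> real" where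
  "qf x u = (\<Sum>k\<in>UNIV. \<Sum>l\<in>UNIV. D k l x * u $ k * u $ l)"

definition dX :: "real \<Rightarrow> nat \<Rightarrow> nat \<Rightarrow> 'a \<Rightarrow> real^'d" where
  "dX t n i \<omega> = X (gp t n (Suc i)) \<omega> - X (gp t n i) \<omega>"

definition drift :: "real \<Rightarrow> nat \<Rightarrow> nat \<Rightarrow> 'a \<Rightarrow> real^'d" where
  "drift t n i \<omega> = integral {0..gp t n (Suc i)} (\<lambda>s. G (X s \<omega>)) - integral {0..gp t n i} (\<lambda>s. G (X s \<omega>))"

text \<open>The part of an increment whose squares sum to zero in the limit, in contrast to
  \<open>euler_noise\<close>, which carries the quadratic variation.\<close>

definition resid :: "real \<Rightarrow> nat \<Rightarrow> nat \<Rightarrow> 'a \<Rightarrow> real^'d" where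
  "resid t n i \<omega> = drift t n i \<omega> + mart_err t n i \<omega>"

definition taylor_rem :: "real \<Rightarrow> nat \<Rightarrow> nat \<Rightarrow> 'a \<Rightarrow> real" where
  "taylor_rem t n i \<omega> = \<Phi> (X (gp t n (Suc i)) \<omega>) - \<Phi> (X (gp t n i) \<omega>) - g (X (gp t n i) \<omega>) \<bullet> dX t n i \<omega>
     - qf (X (gp t n i) \<omega>) (dX t n i \<omega>) / 2"

lemma dX_split: "dX t n i \<omega> = euler_noise t n i \<omega> + resid t n i \<omega>"
  by (simp add: dX_def resid_def drift_def mart_err_def euler_noise_def noise_def)

lemma grid_measurable:
  "continuous_on UNIV f \<Longrightarrow> t > 0 \<Longrightarrow> (\<lambda>\<omega>. f (X (gp t n i) \<omega>)) \<in> borel_measurable M"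
  by (intro fX_measurable gp_nonneg) auto

lemma X_grid_measurable: "t > 0 \<Longrightarrow> X (gp t n i) \<in> borel_measurable M"
  by (intro X_measurable gp_nonneg) auto

lemma drift_measurable [measurable]: "t > 0 \<Longrightarrow> drift t n i \<in> borel_measurable M"
  unfolding drift_def[abs_def] by (intro borel_measurable_diff integral_fX_measurable G_cont gp_nonneg) auto

lemma resid_measurable [measurable]: "t > 0 \<Longrightarrow> resid t n i \<in> borel_measurable M"
  unfolding resid_def[abs_def] by measurable

lemma dX_measurable [measurable]: "t > 0 \<Longrightarrow> dX t n i \<in> borel_measurable M"
  unfolding dX_def[abs_def] by (intro borel_measurable_diff X_grid_measurable)

lemma qf_measurable:
  assumes "t > 0" and [measurable]: "Y \<in> borel_measurable M"
  shows "(\<lambda>\<omega>. qf (X (gp t n i) \<omega>) (Y \<omega>)) \<in> borel_measurable M"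
proof -
  have [measurable]: "(\<lambda>\<omega>. D k l (X (gp t n i) \<omega>)) \<in> borel_measurable M" for k l
    using assms by (intro grid_measurable D_cont) auto
  show ?thesis unfolding qf_def by measurable
qed

lemma taylor_rem_measurable [measurable]: "t > 0 \<Longrightarrow> taylor_rem t n i \<in> borel_measurable M"
  unfolding taylor_rem_def[abs_def]
  by (intro borel_measurable_diff borel_measurable_divide borel_measurable_inner qf_measurable grid_measurable
      \<Phi>_cont g_cont dX_measurable borel_measurable_const) auto

lemma grid_cell:
  assumes "t > 0" "i < 2 ^ n" "s \<in> {gp t n i..gp t n (Suc i)}"
  shows "s \<in> {0..t}" "gp t n i \<in> {0..t}" "gp t n (Suc i) \<in> {0..t}" "\<bar>s - gp t n i\<bar> \<le> t / 2 ^ n"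
  using gp_nonneg[of t n i] gp_le[of t "Suc i" n] assms gp_mono[of t i "Suc i" n] gp_simps(4)[of t n i]
  by auto

lemma drift_integral:
  assumes "t > 0" "\<omega> \<in> space M"
  shows "drift t n i \<omega> = integral {gp t n i..gp t n (Suc i)} (\<lambda>s. G (X s \<omega>))"
proof -
  have "integral {0..gp t n i} (\<lambda>s. G (X s \<omega>)) + integral {gp t n i..gp t n (Suc i)} (\<lambda>s. G (X s \<omega>)) =
      integral {0..gp t n (Suc i)} (\<lambda>s. G (X s \<omega>))"
    using assms gp_nonneg[of t n i] gp_mono[of t i "Suc i" n]
    by (intro Henstock_Kurzweil_Integration.integral_combine integrable_continuous_real fX_cont' G_cont) auto
  then show ?thesis by (simp add: drift_def algebra_simps)
qed

lemma drift_euler_tendsto_0: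
  assumes t: "t > 0"
  shows "(\<lambda>n. dP (\<lambda>\<omega>. \<Sum>i<2^n. g (X (gp t n i) \<omega>) \<bullet> (drift t n i \<omega> - (t / 2^n) *\<^sub>R G (X (gp t n i) \<omega>)))) \<longlonglongrightarrow> 0"
proof (rule dP_tendsto_pathwise)
  show "(\<lambda>\<omega>. \<Sum>i<2^n. g (X (gp t n i) \<omega>) \<bullet> (drift t n i \<omega> - (t / 2^n) *\<^sub>R G (X (gp t n i) \<omega>))) \<in> borel_measurable M" for n
    using t by (intro borel_measurable_sum borel_measurable_inner borel_measurable_diff drift_measurable
        borel_measurable_scaleR borel_measurable_const grid_measurable g_cont G_cont)
next
  fix \<omega> assume w: "\<omega> \<in> space M"
  show "(\<lambda>n. \<Sum>i<2^n. g (X (gp t n i) \<omega>) \<bullet> (drift t n i \<omega> - (t / 2^n) *\<^sub>R G (X (gp t n i) \<omega>))) \<longlonglongrightarrow> 0"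
  proof (rule LIMSEQ_I)
    fix e :: real assume e: "e > 0"
    define C1 where "C1 = C + 1"
    have C1: "C1 > 0" "C \<le> C1" using C_nonneg by (auto simp: C1_def)
    define e' where "e' = e / (2 * C1 * t)"
    have e': "e' > 0" using e t C1 by (simp add: e'_def)
    from uniform_grid_modulus[OF fX_cont'[OF G_cont w order_refl] e' t, of 1]
    obtain n0 where n0: "\<And>n s s'. n \<ge> n0 \<Longrightarrow> s \<in> {0..t} \<Longrightarrow> s' \<in> {0..t} \<Longrightarrow> \<bar>s - s'\<bar> \<le> 1 * t / 2 ^ n \<Longrightarrow>
      dist (G (X s \<omega>)) (G (X s' \<omega>)) < e'" by blast
    show "\<exists>n0. \<forall>n\<ge>n0. norm ((\<Sum>i<2^n. g (X (gp t n i) \<omega>) \<bullet> (drift t n i \<omega> - (t / 2^n) *\<^sub>R G (X (gp t n i) \<omega>))) - 0) < e"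
    proof (intro exI[of _ n0] allI impI)
      fix n assume n: "n \<ge> n0"
      have "\<bar>\<Sum>i<2^n. g (X (gp t n i) \<omega>) \<bullet> (drift t n i \<omega> - (t / 2^n) *\<^sub>R G (X (gp t n i) \<omega>))\<bar> \<le> (\<Sum>i<(2::nat)^n. C * (t / 2^n * e'))"
      proof (rule order_trans[OF sum_abs sum_mono])
        fix i assume i: "i \<in> {..<(2::nat)^n}"
        have "norm (integral {gp t n i..gp t n (Suc i)} (\<lambda>s. G (X s \<omega>)) - (gp t n (Suc i) - gp t n i) *\<^sub>R G (X (gp t n i) \<omega>))
            \<le> (gp t n (Suc i) - gp t n i) * e'"
        proof (rule integral_left_point_error)
          show "continuous_on {gp t n i..gp t n (Suc i)} (\<lambda>s. G (X s \<omega>))"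
            using t by (intro fX_cont' G_cont w gp_nonneg) auto
          fix s assume "s \<in> {gp t n i..gp t n (Suc i)}"
          from grid_cell[OF t _ this] i have "dist (G (X s \<omega>)) (G (X (gp t n i) \<omega>)) < e'" by (intro n0[OF n]) auto
          then show "norm (G (X s \<omega>) - G (X (gp t n i) \<omega>)) \<le> e'" by (simp add: dist_norm)
        qed (use t in \<open>auto intro!: gp_mono\<close>)
        then have b: "norm (drift t n i \<omega> - (t / 2^n) *\<^sub>R G (X (gp t n i) \<omega>)) \<le> t / 2^n * e'"
          unfolding drift_integral[OF t w] by (simp add: gp_simps)
        have "\<bar>g (X (gp t n i) \<omega>) \<bullet> (drift t n i \<omega> - (t / 2^n) *\<^sub>R G (X (gp t n i) \<omega>))\<bar> \<le>
            norm (g (X (gp t n i) \<omega>)) * norm (drift t n i \<omega> - (t / 2^n) *\<^sub>R G (X (gp t n i) \<omega>))"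
          by (rule Cauchy_Schwarz_ineq2)
        also have "\<dots> \<le> C * (t / 2^n * e')" using b g_bound C_nonneg by (intro mult_mono) auto
        finally show "\<bar>g (X (gp t n i) \<omega>) \<bullet> (drift t n i \<omega> - (t / 2^n) *\<^sub>R G (X (gp t n i) \<omega>))\<bar> \<le> C * (t / 2^n * e')" .
      qed
      also have "\<dots> = C * (t * e')" by simp
      also have "\<dots> \<le> C1 * (t * e')" using t e' C1 by (intro mult_right_mono) auto
      also have "\<dots> = e / 2" using t C1 by (simp add: e'_def)
      finally show "norm ((\<Sum>i<2^n. g (X (gp t n i) \<omega>) \<bullet> (drift t n i \<omega> - (t / 2^n) *\<^sub>R G (X (gp t n i) \<omega>))) - 0) < e"
        using e by simp
    qed
  qed
qed

text \<open>The \<open>2^n\<close> squared drifts are of order \<open>(t / 2^n)\<^sup>2\<close> each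
  along a fixed path, so they vanish pathwise; the squared martingale errors vanish by
  \<open>mart_err_squares_tendsto_0\<close>.\<close>

lemma resid_squares_tendsto_0:
  assumes t: "t > 0"
  shows "(\<lambda>n. dP (\<lambda>\<omega>. \<Sum>i<2^n. (norm (resid t n i \<omega>))\<^sup>2)) \<longlonglongrightarrow> 0"
proof -
  note [measurable] = drift_measurable[OF t] resid_measurable[OF t] mart_err_measurable[OF t]
  define A where "A n \<omega> = (\<Sum>i<2^n. (norm (drift t n i \<omega>))\<^sup>2)" for n \<omega>
  define B where "B n \<omega> = (\<Sum>i<2^n. (norm (mart_err t n i \<omega>))\<^sup>2)" for n \<omega>
  have [measurable]: "A n \<in> borel_measurable M" "B n \<in> borel_measurable M" for n
    unfolding A_def[abs_def] B_def[abs_def] by measurable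
  have A: "(\<lambda>n. dP (A n)) \<longlonglongrightarrow> 0"
  proof (rule dP_tendsto_pathwise)
    fix \<omega> assume w: "\<omega> \<in> space M"
    obtain K where K: "K > 0" "\<And>s. s \<in> {0..t} \<Longrightarrow> norm (G (X s \<omega>)) \<le> K" using path_bounded[OF G_cont w] by blast
    have "A n \<omega> \<le> t\<^sup>2 * K\<^sup>2 * (1 / 2) ^ n" for n
    proof -
      have "A n \<omega> \<le> (\<Sum>i<(2::nat)^n. (K * (t / 2^n))\<^sup>2)"
        unfolding A_def
      proof (intro sum_mono power_mono norm_ge_zero)
        fix i assume i: "i \<in> {..<(2::nat)^n}"
        have "norm (integral {gp t n i..gp t n (Suc i)} (\<lambda>s. G (X s \<omega>))) \<le> K * (gp t n (Suc i) - gp t n i)"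
          using grid_cell[OF t, of i n] i t
          by (intro integral_bound fX_cont' G_cont w gp_nonneg K gp_mono) auto
        then show "norm (drift t n i \<omega>) \<le> K * (t / 2^n)" unfolding drift_integral[OF t w] by (simp add: gp_simps)
      qed
      also have "\<dots> = t\<^sup>2 * K\<^sup>2 * (1 / 2) ^ n" by (simp add: power2_eq_square power_divide field_simps)
      finally show ?thesis .
    qed
    moreover have "0 \<le> A n \<omega>" for n unfolding A_def by (intro sum_nonneg) auto
    moreover have lim: "(\<lambda>n. t\<^sup>2 * K\<^sup>2 * (1 / 2) ^ n) \<longlonglongrightarrow> 0"
      by (intro tendsto_mult_right_zero LIMSEQ_realpow_zero) auto
    ultimately show "(\<lambda>n. A n \<omega>) \<longlonglongrightarrow> 0"
      by (intro tendsto_sandwich[OF always_eventually always_eventually tendsto_const lim]) auto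
  qed measurable
  have B: "(\<lambda>n. dP (B n)) \<longlonglongrightarrow> 0" unfolding B_def[abs_def] by (rule mart_err_squares_tendsto_0[OF t])
  have le: "dP (\<lambda>\<omega>. \<Sum>i<2^n. (norm (resid t n i \<omega>))\<^sup>2) \<le> 2 * dP (A n) + 2 * dP (B n)" for n
  proof -
    have "dP (\<lambda>\<omega>. \<Sum>i<2^n. (norm (resid t n i \<omega>))\<^sup>2) \<le> dP (\<lambda>\<omega>. 2 * A n \<omega>) + dP (\<lambda>\<omega>. 2 * B n \<omega>)"
    proof (rule dP_triangle)
      fix \<omega>
      have "(norm (resid t n i \<omega>))\<^sup>2 \<le> 2 * (norm (drift t n i \<omega>))\<^sup>2 + 2 * (norm (mart_err t n i \<omega>))\<^sup>2" for i
      proof -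
        have "(norm (resid t n i \<omega>))\<^sup>2 \<le> (norm (drift t n i \<omega>) + norm (mart_err t n i \<omega>))\<^sup>2"
          unfolding resid_def by (intro power_mono norm_triangle_ineq) auto
        then show ?thesis using sum_squares_bound[of "norm (drift t n i \<omega>)" "norm (mart_err t n i \<omega>)"] by (simp add: power2_sum)
      qed
      then have "(\<Sum>i<2^n. (norm (resid t n i \<omega>))\<^sup>2) \<le> (\<Sum>i<2^n. 2 * (norm (drift t n i \<omega>))\<^sup>2 + 2 * (norm (mart_err t n i \<omega>))\<^sup>2)"
        by (intro sum_mono)
      also have "\<dots> = 2 * A n \<omega> + 2 * B n \<omega>" unfolding A_def B_def by (simp add: sum.distrib sum_distrib_left)
      finally show "\<bar>\<Sum>i<2^n. (norm (resid t n i \<omega>))\<^sup>2\<bar> \<le> \<bar>2 * A n \<omega>\<bar> + \<bar>2 * B n \<omega>\<bar>"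
        using sum_nonneg[of "{..<2^n}" "\<lambda>i. (norm (resid t n i \<omega>))\<^sup>2"] by auto
    qed measurable
    then show ?thesis using dP_scale[of "A n" 2] dP_scale[of "B n" 2] by simp
  qed
  have lim: "(\<lambda>n. 2 * dP (A n) + 2 * dP (B n)) \<longlonglongrightarrow> 0"
    using tendsto_add[OF tendsto_mult[OF tendsto_const[of 2] A] tendsto_mult[OF tendsto_const[of 2] B]] by simp
  show ?thesis
    by (rule tendsto_sandwich[OF always_eventually always_eventually tendsto_const lim]) (use le dP_nonneg in auto)
qed

text \<open>The squares of \<open>euler_noise\<close> are tight and those of \<open>resid\<close>
  vanish, so it suffices to dominate \<open>Y n\<close> with an arbitrarily small weight on the
  former and any weight on the latter. \<open>c\<close> and the exceptional events may depend on
  \<open>\<eta>\<close>, because tightness fixes \<open>\<eta>\<close> before \<open>n\<close> tends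
  to infinity.\<close>

lemma dP_tendsto_0_by_squares:
  assumes t: "t > 0" and Y: "\<And>n. Y n \<in> borel_measurable M"
    and b: "\<And>\<eta>. \<eta> > 0 \<Longrightarrow> \<exists>c A. (\<forall>n. A n \<in> events) \<and> (\<lambda>n. prob (A n)) \<longlonglongrightarrow> 0 \<and>
      (\<forall>n. \<forall>\<omega>\<in>space M. \<omega> \<notin> A n \<longrightarrow> \<bar>Y n \<omega>\<bar> \<le> \<eta> * (\<Sum>i<2^n. (norm (euler_noise t n i \<omega>))\<^sup>2) + c * (\<Sum>i<2^n. (norm (resid t n i \<omega>))\<^sup>2))"
  shows "(\<lambda>n. dP (Y n)) \<longlonglongrightarrow> 0"
proof (rule LIMSEQ_I)
  fix e :: real assume e: "e > 0"
  note [measurable] = resid_measurable[OF t] euler_noise_measurable[OF t] Y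
  define a2 where "a2 n \<omega> = (\<Sum>i<2^n. (norm (euler_noise t n i \<omega>))\<^sup>2)" for n \<omega>
  define e2 where "e2 n \<omega> = (\<Sum>i<2^n. (norm (resid t n i \<omega>))\<^sup>2)" for n \<omega>
  have [measurable]: "a2 n \<in> borel_measurable M" "e2 n \<in> borel_measurable M" for n
    unfolding a2_def[abs_def] e2_def[abs_def] by measurable
  obtain \<eta> where \<eta>: "\<eta> > 0" "\<And>n. dP (\<lambda>\<omega>. \<eta> * a2 n \<omega>) \<le> e / 4"
    using euler_noise_squares_tight[OF t, of "e / 4"] e unfolding a2_def by auto
  obtain c A where A[measurable]: "\<And>n. A n \<in> events" and A0: "(\<lambda>n. prob (A n)) \<longlonglongrightarrow> 0"
    and le: "\<And>n \<omega>. \<omega> \<in> space M \<Longrightarrow> \<omega> \<notin> A n \<Longrightarrow> \<bar>Y n \<omega>\<bar> \<le> \<eta> * a2 n \<omega> + c * e2 n \<omega>"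
    using b[OF \<eta>(1)] unfolding a2_def e2_def by blast
  have bnd: "dP (Y n) \<le> prob (A n) + (e / 4 + max 1 \<bar>c\<bar> * dP (e2 n))" for n
  proof -
    have "dP (Y n) \<le> prob (A n) + dP (\<lambda>\<omega>. \<eta> * a2 n \<omega> + c * e2 n \<omega>)"
      by (rule dP_event) (use le in \<open>auto intro: order_trans[OF _ abs_ge_self]\<close>)
    also have "dP (\<lambda>\<omega>. \<eta> * a2 n \<omega> + c * e2 n \<omega>) \<le> dP (\<lambda>\<omega>. \<eta> * a2 n \<omega>) + dP (\<lambda>\<omega>. c * e2 n \<omega>)"
      by (rule dP_triangle) (auto intro: abs_triangle_ineq)
    finally show ?thesis using \<eta>(2)[of n] dP_scale[of "e2 n" c] by simp
  qed
  have "(\<lambda>n. max 1 \<bar>c\<bar> * dP (e2 n)) \<longlonglongrightarrow> max 1 \<bar>c\<bar> * 0"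
    unfolding e2_def[abs_def] by (intro tendsto_mult tendsto_const resid_squares_tendsto_0[OF t])
  from tendsto_add[OF A0 this] have "eventually (\<lambda>n. prob (A n) + max 1 \<bar>c\<bar> * dP (e2 n) < e / 2) sequentially"
    using e by (intro order_tendstoD(2)) auto
  then obtain n0 where n0: "\<And>n. n \<ge> n0 \<Longrightarrow> prob (A n) + max 1 \<bar>c\<bar> * dP (e2 n) < e / 2" by (auto simp: eventually_sequentially)
  show "\<exists>n0. \<forall>n\<ge>n0. norm (dP (Y n) - 0) < e"
  proof (intro exI[of _ n0] allI impI)
    fix n assume "n \<ge> n0"
    from n0[OF this] bnd[of n] e dP_nonneg[of "Y n"] show "norm (dP (Y n) - 0) < e" by simp
  qed
qed

lemma qf_perturb:
  "\<bar>qf x (a + u) - qf x a\<bar> \<le> (real CARD('d))\<^sup>2 * C * (2 * norm a * norm u + (norm u)\<^sup>2)"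
proof -
  have "\<bar>qf x (a + u) - qf x a\<bar> = \<bar>\<Sum>k\<in>UNIV. \<Sum>l\<in>UNIV. D k l x * (a $ k * u $ l + u $ k * a $ l + u $ k * u $ l)\<bar>"
    unfolding qf_def by (simp add: sum_subtractf[symmetric] algebra_simps)
  also have "\<dots> \<le> (\<Sum>k\<in>(UNIV::'d set). \<Sum>l\<in>(UNIV::'d set). C * (2 * norm a * norm u + (norm u)\<^sup>2))"
  proof (intro order_trans[OF sum_abs] sum_mono)
    fix k l
    have p: "\<bar>p $ k * q $ l\<bar> \<le> norm p * norm q" for p q :: "real^'d"
      unfolding abs_mult by (intro mult_mono component_le_norm_cart) auto
    have "\<bar>a $ k * u $ l + u $ k * a $ l + u $ k * u $ l\<bar> \<le> \<bar>a $ k * u $ l\<bar> + \<bar>u $ k * a $ l\<bar> + \<bar>u $ k * u $ l\<bar>"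
      using abs_triangle_ineq[of "a $ k * u $ l + u $ k * a $ l" "u $ k * u $ l"] abs_triangle_ineq[of "a $ k * u $ l" "u $ k * a $ l"]
      by linarith
    also have "\<dots> \<le> norm a * norm u + norm u * norm a + norm u * norm u" by (intro add_mono p)
    also have "\<dots> = 2 * norm a * norm u + (norm u)\<^sup>2" by (simp add: power2_eq_square)
    finally show "\<bar>D k l x * (a $ k * u $ l + u $ k * a $ l + u $ k * u $ l)\<bar> \<le> C * (2 * norm a * norm u + (norm u)\<^sup>2)"
      unfolding abs_mult[of "D k l x"] using D_bound C_nonneg by (intro mult_mono) auto
  qed
  also have "\<dots> = (real CARD('d))\<^sup>2 * C * (2 * norm a * norm u + (norm u)\<^sup>2)" by (simp add: power2_eq_square)
  finally show ?thesis .
qed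

lemma qf_perturb_tendsto_0:
  assumes t: "t > 0"
  shows "(\<lambda>n. dP (\<lambda>\<omega>. \<Sum>i<2^n. (qf (X (gp t n i) \<omega>) (dX t n i \<omega>) - qf (X (gp t n i) \<omega>) (euler_noise t n i \<omega>)) / 2)) \<longlonglongrightarrow> 0"
proof (rule dP_tendsto_0_by_squares[OF t])
  show "(\<lambda>\<omega>. \<Sum>i<2^n. (qf (X (gp t n i) \<omega>) (dX t n i \<omega>) - qf (X (gp t n i) \<omega>) (euler_noise t n i \<omega>)) / 2) \<in> borel_measurable M" for n
    using t by (intro borel_measurable_sum borel_measurable_divide borel_measurable_diff qf_measurable
        dX_measurable euler_noise_measurable borel_measurable_const)
next
  fix \<eta> :: real assume \<eta>: "\<eta> > 0"
  define B where "B = (real CARD('d))\<^sup>2 * C"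
  have B: "B \<ge> 0" using C_nonneg by (simp add: B_def)
  define c where "c = B * ((B + 1) / \<eta> + 1)"
  have one: "\<bar>(qf x (a + u) - qf x a) / 2\<bar> \<le> \<eta> * (norm a)\<^sup>2 + c * (norm u)\<^sup>2" for x a u
  proof -
    \<comment> \<open>Young's inequality with weight \<open>\<theta>\<close> splits the mixed term.
      The denominator \<open>B + 1\<close> is positive even for \<open>B = 0\<close> and gives
      \<open>B * \<theta> \<le> \<eta>\<close>.\<close>
    define \<theta> where "\<theta> = \<eta> / (B + 1)"
    have \<theta>: "\<theta> > 0" using \<eta> B by (simp add: \<theta>_def)
    have "0 \<le> (\<theta> * norm a - norm u)\<^sup>2" by simp
    then have "2 * norm a * norm u * \<theta> \<le> \<theta>\<^sup>2 * (norm a)\<^sup>2 + (norm u)\<^sup>2"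
      by (simp add: power2_diff power_mult_distrib mult_ac)
    then have "2 * norm a * norm u \<le> \<theta> * (norm a)\<^sup>2 + (norm u)\<^sup>2 / \<theta>"
      using \<theta> by (simp add: field_simps power2_eq_square)
    then have "B * (2 * norm a * norm u + (norm u)\<^sup>2) \<le> B * (\<theta> * (norm a)\<^sup>2 + (norm u)\<^sup>2 / \<theta> + (norm u)\<^sup>2)"
      using B by (intro mult_left_mono) auto
    also have "\<dots> = B * \<theta> * (norm a)\<^sup>2 + c * (norm u)\<^sup>2"
    proof -
      have "c = B * (1 / \<theta> + 1)" by (simp add: c_def \<theta>_def)
      then show ?thesis by (simp add: algebra_simps)
    qed
    also have "\<dots> \<le> \<eta> * (norm a)\<^sup>2 + c * (norm u)\<^sup>2"
    proof -
      have "B * \<theta> \<le> \<eta>" using \<eta> B by (simp add: \<theta>_def field_simps)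
      then show ?thesis by (intro add_right_mono mult_right_mono) auto
    qed
    finally have "\<bar>qf x (a + u) - qf x a\<bar> \<le> \<eta> * (norm a)\<^sup>2 + c * (norm u)\<^sup>2"
      using qf_perturb[of x a u] unfolding B_def by linarith
    then show ?thesis by simp
  qed
  have "\<bar>\<Sum>i<2^n. (qf (X (gp t n i) \<omega>) (dX t n i \<omega>) - qf (X (gp t n i) \<omega>) (euler_noise t n i \<omega>)) / 2\<bar> \<le>
      \<eta> * (\<Sum>i<2^n. (norm (euler_noise t n i \<omega>))\<^sup>2) + c * (\<Sum>i<2^n. (norm (resid t n i \<omega>))\<^sup>2)" for n \<omega>
    unfolding dX_split sum_distrib_left sum.distrib[symmetric]
    by (rule order_trans[OF sum_abs sum_mono]) (rule one)
  then show "\<exists>c A. (\<forall>n. A n \<in> events) \<and> (\<lambda>n. prob (A n)) \<longlonglongrightarrow> 0 \<and> (\<forall>n. \<forall>\<omega>\<in>space M. \<omega> \<notin> A n \<longrightarrow>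
      \<bar>\<Sum>i<2^n. (qf (X (gp t n i) \<omega>) (dX t n i \<omega>) - qf (X (gp t n i) \<omega>) (euler_noise t n i \<omega>)) / 2\<bar> \<le>
      \<eta> * (\<Sum>i<2^n. (norm (euler_noise t n i \<omega>))\<^sup>2) + c * (\<Sum>i<2^n. (norm (resid t n i \<omega>))\<^sup>2))"
    by (intro exI[of _ c] exI[of _ "\<lambda>_. {}"]) auto
qed

text \<open>Up to time \<open>t\<close> the path stays in a ball. By compactness the second
  derivatives are uniformly continuous there, and by convexity the segments between consecutive grid
  values do not leave it.\<close>

lemma taylor_rem_eventually_small:
  assumes t: "t > 0" and w: "\<omega> \<in> space M" and e: "e > 0"
  shows "eventually (\<lambda>n. \<forall>i\<in>{0..<2^n}. \<bar>taylor_rem t n i \<omega>\<bar> \<le> e * (norm (dX t n i \<omega>))\<^sup>2) sequentially"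
proof -
  define e' where "e' = e / (real CARD('d))\<^sup>2"
  have e': "e' > 0" using e by (simp add: e'_def)
  obtain R where R: "R > 0" "\<And>s. s \<in> {0..t} \<Longrightarrow> norm (X s \<omega>) \<le> R"
    using path_bounded[of "\<lambda>x. x", OF _ w] by (auto simp: continuous_on_id)
  define DD :: "real^'d \<Rightarrow> real^'d^'d" where "DD x = (\<chi> k l. D k l x)" for x
  have "continuous_on (cball 0 R) DD"
    unfolding DD_def[abs_def] by (intro continuous_on_vec_lambda continuous_on_subset[OF D_cont]) auto
  then have "uniformly_continuous_on (cball 0 R) DD" by (intro compact_uniformly_continuous) auto
  then obtain d where d: "d > 0" "\<And>x y. x \<in> cball 0 R \<Longrightarrow> y \<in> cball 0 R \<Longrightarrow> dist y x < d \<Longrightarrow> dist (DD y) (DD x) < e'"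
    using e' unfolding uniformly_continuous_on_def by metis
  have DD: "\<bar>D k l y - D k l x\<bar> \<le> dist (DD y) (DD x)" for k l x y
  proof -
    have "\<bar>(DD y - DD x) $ k $ l\<bar> \<le> norm ((DD y - DD x) $ k)" by (rule component_le_norm_cart)
    also have "\<dots> \<le> norm (DD y - DD x)" by (rule Finite_Cartesian_Product.norm_nth_le)
    finally show ?thesis by (simp add: DD_def dist_norm)
  qed
  from uniform_grid_modulus[OF fX_cont'[OF continuous_on_id w order_refl] d(1) t, of 1]
  obtain n0 where n0: "\<And>n s s'. n \<ge> n0 \<Longrightarrow> s \<in> {0..t} \<Longrightarrow> s' \<in> {0..t} \<Longrightarrow> \<bar>s - s'\<bar> \<le> 1 * t / 2 ^ n \<Longrightarrow>
      dist (X s \<omega>) (X s' \<omega>) < d" by blast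
  show ?thesis unfolding eventually_sequentially
  proof (intro exI[of _ n0] allI impI ballI)
    fix n i assume n: "n \<ge> n0" and i: "i \<in> {0..<(2::nat)^n}"
    define x where "x = X (gp t n i) \<omega>"
    define u where "u = dX t n i \<omega>"
    have y: "X (gp t n (Suc i)) \<omega> = x + u" by (simp add: x_def u_def dX_def)
    have mem: "gp t n (Suc i) \<in> {gp t n i..gp t n (Suc i)}" using t by (auto intro: gp_mono)
    note cell = grid_cell[OF t _ mem]
    have x: "x \<in> cball 0 R" unfolding x_def using cell i R by auto
    have "X (gp t n (Suc i)) \<omega> \<in> cball 0 R" using cell i R by auto
    then have xu: "x + u \<in> cball 0 R" unfolding y .
    have "dist (X (gp t n (Suc i)) \<omega>) (X (gp t n i) \<omega>) < d" using cell i by (intro n0[OF n]) auto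
    then have "dist (x + u) x < d" unfolding y x_def[symmetric] .
    then have nu: "norm u < d" by (simp add: dist_norm)
    have "\<bar>D k l (x + s *\<^sub>R u) - D k l x\<bar> \<le> e'" if s: "0 < s" "s < 1" for k l s
    proof -
      have "x + s *\<^sub>R u = (1 - s) *\<^sub>R x + s *\<^sub>R (x + u)" by (simp add: algebra_simps)
      then have "x + s *\<^sub>R u \<in> cball 0 R" using s x xu convexD[OF convex_cball[of 0 R], of x "x + u" "1 - s" s] by auto
      moreover have "dist (x + s *\<^sub>R u) x \<le> norm u" using s by (simp add: dist_norm mult_left_le_one_le)
      ultimately have "dist (DD (x + s *\<^sub>R u)) (DD x) < e'" using x nu by (intro d(2)) auto
      then show ?thesis using DD[of k l "x + s *\<^sub>R u" x] by linarith
    qed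
    from second_order_taylor[of \<Phi> x u g D, OF d1 d2 this]
    have "\<bar>\<Phi> (x + u) - \<Phi> x - g x \<bullet> u - qf x u / 2\<bar> \<le> (real CARD('d))\<^sup>2 * e' * (norm u)\<^sup>2" unfolding qf_def .
    also have "(real CARD('d))\<^sup>2 * e' = e" by (simp add: e'_def)
    finally show "\<bar>taylor_rem t n i \<omega>\<bar> \<le> e * (norm (dX t n i \<omega>))\<^sup>2"
      unfolding taylor_rem_def y by (simp add: x_def u_def)
  qed
qed

lemma taylor_rem_tendsto_0:
  assumes t: "t > 0"
  shows "(\<lambda>n. dP (\<lambda>\<omega>. \<Sum>i<2^n. taylor_rem t n i \<omega>)) \<longlonglongrightarrow> 0"
proof (rule dP_tendsto_0_by_squares[OF t])
  note [measurable] = taylor_rem_measurable[OF t] dX_measurable[OF t]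
  show "(\<lambda>\<omega>. \<Sum>i<2^n. taylor_rem t n i \<omega>) \<in> borel_measurable M" for n by measurable
  fix \<eta> :: real assume \<eta>: "\<eta> > 0"
  \<comment> \<open>The modulus of continuity depends on the path, so at level \<open>n\<close> the
    Taylor bound may still fail; the event of failure has vanishing probability.\<close>
  define A where "A n = {\<omega>\<in>space M. \<not> (\<forall>i\<in>{0..<2^n}. \<bar>taylor_rem t n i \<omega>\<bar> \<le> \<eta> / 2 * (norm (dX t n i \<omega>))\<^sup>2)}" for n
  have Am: "A n \<in> events" for n unfolding A_def by measurable
  moreover have "(\<lambda>n. prob (A n)) \<longlonglongrightarrow> 0"
  proof (rule prob_tendsto_0_pathwise[OF Am])
    fix \<omega> assume w: "\<omega> \<in> space M"
    show "eventually (\<lambda>n. \<omega> \<notin> A n) sequentially"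
      by (rule eventually_mono[OF taylor_rem_eventually_small[OF t w, of "\<eta> / 2"]]) (use \<eta> in \<open>auto simp: A_def\<close>)
  qed
  moreover have "\<bar>\<Sum>i<2^n. taylor_rem t n i \<omega>\<bar> \<le>
      \<eta> * (\<Sum>i<2^n. (norm (euler_noise t n i \<omega>))\<^sup>2) + \<eta> * (\<Sum>i<2^n. (norm (resid t n i \<omega>))\<^sup>2)"
    if w: "\<omega> \<in> space M" "\<omega> \<notin> A n" for n \<omega>
    unfolding sum_distrib_left sum.distrib[symmetric]
  proof (rule order_trans[OF sum_abs sum_mono])
    fix i assume i: "i \<in> {..<(2::nat)^n}"
    define a where "a = norm (euler_noise t n i \<omega>)"
    define u where "u = norm (resid t n i \<omega>)"
    have "\<bar>taylor_rem t n i \<omega>\<bar> \<le> \<eta> / 2 * (norm (dX t n i \<omega>))\<^sup>2" using w i by (auto simp: A_def)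
    also have "\<dots> \<le> \<eta> / 2 * (a + u)\<^sup>2"
      unfolding dX_split a_def u_def using \<eta> by (intro mult_left_mono power_mono norm_triangle_ineq) auto
    also have "\<dots> \<le> \<eta> / 2 * (2 * a\<^sup>2 + 2 * u\<^sup>2)"
      using \<eta> sum_squares_bound[of a u] by (intro mult_left_mono) (auto simp: power2_sum)
    finally show "\<bar>taylor_rem t n i \<omega>\<bar> \<le> \<eta> * (norm (euler_noise t n i \<omega>))\<^sup>2 + \<eta> * (norm (resid t n i \<omega>))\<^sup>2"
      unfolding a_def u_def by (simp add: algebra_simps)
  qed
  ultimately show "\<exists>c A. (\<forall>n. A n \<in> events) \<and> (\<lambda>n. prob (A n)) \<longlonglongrightarrow> 0 \<and> (\<forall>n. \<forall>\<omega>\<in>space M. \<omega> \<notin> A n \<longrightarrow>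
      \<bar>\<Sum>i<2^n. taylor_rem t n i \<omega>\<bar> \<le> \<eta> * (\<Sum>i<2^n. (norm (euler_noise t n i \<omega>))\<^sup>2) + c * (\<Sum>i<2^n. (norm (resid t n i \<omega>))\<^sup>2))"
    by (intro exI[of _ \<eta>] exI[of _ A]) auto
qed

end

section \<open>The Ito formula on dyadic grids\<close>

lemma sum_swap_pairs:
  fixes f :: "'d::finite \<Rightarrow> 'd \<Rightarrow> 'd \<Rightarrow> 'd \<Rightarrow> real"
  shows "(\<Sum>k'\<in>UNIV. \<Sum>l'\<in>UNIV. \<Sum>k\<in>UNIV. \<Sum>l\<in>UNIV. f k l k' l') =
    (\<Sum>k\<in>UNIV. \<Sum>l\<in>UNIV. \<Sum>k'\<in>UNIV. \<Sum>l'\<in>UNIV. f k l k' l')"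
proof -
  have "(\<Sum>k'\<in>UNIV. \<Sum>l'\<in>UNIV. \<Sum>k\<in>UNIV. \<Sum>l\<in>UNIV. f k l k' l') = (\<Sum>k'\<in>UNIV. \<Sum>k\<in>UNIV. \<Sum>l'\<in>UNIV. \<Sum>l\<in>UNIV. f k l k' l')"
    by (rule sum.cong[OF refl], rule sum.swap)
  also have "\<dots> = (\<Sum>k\<in>UNIV. \<Sum>k'\<in>UNIV. \<Sum>l'\<in>UNIV. \<Sum>l\<in>UNIV. f k l k' l')" by (rule sum.swap)
  also have "\<dots> = (\<Sum>k\<in>UNIV. \<Sum>k'\<in>UNIV. \<Sum>l\<in>UNIV. \<Sum>l'\<in>UNIV. f k l k' l')"
    by (rule sum.cong[OF refl], rule sum.cong[OF refl], rule sum.swap)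
  also have "\<dots> = (\<Sum>k\<in>UNIV. \<Sum>l\<in>UNIV. \<Sum>k'\<in>UNIV. \<Sum>l'\<in>UNIV. f k l k' l')"
    by (rule sum.cong[OF refl], rule sum.swap)
  finally show ?thesis .
qed

context sde_test_function begin

text \<open>The entries of \<open>r\<^sup>2 / 2\<close> times \<open>S^T D S\<close>: the
  second-order term of an Euler step as a quadratic form in the Brownian increment. Its trace is the
  second-order part of \<open>L\<close>.\<close>

definition hess_noise :: "'d \<Rightarrow> 'd \<Rightarrow> real^'d \<Rightarrow> real" where
  "hess_noise k l x = (r x)\<^sup>2 / 2 * (\<Sum>k'\<in>UNIV. \<Sum>l'\<in>UNIV. D k' l' x * S $ k' $ k * S $ l' $ l)"

lemma hess_noise_cont: "continuous_on UNIV (hess_noise k l)"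
  unfolding hess_noise_def[abs_def] by (intro continuous_intros r_cont D_cont) auto

lemma qf_euler_noise:
  "qf x (S *v (r x *\<^sub>R w)) / 2 = (\<Sum>k\<in>UNIV. \<Sum>l\<in>UNIV. hess_noise k l x * (w $ k * w $ l))"
proof -
  have "qf x (S *v (r x *\<^sub>R w)) / 2 = (\<Sum>k'\<in>UNIV. \<Sum>l'\<in>UNIV. \<Sum>k\<in>UNIV. \<Sum>l\<in>UNIV.
      (r x)\<^sup>2 / 2 * (D k' l' x * S $ k' $ k * S $ l' $ l) * (w $ k * w $ l))"
    unfolding qf_def matrix_vector_mult_def
    by (simp add: sum_divide_distrib sum_product sum_distrib_left power2_eq_square mult_ac)
  also have "\<dots> = (\<Sum>k\<in>UNIV. \<Sum>l\<in>UNIV. \<Sum>k'\<in>UNIV. \<Sum>l'\<in>UNIV.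
      (r x)\<^sup>2 / 2 * (D k' l' x * S $ k' $ k * S $ l' $ l) * (w $ k * w $ l))"
    by (rule sum_swap_pairs)
  also have "\<dots> = (\<Sum>k\<in>UNIV. \<Sum>l\<in>UNIV. hess_noise k l x * (w $ k * w $ l))"
    unfolding hess_noise_def by (simp only: sum_distrib_left sum_distrib_right)
  finally show ?thesis .
qed

lemma trace_hess_noise:
  "(\<Sum>k\<in>UNIV. hess_noise k k x) = (r x)\<^sup>2 / 2 * (\<Sum>k\<in>UNIV. \<Sum>l\<in>UNIV. D k l x * (S ** transpose S) $ k $ l)"
proof -
  have "(\<Sum>k\<in>UNIV. hess_noise k k x) = (r x)\<^sup>2 / 2 * (\<Sum>k\<in>UNIV. \<Sum>k'\<in>UNIV. \<Sum>l'\<in>UNIV. D k' l' x * S $ k' $ k * S $ l' $ k)"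
    unfolding hess_noise_def by (simp only: sum_distrib_left)
  also have "(\<Sum>k\<in>UNIV. \<Sum>k'\<in>UNIV. \<Sum>l'\<in>UNIV. D k' l' x * S $ k' $ k * S $ l' $ k) =
      (\<Sum>k'\<in>UNIV. \<Sum>l'\<in>UNIV. \<Sum>k\<in>UNIV. D k' l' x * S $ k' $ k * S $ l' $ k)"
    by (subst sum.swap, rule sum.cong[OF refl], rule sum.swap)
  also have "\<dots> = (\<Sum>k\<in>UNIV. \<Sum>l\<in>UNIV. D k l x * (S ** transpose S) $ k $ l)"
    by (simp add: matrix_matrix_mult_def transpose_def sum_distrib_left mult.assoc)
  finally show ?thesis .
qed

text \<open>A product of two increment components minus its mean has variance of order
  \<open>h\<^sup>2\<close>. With \<open>h = t / 2^n\<close> and bounded coefficients,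
  \<open>2^n\<close> of these terms have total variance of order \<open>1 / 2^n\<close>, so the
  products may be replaced by their means, which leaves the trace.\<close>

lemma quadratic_variation_tendsto_0:
  assumes t: "t > 0"
  shows "(\<lambda>n. dP (\<lambda>\<omega>. \<Sum>i<2^n. qf (X (gp t n i) \<omega>) (euler_noise t n i \<omega>) / 2
      - (t / 2^n) * (\<Sum>k\<in>UNIV. hess_noise k k (X (gp t n i) \<omega>)))) \<longlonglongrightarrow> 0"
proof -
  define z where "z n k l x = x $ k * x $ l - (if k = l then t / 2^n else 0)" for n k l and x :: "real^'d"
  define Z where "Z n k l \<omega> = (\<Sum>i=0..<2^n. hess_noise k l (X (gp t n i) \<omega>) * z n k l (dWg t n i \<omega>))" for n k l \<omega>
  have h: "t / 2^n > 0" for n using t by simp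
  note zc = centred_noise_product[OF h, folded z_def]
  have cm: "(\<lambda>\<omega>. hess_noise k l (X (gp t n i) \<omega>)) \<in> borel_measurable (F (real i * (t / 2^n)))" for n k l i
    using fX_grid_adapted[OF hess_noise_cont t, of k l n i 0] by simp
  have zm[measurable]: "z n k l \<in> borel_measurable borel" for n k l
    unfolding z_def[abs_def] by measurable
  have Zm[measurable]: "Z n k l \<in> borel_measurable M" for n k l
    unfolding Z_def[abs_def] using t
    by (intro borel_measurable_sum borel_measurable_times grid_measurable hess_noise_cont measurable_compose[OF dWg_measurable zm]) auto
  have Z0: "(\<lambda>n. dP (Z n k l)) \<longlonglongrightarrow> 0" for k l
  proof -
    \<comment> \<open>The truncation level is \<open>n\<close> itself: the coefficients of each path
      are eventually below it, while its cost \<open>real n * (1 / sqrt 2) ^ n\<close> still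
      vanishes.\<close>
    define A where "A n = {\<omega>\<in>space M. \<exists>i\<in>{0..<2^n}. real n < \<bar>hess_noise k l (X (gp t n i) \<omega>)\<bar>}" for n :: nat
    have le: "dP (Z n k l) \<le> prob (A n) + sqrt 8 * t * (real n * (1 / sqrt 2) ^ n)" for n
    proof -
      have "dP (Z n k l) \<le> prob (A n) + real n * sqrt (real (2^n - 0) * (8 * (t / 2^n)\<^sup>2))"
        unfolding Z_def[abs_def] A_def dWg_def by (rule noise_sum_dP[OF zc cm]) auto
      also have "real (2^n - 0) * (8 * (t / 2^n)\<^sup>2) = 8 * t\<^sup>2 * (1 / 2) ^ n"
        by (simp add: power2_eq_square field_simps)
      also have "sqrt (8 * t\<^sup>2 * (1 / 2) ^ n) = sqrt 8 * t * (1 / sqrt 2) ^ n"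
        using t by (simp add: real_sqrt_mult real_sqrt_power real_sqrt_divide)
      finally show ?thesis by (simp add: mult_ac)
    qed
    have "(\<lambda>n. prob (A n)) \<longlonglongrightarrow> 0"
    proof (rule prob_tendsto_0_pathwise)
      have [measurable]: "(\<lambda>\<omega>. hess_noise k l (X (gp t n i) \<omega>)) \<in> borel_measurable M" for n i
        using t by (intro grid_measurable hess_noise_cont)
      show "A n \<in> events" for n unfolding A_def by measurable
      fix \<omega> assume w: "\<omega> \<in> space M"
      obtain K where K: "K > 0" "\<And>s. s \<in> {0..t} \<Longrightarrow> norm (hess_noise k l (X s \<omega>)) \<le> K"
        using path_bounded[OF hess_noise_cont w] by blast
      obtain k0 where k0: "K \<le> real k0" using real_arch_simple by blast
      have "\<omega> \<notin> A n" if "n \<ge> k0" for n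
      proof
        assume "\<omega> \<in> A n"
        then obtain i where i: "i < 2^n" "real n < \<bar>hess_noise k l (X (gp t n i) \<omega>)\<bar>" unfolding A_def by auto
        have "gp t n i \<in> {0..t}" using t i by (auto intro: gp_nonneg gp_le)
        from K(2)[OF this] i(2) k0 that show False by simp
      qed
      then show "eventually (\<lambda>n. \<omega> \<notin> A n) sequentially" by (auto simp: eventually_sequentially)
    qed
    moreover have "(\<lambda>n. sqrt 8 * t * (real n * (1 / sqrt 2) ^ n)) \<longlonglongrightarrow> sqrt 8 * t * 0"
      using powser_times_n_limit_0[of "1 / sqrt 2"] by (intro tendsto_mult tendsto_const) auto
    ultimately have lim: "(\<lambda>n. prob (A n) + sqrt 8 * t * (real n * (1 / sqrt 2) ^ n)) \<longlonglongrightarrow> 0"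
      using tendsto_add by fastforce
    show ?thesis
      by (rule tendsto_sandwich[OF always_eventually always_eventually tendsto_const lim]) (use le dP_nonneg in auto)
  qed
  have eq: "(\<Sum>i<2^n. qf (X (gp t n i) \<omega>) (euler_noise t n i \<omega>) / 2 - (t / 2^n) * (\<Sum>k\<in>UNIV. hess_noise k k (X (gp t n i) \<omega>))) =
      (\<Sum>k\<in>UNIV. \<Sum>l\<in>UNIV. Z n k l \<omega>)" for n \<omega>
  proof -
    have "qf x (S *v (r x *\<^sub>R w)) / 2 - (t / 2^n) * (\<Sum>k\<in>UNIV. hess_noise k k x) =
        (\<Sum>k\<in>UNIV. \<Sum>l\<in>UNIV. hess_noise k l x * z n k l w)" for x w
    proof -
      have "(\<Sum>k\<in>UNIV. \<Sum>l\<in>UNIV. hess_noise k l x * z n k l w) =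
          (\<Sum>k\<in>UNIV. \<Sum>l\<in>UNIV. hess_noise k l x * (w $ k * w $ l)) -
          (\<Sum>k\<in>UNIV. \<Sum>l\<in>UNIV. if k = l then hess_noise k l x * (t / 2^n) else 0)"
        unfolding z_def sum_subtractf[symmetric] by (intro sum.cong refl) (simp add: right_diff_distrib)
      also have "(\<Sum>k\<in>UNIV. \<Sum>l\<in>UNIV. if k = l then hess_noise k l x * (t / 2^n) else 0) = (t / 2^n) * (\<Sum>k\<in>UNIV. hess_noise k k x)"
        by (simp add: sum_distrib_left mult.commute)
      finally show ?thesis unfolding qf_euler_noise by simp
    qed
    then have "(\<Sum>i<2^n. qf (X (gp t n i) \<omega>) (euler_noise t n i \<omega>) / 2 - (t / 2^n) * (\<Sum>k\<in>UNIV. hess_noise k k (X (gp t n i) \<omega>))) =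
        (\<Sum>i<2^n. \<Sum>k\<in>UNIV. \<Sum>l\<in>UNIV. hess_noise k l (X (gp t n i) \<omega>) * z n k l (dWg t n i \<omega>))"
      unfolding euler_noise_def rX_def by simp
    also have "\<dots> = (\<Sum>k\<in>UNIV. \<Sum>i<2^n. \<Sum>l\<in>UNIV. hess_noise k l (X (gp t n i) \<omega>) * z n k l (dWg t n i \<omega>))"
      by (rule sum.swap)
    also have "\<dots> = (\<Sum>k\<in>UNIV. \<Sum>l\<in>UNIV. Z n k l \<omega>)"
      unfolding Z_def lessThan_atLeast0 by (rule sum.cong[OF refl], rule sum.swap)
    finally show ?thesis .
  qed
  have le: "dP (\<lambda>\<omega>. \<Sum>k\<in>UNIV. \<Sum>l\<in>UNIV. Z n k l \<omega>) \<le> (\<Sum>k\<in>UNIV. \<Sum>l\<in>UNIV. dP (Z n k l))" for n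
  proof -
    have "dP (\<lambda>\<omega>. \<Sum>k\<in>UNIV. \<Sum>l\<in>UNIV. Z n k l \<omega>) \<le> (\<Sum>k\<in>UNIV. dP (\<lambda>\<omega>. \<Sum>l\<in>UNIV. Z n k l \<omega>))"
      by (rule dP_sum) auto
    also have "\<dots> \<le> (\<Sum>k\<in>UNIV. \<Sum>l\<in>UNIV. dP (Z n k l))" by (intro sum_mono dP_sum) auto
    finally show ?thesis .
  qed
  have "(\<lambda>n. \<Sum>k\<in>UNIV. \<Sum>l\<in>UNIV. dP (Z n k l)) \<longlonglongrightarrow> (\<Sum>k\<in>(UNIV::'d set). \<Sum>l\<in>(UNIV::'d set). 0)"
    by (intro tendsto_sum Z0)
  then have lim: "(\<lambda>n. \<Sum>k\<in>UNIV. \<Sum>l\<in>UNIV. dP (Z n k l)) \<longlonglongrightarrow> 0" by simp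
  show ?thesis unfolding eq
    by (rule tendsto_sandwich[OF always_eventually always_eventually tendsto_const lim]) (use le dP_nonneg in auto)
qed

definition mart_part :: "real \<Rightarrow> nat \<Rightarrow> 'a \<Rightarrow> real" where
  "mart_part t n \<omega> = (\<Sum>i<2^n. g (X (gp t n i) \<omega>) \<bullet> euler_noise t n i \<omega>)"

text \<open>The error in Ito's formula when both of its integrals are replaced by left-point
  sums.\<close>

definition ito_defect :: "real \<Rightarrow> nat \<Rightarrow> 'a \<Rightarrow> real" where
  "ito_defect t n \<omega> = \<Phi> (X t \<omega>) - \<Phi> x0 - (\<Sum>i<2^n. (t / 2^n) * L (X (gp t n i) \<omega>)) - mart_part t n \<omega>"

lemma mart_part_measurable [measurable]: "t > 0 \<Longrightarrow> mart_part t n \<in> borel_measurable M"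
  unfolding mart_part_def[abs_def]
  by (intro borel_measurable_sum borel_measurable_inner grid_measurable g_cont euler_noise_measurable)

lemma ito_defect_measurable [measurable]: "t > 0 \<Longrightarrow> ito_defect t n \<in> borel_measurable M"
  unfolding ito_defect_def[abs_def]
  by (intro borel_measurable_diff borel_measurable_const borel_measurable_sum borel_measurable_times
      grid_measurable L_cont mart_part_measurable fX_measurable[OF \<Phi>_cont]) auto

text \<open>The defect has five sources in each cell: the drift frozen at the left end, the noise
  against its Euler step, the quadratic form of the true increment against that of the Euler step,
  products of Brownian increments against their means, and the Taylor remainder.\<close>

lemma ito_defect_tendsto_0:
  assumes t: "t > 0"
  shows "(\<lambda>n. dP (ito_defect t n)) \<longlonglongrightarrow> 0"
proof -
  define Y1 where "Y1 n \<omega> = (\<Sum>i<2^n. g (X (gp t n i) \<omega>) \<bullet> (drift t n i \<omega> - (t / 2^n) *\<^sub>R G (X (gp t n i) \<omega>)))" for n \<omega>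
  define Y2 where "Y2 n \<omega> = (\<Sum>i<2^n. g (X (gp t n i) \<omega>) \<bullet> mart_err t n i \<omega>)" for n \<omega>
  define Y3 where "Y3 n \<omega> = (\<Sum>i<2^n. (qf (X (gp t n i) \<omega>) (dX t n i \<omega>) - qf (X (gp t n i) \<omega>) (euler_noise t n i \<omega>)) / 2)" for n \<omega>
  define Y4 where "Y4 n \<omega> = (\<Sum>i<2^n. qf (X (gp t n i) \<omega>) (euler_noise t n i \<omega>) / 2
      - (t / 2^n) * (\<Sum>k\<in>UNIV. hess_noise k k (X (gp t n i) \<omega>)))" for n \<omega>
  define Y5 where "Y5 n \<omega> = (\<Sum>i<2^n. taylor_rem t n i \<omega>)" for n \<omega>
  have m1[measurable]: "Y1 n \<in> borel_measurable M" for n unfolding Y1_def[abs_def]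
    using t by (intro borel_measurable_sum borel_measurable_inner borel_measurable_diff drift_measurable
        borel_measurable_scaleR borel_measurable_const grid_measurable g_cont G_cont)
  have m2[measurable]: "Y2 n \<in> borel_measurable M" for n unfolding Y2_def[abs_def]
    using t by (intro borel_measurable_sum borel_measurable_inner mart_err_measurable grid_measurable g_cont)
  have m3[measurable]: "Y3 n \<in> borel_measurable M" for n unfolding Y3_def[abs_def]
    using t by (intro borel_measurable_sum borel_measurable_divide borel_measurable_diff qf_measurable
        dX_measurable euler_noise_measurable borel_measurable_const)
  have m4[measurable]: "Y4 n \<in> borel_measurable M" for n unfolding Y4_def[abs_def]
    using t by (intro borel_measurable_sum borel_measurable_divide borel_measurable_diff qf_measurable
        borel_measurable_times euler_noise_measurable borel_measurable_const grid_measurable hess_noise_cont)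
  have m5[measurable]: "Y5 n \<in> borel_measurable M" for n unfolding Y5_def[abs_def]
    using t by (intro borel_measurable_sum taylor_rem_measurable)
  have eq: "ito_defect t n \<omega> = Y1 n \<omega> + Y2 n \<omega> + Y3 n \<omega> + Y4 n \<omega> + Y5 n \<omega>" if w: "\<omega> \<in> space M" for n \<omega>
  proof -
    have "(\<Sum>i<2^n. \<Phi> (X (gp t n (Suc i)) \<omega>) - \<Phi> (X (gp t n i) \<omega>)) = \<Phi> (X (gp t n (2^n)) \<omega>) - \<Phi> (X (gp t n 0) \<omega>)"
      by (rule sum_lessThan_telescope)
    then have tele: "\<Phi> (X t \<omega>) - \<Phi> x0 = (\<Sum>i<2^n. \<Phi> (X (gp t n (Suc i)) \<omega>) - \<Phi> (X (gp t n i) \<omega>))"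
      by (simp add: gp_simps X_init[OF w])
    have cell: "\<Phi> (X (gp t n (Suc i)) \<omega>) - \<Phi> (X (gp t n i) \<omega>) - (t / 2^n) * L (X (gp t n i) \<omega>) - g (X (gp t n i) \<omega>) \<bullet> euler_noise t n i \<omega> =
        g (X (gp t n i) \<omega>) \<bullet> (drift t n i \<omega> - (t / 2^n) *\<^sub>R G (X (gp t n i) \<omega>)) + g (X (gp t n i) \<omega>) \<bullet> mart_err t n i \<omega>
        + (qf (X (gp t n i) \<omega>) (dX t n i \<omega>) - qf (X (gp t n i) \<omega>) (euler_noise t n i \<omega>)) / 2
        + (qf (X (gp t n i) \<omega>) (euler_noise t n i \<omega>) / 2 - (t / 2^n) * (\<Sum>k\<in>UNIV. hess_noise k k (X (gp t n i) \<omega>)))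
        + taylor_rem t n i \<omega>" for i
    proof -
      define x where "x = X (gp t n i) \<omega>"
      have "L x = g x \<bullet> G x + (\<Sum>k\<in>UNIV. hess_noise k k x)" unfolding L_def trace_hess_noise by (simp add: inner_commute)
      moreover have "g x \<bullet> dX t n i \<omega> = g x \<bullet> euler_noise t n i \<omega> + g x \<bullet> drift t n i \<omega> + g x \<bullet> mart_err t n i \<omega>"
        unfolding dX_split resid_def by (simp add: inner_add_right)
      ultimately show ?thesis unfolding taylor_rem_def x_def[symmetric]
        by (simp add: inner_diff_right diff_divide_distrib distrib_left)
    qed
    have "ito_defect t n \<omega> = (\<Sum>i<2^n. \<Phi> (X (gp t n (Suc i)) \<omega>) - \<Phi> (X (gp t n i) \<omega>) - (t / 2^n) * L (X (gp t n i) \<omega>) - g (X (gp t n i) \<omega>) \<bullet> euler_noise t n i \<omega>)"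
      unfolding ito_defect_def mart_part_def tele by (simp only: sum_subtractf)
    then show ?thesis unfolding cell Y1_def Y2_def Y3_def Y4_def Y5_def by (simp only: sum.distrib)
  qed
  have le: "dP (ito_defect t n) \<le> dP (Y1 n) + dP (Y2 n) + dP (Y3 n) + dP (Y4 n) + dP (Y5 n)" for n
  proof -
    have tri: "dP (\<lambda>\<omega>. U \<omega> + V \<omega>) \<le> dP U + dP V" if "U \<in> borel_measurable M" "V \<in> borel_measurable M" for U V :: "'a \<Rightarrow> real"
      using that by (intro dP_triangle) (auto intro: abs_triangle_ineq)
    have "dP (ito_defect t n) \<le> dP (\<lambda>\<omega>. Y1 n \<omega> + Y2 n \<omega> + Y3 n \<omega> + Y4 n \<omega> + Y5 n \<omega>)"
      by (rule dP_mono) (use t in \<open>auto simp: eq\<close>)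
    also have "\<dots> \<le> dP (Y1 n) + dP (Y2 n) + dP (Y3 n) + dP (Y4 n) + dP (Y5 n)"
      using tri[OF m1[of n] m2[of n]] tri[OF borel_measurable_add[OF m1[of n] m2[of n]] m3[of n]]
        tri[OF borel_measurable_add[OF borel_measurable_add[OF m1[of n] m2[of n]] m3[of n]] m4[of n]]
        tri[OF borel_measurable_add[OF borel_measurable_add[OF borel_measurable_add[OF m1[of n] m2[of n]] m3[of n]] m4[of n]] m5[of n]]
      by linarith
    finally show ?thesis .
  qed
  have "(\<lambda>n. dP (Y1 n) + dP (Y2 n) + dP (Y3 n) + dP (Y4 n) + dP (Y5 n)) \<longlonglongrightarrow> 0 + 0 + 0 + 0 + 0"
    unfolding Y1_def[abs_def] Y2_def[abs_def] Y3_def[abs_def] Y4_def[abs_def] Y5_def[abs_def]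
    by (intro tendsto_add drift_euler_tendsto_0[OF t] mart_err_weighted_tendsto_0[OF t g_cont g_bound] qf_perturb_tendsto_0[OF t]
        quadratic_variation_tendsto_0[OF t] taylor_rem_tendsto_0[OF t])
  then have lim: "(\<lambda>n. dP (Y1 n) + dP (Y2 n) + dP (Y3 n) + dP (Y4 n) + dP (Y5 n)) \<longlonglongrightarrow> 0" by simp
  show ?thesis
    by (rule tendsto_sandwich[OF always_eventually always_eventually tendsto_const lim]) (use le dP_nonneg in auto)
qed

text \<open>The coefficients \<open>r\<close> times \<open>S^T g\<close> are bounded by
  \<open>rg_bound\<close>, so each component is a centred martingale sum with second moment of order
  \<open>t\<close>, uniformly in \<open>n\<close>. Cauchy-Schwarz combines the components.\<close>

lemma mart_part_moments:
  assumes t: "t > 0"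
  obtains v where "\<And>n. integrable M (mart_part t n)" "\<And>n. expectation (mart_part t n) = 0"
    "\<And>n. integrable M (\<lambda>\<omega>. (mart_part t n \<omega>)\<^sup>2)" "\<And>n. expectation (\<lambda>\<omega>. (mart_part t n \<omega>)\<^sup>2) \<le> v"
proof -
  obtain KS where KS: "KS > 0" "\<And>x. norm (transpose S *v x) \<le> norm x * KS"
    using bounded_linear.pos_bounded[OF matrix_vector_mul_bounded_linear[of "transpose S"]] by blast
  define c where "c k x = r x * (transpose S *v g x) $ k" for k x
  have cb: "\<bar>c k x\<bar> \<le> KS * C" for k x
  proof -
    have "\<bar>c k x\<bar> = \<bar>r x\<bar> * \<bar>(transpose S *v g x) $ k\<bar>" by (simp add: c_def abs_mult)
    also have "\<dots> \<le> \<bar>r x\<bar> * (norm (g x) * KS)"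
      using component_le_norm_cart[of "transpose S *v g x" k] KS(2)[of "g x"] by (intro mult_left_mono) linarith+
    also have "\<dots> = KS * (\<bar>r x\<bar> * norm (g x))" by simp
    also have "\<dots> \<le> KS * C" using KS(1) rg_bound[of x] by (intro mult_left_mono) auto
    finally show ?thesis .
  qed
  have "continuous_on UNIV (\<lambda>x. transpose S *v g x)"
    by (rule continuous_on_compose2[OF linear_continuous_on[OF matrix_vector_mul_bounded_linear, of UNIV] g_cont]) auto
  then have cc: "continuous_on UNIV (c k)" for k unfolding c_def[abs_def] by (intro continuous_intros r_cont)
  have cm: "(\<lambda>\<omega>. c k (X (gp t n i) \<omega>)) \<in> borel_measurable (F (real i * (t / 2^n)))" for n k i
    using fX_grid_adapted[OF cc t, of k n i 0] by simp
  define Z where "Z n k \<omega> = (\<Sum>i=0..<2^n. c k (X (gp t n i) \<omega>) * dWg t n i \<omega> $ k)" for n k \<omega>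
  have h: "t / 2^n > 0" for n using t by simp
  have Z: "Z n k \<in> borel_measurable (F (real (2^n) * (t / 2^n))) \<and> integrable M (\<lambda>\<omega>. (Z n k \<omega>)\<^sup>2) \<and> expectation (Z n k) = 0 \<and>
      expectation (\<lambda>\<omega>. (Z n k \<omega>)\<^sup>2) \<le> real (2^n - 0) * ((KS * C)\<^sup>2 * (t / 2^n))" for n k
    using martingale_sum_second_moment[OF centred_noise_component[OF h[of n], of k] cm cb, of 0 "2^n"]
    unfolding Z_def[abs_def] dWg_def by simp
  have Zm[measurable]: "Z n k \<in> borel_measurable M" for n k using Z adapted_measurable by blast
  have Zi2: "integrable M (\<lambda>\<omega>. (Z n k \<omega>)\<^sup>2)" for n k using Z by blast
  have Zi: "integrable M (Z n k)" for n k by (rule square_integrable_imp_integrable) (use Zi2 in auto)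
  have ZE: "expectation (\<lambda>\<omega>. (Z n k \<omega>)\<^sup>2) \<le> (KS * C)\<^sup>2 * t" for n k
    using conjunct2[OF conjunct2[OF conjunct2[OF Z[of n k]]]] by simp
  have eq: "mart_part t n \<omega> = (\<Sum>k\<in>UNIV. Z n k \<omega>)" for n \<omega>
  proof -
    have "g x \<bullet> (S *v (r x *\<^sub>R w)) = (\<Sum>k\<in>UNIV. c k x * w $ k)" for x w
    proof -
      have "g x \<bullet> (S *v (r x *\<^sub>R w)) = r x * ((transpose S *v g x) \<bullet> w)"
        by (simp add: matrix_vector_mult_scaleR dot_lmul_matrix transpose_matrix_vector)
      then show ?thesis by (simp add: inner_vec_def sum_distrib_left c_def mult_ac)
    qed
    then have "mart_part t n \<omega> = (\<Sum>i<2^n. \<Sum>k\<in>UNIV. c k (X (gp t n i) \<omega>) * dWg t n i \<omega> $ k)"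
      unfolding mart_part_def euler_noise_def rX_def by simp
    also have "\<dots> = (\<Sum>k\<in>UNIV. Z n k \<omega>)" unfolding Z_def lessThan_atLeast0 by (rule sum.swap)
    finally show ?thesis .
  qed
  define dd where "dd = real CARD('d)"
  have sq: "(mart_part t n \<omega>)\<^sup>2 \<le> dd * (\<Sum>k\<in>UNIV. (Z n k \<omega>)\<^sup>2)" for n \<omega>
  proof -
    have "(\<Sum>k\<in>(UNIV::'d set). 1 * Z n k \<omega>)\<^sup>2 \<le> (\<Sum>k\<in>(UNIV::'d set). 1\<^sup>2) * (\<Sum>k\<in>UNIV. (Z n k \<omega>)\<^sup>2)"
      by (rule Cauchy_Schwarz_ineq_sum)
    then show ?thesis unfolding eq dd_def by simp
  qed
  note [measurable] = mart_part_measurable[OF t]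
  have ib: "integrable M (\<lambda>\<omega>. dd * (\<Sum>k\<in>UNIV. (Z n k \<omega>)\<^sup>2))" for n using Zi2 by auto
  have i2: "integrable M (\<lambda>\<omega>. (mart_part t n \<omega>)\<^sup>2)" for n
    by (rule Bochner_Integration.integrable_bound[OF ib]) (use sq in \<open>auto intro: order_trans[OF sq abs_ge_self]\<close>)
  have "expectation (\<lambda>\<omega>. (mart_part t n \<omega>)\<^sup>2) \<le> dd * (dd * ((KS * C)\<^sup>2 * t))" for n
  proof -
    have "expectation (\<lambda>\<omega>. (mart_part t n \<omega>)\<^sup>2) \<le> expectation (\<lambda>\<omega>. dd * (\<Sum>k\<in>UNIV. (Z n k \<omega>)\<^sup>2))"
      by (rule integral_mono[OF i2 ib]) (rule sq)
    also have "\<dots> = dd * (\<Sum>k\<in>UNIV. expectation (\<lambda>\<omega>. (Z n k \<omega>)\<^sup>2))" using Zi2 by simp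
    also have "\<dots> \<le> dd * (\<Sum>k\<in>(UNIV::'d set). (KS * C)\<^sup>2 * t)" by (intro mult_left_mono sum_mono ZE) (simp add: dd_def)
    finally show ?thesis by (simp add: dd_def)
  qed
  moreover have "integrable M (mart_part t n)" for n unfolding eq[abs_def] using Zi by auto
  moreover have "expectation (mart_part t n) = 0" for n unfolding eq[abs_def] using Zi Z by simp
  ultimately show thesis using that i2 by blast
qed

lemma expectation_L_cont: "continuous_on {0..t} (\<lambda>s. expectation (\<lambda>\<omega>. L (X s \<omega>)))"
  unfolding continuous_on_sequentially
proof (intro allI ballI impI)
  fix s and a assume a: "a \<in> {0..t}" and s: "(\<forall>n. s n \<in> {0..t}) \<and> s \<longlonglongrightarrow> a"
  have "(\<lambda>n. expectation (\<lambda>\<omega>. L (X (s n) \<omega>))) \<longlonglongrightarrow> expectation (\<lambda>\<omega>. L (X a \<omega>))"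
  proof (rule integral_dominated_convergence[where w="\<lambda>_. C"])
    show "(\<lambda>\<omega>. L (X a \<omega>)) \<in> borel_measurable M" using a by (intro fX_measurable[OF L_cont]) auto
    show "(\<lambda>\<omega>. L (X (s n) \<omega>)) \<in> borel_measurable M" for n using s by (intro fX_measurable[OF L_cont]) auto
    show "AE \<omega> in M. (\<lambda>n. L (X (s n) \<omega>)) \<longlonglongrightarrow> L (X a \<omega>)"
    proof (rule AE_I2)
      fix \<omega> assume w: "\<omega> \<in> space M"
      from fX_cont'[OF L_cont w order_refl, of t] s a
      show "(\<lambda>n. L (X (s n) \<omega>)) \<longlonglongrightarrow> L (X a \<omega>)"
        unfolding continuous_on_sequentially by (auto simp: o_def)
    qed
  qed (use L_bound in auto)
  then show "((\<lambda>s. expectation (\<lambda>\<omega>. L (X s \<omega>))) \<circ> s) \<longlonglongrightarrow> expectation (\<lambda>\<omega>. L (X a \<omega>))" by (simp add: o_def)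
qed

text \<open>On every grid the martingale part has mean exactly zero, so the mean of the defect
  involves only \<open>\<Phi>\<close> and a Riemann sum of the continuous function \<open>f\<close>.
  Convergence of that mean to zero needs the \<open>L\<^sup>2\<close> bound, since the defect itself
  tends to zero only in probability.\<close>

theorem dynkin:
  assumes t: "t > 0"
  shows "expectation (\<lambda>\<omega>. \<Phi> (X t \<omega>)) = \<Phi> x0 + integral {0..t} (\<lambda>s. expectation (\<lambda>\<omega>. L (X s \<omega>)))"
proof -
  obtain v where mi: "\<And>n. integrable M (mart_part t n)" and m0: "\<And>n. expectation (mart_part t n) = 0"
    and mi2: "\<And>n. integrable M (\<lambda>\<omega>. (mart_part t n \<omega>)\<^sup>2)" and mv: "\<And>n. expectation (\<lambda>\<omega>. (mart_part t n \<omega>)\<^sup>2) \<le> v"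
    using mart_part_moments[OF t] by blast
  note [measurable] = mart_part_measurable[OF t] ito_defect_measurable[OF t]
  define R where "R n \<omega> = \<Phi> (X t \<omega>) - \<Phi> x0 - (\<Sum>i<2^n. (t / 2^n) * L (X (gp t n i) \<omega>))" for n \<omega>
  have def_eq: "ito_defect t n \<omega> = R n \<omega> - mart_part t n \<omega>" for n \<omega> by (simp add: ito_defect_def R_def)
  have Rm[measurable]: "R n \<in> borel_measurable M" for n
    unfolding R_def[abs_def] using t
    by (intro borel_measurable_diff borel_measurable_const borel_measurable_sum borel_measurable_times
      grid_measurable L_cont fX_measurable[OF \<Phi>_cont]) auto
  define B where "B = 2 * C + t * C"
  have Rb: "\<bar>R n \<omega>\<bar> \<le> B" for n \<omega>
  proof -
    have "\<bar>\<Sum>i<2^n. (t / 2^n) * L (X (gp t n i) \<omega>)\<bar> \<le> (\<Sum>i<(2::nat)^n. (t / 2^n) * C)"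
      using t L_bound by (intro order_trans[OF sum_abs sum_mono]) (auto simp: abs_mult intro!: divide_right_mono)
    also have "\<dots> = t * C" by simp
    finally show ?thesis unfolding R_def B_def using \<Phi>_bound[of "X t \<omega>"] \<Phi>_bound[of x0] by linarith
  qed
  have B0: "B \<ge> 0" using Rb[of 0 undefined] by linarith
  have Ri: "integrable M (R n)" for n by (rule integrable_const_bound[where B=B]) (use Rb in auto)
  have sq: "(ito_defect t n \<omega>)\<^sup>2 \<le> 2 * B\<^sup>2 + 2 * (mart_part t n \<omega>)\<^sup>2" for n \<omega>
  proof -
    have "(ito_defect t n \<omega>)\<^sup>2 \<le> 2 * (R n \<omega>)\<^sup>2 + 2 * (mart_part t n \<omega>)\<^sup>2"
      unfolding def_eq using sum_squares_bound[of "R n \<omega>" "- mart_part t n \<omega>"] by (simp add: power2_diff)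
    moreover have "(R n \<omega>)\<^sup>2 \<le> B\<^sup>2" using Rb[of n \<omega>] B0 abs_le_square_iff[of "R n \<omega>" B] by simp
    ultimately show ?thesis by linarith
  qed
  have ib: "integrable M (\<lambda>\<omega>. 2 * B\<^sup>2 + 2 * (mart_part t n \<omega>)\<^sup>2)" for n using mi2 by auto
  have i2: "integrable M (\<lambda>\<omega>. (ito_defect t n \<omega>)\<^sup>2)" for n
    by (rule Bochner_Integration.integrable_bound[OF ib]) (use sq in \<open>auto intro: order_trans[OF sq abs_ge_self]\<close>)
  have v2: "expectation (\<lambda>\<omega>. (ito_defect t n \<omega>)\<^sup>2) \<le> 2 * B\<^sup>2 + 2 * v" for n
  proof -
    have "expectation (\<lambda>\<omega>. (ito_defect t n \<omega>)\<^sup>2) \<le> expectation (\<lambda>\<omega>. 2 * B\<^sup>2 + 2 * (mart_part t n \<omega>)\<^sup>2)"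
      by (rule integral_mono[OF i2 ib]) (rule sq)
    also have "\<dots> = 2 * B\<^sup>2 + 2 * expectation (\<lambda>\<omega>. (mart_part t n \<omega>)\<^sup>2)" using mi2 by (simp add: prob_space)
    finally show ?thesis using mv[of n] by linarith
  qed
  have lim0: "(\<lambda>n. expectation (ito_defect t n)) \<longlonglongrightarrow> 0"
    by (rule tendsto_expectation_of_dP[OF _ i2 v2 ito_defect_tendsto_0[OF t]]) measurable
  have Li: "integrable M (\<lambda>\<omega>. L (X s \<omega>))" if "s \<ge> 0" for s
    by (rule integrable_const_bound[where B=C]) (use L_bound fX_measurable[OF L_cont that] in auto)
  have \<Phi>i: "integrable M (\<lambda>\<omega>. \<Phi> (X t \<omega>))"
    by (rule integrable_const_bound[where B=C]) (use \<Phi>_bound fX_measurable[OF \<Phi>_cont] t in auto)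
  define f where "f s = expectation (\<lambda>\<omega>. L (X s \<omega>))" for s
  have "expectation (ito_defect t n) = expectation (\<lambda>\<omega>. \<Phi> (X t \<omega>)) - \<Phi> x0 - (\<Sum>i<2^n. (t / 2^n) *\<^sub>R f (real i * (t / 2^n)))" for n
  proof -
    have "expectation (ito_defect t n) = expectation (R n)" unfolding def_eq[abs_def] using Ri mi m0 by simp
    also have "\<dots> = expectation (\<lambda>\<omega>. \<Phi> (X t \<omega>)) - \<Phi> x0 - (\<Sum>i<2^n. (t / 2^n) * f (gp t n i))"
      unfolding R_def[abs_def] f_def using \<Phi>i Li gp_nonneg[of t n] t by (simp add: prob_space)
    finally show ?thesis by (simp add: gp_def)
  qed
  then have "(\<lambda>n. expectation (\<lambda>\<omega>. \<Phi> (X t \<omega>)) - \<Phi> x0 - (\<Sum>i<2^n. (t / 2^n) *\<^sub>R f (real i * (t / 2^n)))) \<longlonglongrightarrow> 0"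
    using lim0 by simp
  moreover have "continuous_on {0..t} f" unfolding f_def[abs_def] by (rule expectation_L_cont)
  from riemann_sum_tendsto[OF t this] have "(\<lambda>n. expectation (\<lambda>\<omega>. \<Phi> (X t \<omega>)) - \<Phi> x0 - (\<Sum>i<2^n. (t / 2^n) *\<^sub>R f (real i * (t / 2^n)))) \<longlonglongrightarrow>
      expectation (\<lambda>\<omega>. \<Phi> (X t \<omega>)) - \<Phi> x0 - integral {0..t} f"
    by (intro tendsto_diff tendsto_const)
  ultimately have "expectation (\<lambda>\<omega>. \<Phi> (X t \<omega>)) - \<Phi> x0 - integral {0..t} f = 0"
    using LIMSEQ_unique by blast
  then show ?thesis unfolding f_def[abs_def] by simp
qed

end

section \<open>A Lyapunov function\<close>

lemma quadratic_lower_bound: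
  fixes lam d k2 :: real
  assumes "lam > 0" "k2 > 0"
  obtains m where "m > 0" "\<And>y. m * (1 + y\<^sup>2) \<le> (lam * y + d)\<^sup>2 + k2"
proof -
  \<comment> \<open>Only a fraction \<open>\<tau> \<le> 1\<close> of the square is used. Removing
    the shift \<open>d\<close> from it loses \<open>\<tau> * d\<^sup>2\<close>, and this choice
    keeps the loss below half of \<open>k2\<close>.\<close>
  define \<tau> where "\<tau> = k2 / (2 * d\<^sup>2 + k2)"
  have den: "2 * d\<^sup>2 + k2 > 0" using assms by (simp add: add_nonneg_pos)
  have \<tau>: "\<tau> > 0" "\<tau> \<le> 1" using assms den by (auto simp: \<tau>_def field_simps)
  have \<tau>d: "\<tau> * d\<^sup>2 \<le> k2 / 2" using assms den by (simp add: \<tau>_def field_simps)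
  define m where "m = min (\<tau> * lam\<^sup>2 / 2) (k2 / 2)"
  have m: "m > 0" using assms \<tau> by (simp add: m_def)
  have "m * (1 + y\<^sup>2) \<le> (lam * y + d)\<^sup>2 + k2" for y
  proof -
    have "(lam * y)\<^sup>2 \<le> 2 * (lam * y + d)\<^sup>2 + 2 * d\<^sup>2"
      using sum_squares_bound[of "lam * y + d" "- d"] by (simp add: power2_eq_square algebra_simps)
    then have "\<tau> * ((lam * y)\<^sup>2 / 2) \<le> \<tau> * ((lam * y + d)\<^sup>2 + d\<^sup>2)" using \<tau> by (intro mult_left_mono) auto
    also have "\<dots> \<le> (lam * y + d)\<^sup>2 + \<tau> * d\<^sup>2"
      using mult_right_mono[OF \<tau>(2), of "(lam * y + d)\<^sup>2"] by (simp add: distrib_left)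
    finally have "\<tau> * ((lam * y)\<^sup>2 / 2) + k2 / 2 \<le> (lam * y + d)\<^sup>2 + k2" using \<tau>d by linarith
    moreover have "m * y\<^sup>2 \<le> (\<tau> * lam\<^sup>2 / 2) * y\<^sup>2" by (intro mult_right_mono) (auto simp: m_def)
    moreover have "m \<le> k2 / 2" by (simp add: m_def)
    ultimately show ?thesis by (simp add: algebra_simps power_mult_distrib)
  qed
  then show thesis using that m by blast
qed

text \<open>The generator inequality for a \<open>\<phi>\<close> with
  \<open>\<phi>' y = y * w y\<close>, cleared of the weight \<open>w\<close> and of the denominator
  \<open>(1 + y\<^sup>2)\<^sup>2\<close>. For large \<open>y\<close> the sign is decided by
  \<open>gap\<close>, near the origin by \<open>k2\<close>; in between the term with
  \<open>N\<close> makes up the deficit.\<close>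

lemma drift_polynomial_bound:
  fixes q \<alpha> c2 lam d k2 :: real
  assumes q: "q > 1" and c2: "c2 > 0" and lam: "lam > 0" and k2: "k2 > 0" and \<alpha>: "\<alpha> \<ge> 0"
    and gap: "\<alpha> < (q - 1) * c2 * lam\<^sup>2 / 2"
  obtains N c where "N \<ge> 0" "c > 0"
    "\<And>y. c * (1 + y\<^sup>2) ^ 3 \<le> c2 / 2 * ((lam * y + d)\<^sup>2 + k2) * ((1 + (q - 1) * y\<^sup>2) * (1 + y\<^sup>2) + N * y\<^sup>2)
      - \<alpha> * y\<^sup>2 * (1 + y\<^sup>2)\<^sup>2"
proof -
  obtain m where m: "m > 0" "\<And>y. m * (1 + y\<^sup>2) \<le> (lam * y + d)\<^sup>2 + k2" using quadratic_lower_bound[OF lam k2] by blast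
  define c1 where "c1 = c2 * m"
  have c1: "c1 > 0" using c2 m by (simp add: c1_def)
  define \<theta> where "\<theta> = (q - 1) * c2 * lam\<^sup>2 / 2 - \<alpha>"
  have \<theta>: "\<theta> > 0" using gap by (simp add: \<theta>_def)
  define e1 where "e1 = (q - 1) * c2 * lam * d"
  define e0 where "e0 = (q - 1) * c2 * (d\<^sup>2 + k2) / 2 - \<alpha>"
  \<comment> \<open>Completing the square: with half of the leading term set aside, the remaining
    quadratic in \<open>y\<close> is at least \<open>- C4\<close>.\<close>
  define C4 where "C4 = e1\<^sup>2 / (2 * \<theta>) + \<bar>e0\<bar>"
  have C4: "C4 \<ge> 0" using \<theta> by (simp add: C4_def)
  \<comment> \<open>Gives \<open>c1 * N / 2 = C4\<close>, so that the \<open>N\<close> term absorbs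
    the deficit \<open>C4 * y\<^sup>2\<close>.\<close>
  define N where "N = 2 * C4 / c1"
  have N: "N \<ge> 0" using C4 c1 by (simp add: N_def)
  define c where "c = min c1 \<theta> / 4"
  have c: "c > 0" using c1 \<theta> by (simp add: c_def)
  have "c * (1 + y\<^sup>2) ^ 3 \<le> c2 / 2 * ((lam * y + d)\<^sup>2 + k2) * ((1 + (q - 1) * y\<^sup>2) * (1 + y\<^sup>2) + N * y\<^sup>2) - \<alpha> * y\<^sup>2 * (1 + y\<^sup>2)\<^sup>2" for y
  proof -
    define P where "P = 1 + y\<^sup>2"
    define a where "a = c2 * ((lam * y + d)\<^sup>2 + k2)"
    have P: "P \<ge> 1" by (simp add: P_def)
    have a: "c1 * P \<le> a" using m(2)[of y] c2 by (simp add: a_def c1_def P_def mult.assoc)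
    have e: "\<theta> * y\<^sup>2 / 2 + e1 * y + e0 \<ge> - C4"
    proof -
      have "0 \<le> (\<theta> * y + e1)\<^sup>2 / (2 * \<theta>)" using \<theta> by simp
      also have "\<dots> = \<theta> * y\<^sup>2 / 2 + e1 * y + e1\<^sup>2 / (2 * \<theta>)" using \<theta> by (simp add: power2_eq_square field_simps)
      finally show ?thesis unfolding C4_def by linarith
    qed
    have id: "(q - 1) * a * y\<^sup>2 / 2 - \<alpha> * y\<^sup>2 * P = y\<^sup>2 * (\<theta> * y\<^sup>2 + e1 * y + e0)"
      unfolding a_def P_def \<theta>_def e1_def e0_def by (simp add: power2_eq_square field_simps)
    have "y\<^sup>2 * (\<theta> * y\<^sup>2 / 2 - C4) \<le> y\<^sup>2 * (\<theta> * y\<^sup>2 + e1 * y + e0)" using e by (intro mult_left_mono) auto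
    then have k1: "\<theta> * (y\<^sup>2)\<^sup>2 / 2 - C4 * y\<^sup>2 \<le> (q - 1) * a * y\<^sup>2 / 2 - \<alpha> * y\<^sup>2 * P"
      unfolding id by (simp add: algebra_simps power2_eq_square)
    have "C4 * y\<^sup>2 * P = c1 * P * N * y\<^sup>2 / 2" using c1 by (simp add: N_def)
    also have "\<dots> \<le> a * N * y\<^sup>2 / 2" using a N by (intro divide_right_mono mult_right_mono) auto
    finally have k2': "C4 * y\<^sup>2 * P \<le> a * N * y\<^sup>2 / 2" .
    have "P\<^sup>2 \<le> 2 + 2 * (y\<^sup>2)\<^sup>2"
      using sum_squares_bound[of 1 "y\<^sup>2"] by (simp add: P_def power2_sum)
    then have "c * P\<^sup>2 \<le> c * (2 + 2 * (y\<^sup>2)\<^sup>2)" using c by (intro mult_left_mono) auto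
    also have "\<dots> = 2 * c * 1 + 2 * c * (y\<^sup>2)\<^sup>2" by (simp add: algebra_simps)
    also have "\<dots> \<le> c1 / 2 * P + \<theta> / 2 * (y\<^sup>2)\<^sup>2"
      using P c1 \<theta> by (intro add_mono mult_mono) (auto simp: c_def)
    finally have k3: "c * P\<^sup>2 \<le> c1 * P / 2 + \<theta> * (y\<^sup>2)\<^sup>2 / 2" by simp
    have "c * P ^ 3 = P * (c * P\<^sup>2)" by (simp add: power3_eq_cube power2_eq_square)
    also have "\<dots> \<le> P * (c1 * P / 2 + \<theta> * (y\<^sup>2)\<^sup>2 / 2)" using k3 P by (intro mult_left_mono) auto
    also have "\<dots> \<le> P * (a / 2 + \<theta> * (y\<^sup>2)\<^sup>2 / 2)" using a P by (intro mult_left_mono) auto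
    also have "\<dots> \<le> P * (a / 2 + ((q - 1) * a * y\<^sup>2 / 2 - \<alpha> * y\<^sup>2 * P + C4 * y\<^sup>2))" using k1 P by (intro mult_left_mono) auto
    also have "\<dots> = P * (a / 2 + (q - 1) * a * y\<^sup>2 / 2) - \<alpha> * y\<^sup>2 * P\<^sup>2 + C4 * y\<^sup>2 * P"
      by (simp add: algebra_simps power2_eq_square)
    also have "\<dots> \<le> P * (a / 2 + (q - 1) * a * y\<^sup>2 / 2) - \<alpha> * y\<^sup>2 * P\<^sup>2 + a * N * y\<^sup>2 / 2" using k2' by linarith
    also have "\<dots> = a / 2 * ((1 + (q - 1) * y\<^sup>2) * P + N * y\<^sup>2) - \<alpha> * y\<^sup>2 * P\<^sup>2" by (simp add: field_simps)
    finally show ?thesis unfolding a_def P_def by simp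
  qed
  then show thesis using that N c by blast
qed

text \<open>Here \<open>\<phi>' y = y (1 + y\<^sup>2) powr ((q - 2) / 2) exp (- N / (2 (1 + y\<^sup>2)))\<close>. The power gives the growth \<open>q\<close>;
  the exponential factor makes \<open>\<phi>\<close> convex enough on the bounded range where the power alone would not beat
  the drift.\<close>

lemma convex_test_function:
  fixes q \<alpha> c2 lam d k2 :: real
  assumes q: "q > 1" and c2: "c2 > 0" and lam: "lam > 0" and k2: "k2 > 0" and \<alpha>: "\<alpha> \<ge> 0"
    and gap: "\<alpha> < (q - 1) * c2 * lam\<^sup>2 / 2"
  obtains \<phi> \<phi>1 \<phi>2 :: "real \<Rightarrow> real" and \<epsilon> K where "\<epsilon> > 0" "K > 0"
    "\<And>y. (\<phi> has_real_derivative \<phi>1 y) (at y)" "\<And>y. (\<phi>1 has_real_derivative \<phi>2 y) (at y)" "continuous_on UNIV \<phi>2"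
    "\<And>y. 0 \<le> \<phi>2 y" "\<And>y. \<bar>\<phi> y\<bar> \<le> K * (1 + y\<^sup>2) powr (q / 2)" "\<And>y. \<bar>\<phi>1 y\<bar> \<le> K * (1 + y\<^sup>2) powr ((q - 1) / 2)"
    "\<And>y. \<bar>\<phi>2 y\<bar> \<le> K * (1 + y\<^sup>2) powr (q / 2)"
    "\<And>y. \<epsilon> \<le> c2 / 2 * ((lam * y + d)\<^sup>2 + k2) * \<phi>2 y - \<alpha> * y * \<phi>1 y"
proof -
  obtain N c where N: "N \<ge> 0" and c: "c > 0" and poly:
    "\<And>y. c * (1 + y\<^sup>2) ^ 3 \<le> c2 / 2 * ((lam * y + d)\<^sup>2 + k2) * ((1 + (q - 1) * y\<^sup>2) * (1 + y\<^sup>2) + N * y\<^sup>2) - \<alpha> * y\<^sup>2 * (1 + y\<^sup>2)\<^sup>2"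
    using drift_polynomial_bound[OF assms] by blast
  define s where "s = (q - 2) / 2"
  have qs: "q / 2 = s + 1" by (simp add: s_def field_simps)
  define f where "f \<rho> = \<rho> powr s * exp (- N / (2 * \<rho>))" for \<rho> :: real
  define w where "w y = f (1 + y\<^sup>2)" for y
  \<comment> \<open>The argument \<open>1 + y\<^sup>2\<close> never falls below 1. Starting the
    integral at 1/2 keeps 1 an interior point, so that the integral is differentiable there too,
    which is the case \<open>y = 0\<close>.\<close>
  define \<phi> where "\<phi> y = integral {1/2..1 + y\<^sup>2} f / 2" for y
  define \<phi>1 where "\<phi>1 y = y * w y" for y
  define \<phi>2 where "\<phi>2 y = w y * ((1 + (q - 1) * y\<^sup>2) * (1 + y\<^sup>2) + N * y\<^sup>2) / (1 + y\<^sup>2)\<^sup>2" for y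
  have P: "1 + y\<^sup>2 \<ge> 1" "1 + y\<^sup>2 > 0" "1 + y\<^sup>2 \<noteq> 0" for y :: real
    by (auto simp: add_pos_nonneg power2_eq_square add_nonneg_eq_0_iff)
  have fc: "continuous_on {1/2..b} f" for b
    unfolding f_def[abs_def] by (intro continuous_intros) auto
  have f0: "0 \<le> f \<rho>" for \<rho> by (simp add: f_def)
  have fle: "f \<rho> \<le> \<rho> powr s" if "\<rho> > 0" for \<rho>
  proof -
    have "- N / (2 * \<rho>) \<le> 0" using N that by simp
    then have "exp (- N / (2 * \<rho>)) \<le> 1" by simp
    then show ?thesis unfolding f_def by (simp add: mult_left_le)
  qed
  have Fd: "((\<lambda>\<rho>. integral {1/2..\<rho>} f) has_real_derivative f \<rho>) (at \<rho>)" if "\<rho> \<ge> 1" for \<rho>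
  proof -
    have "((\<lambda>\<rho>. integral {1/2..\<rho>} f) has_real_derivative f \<rho>) (at \<rho> within {1/2..\<rho> + 1})"
      using that by (intro integral_has_real_derivative fc) auto
    then show ?thesis using that by (simp add: at_within_Icc_at)
  qed
  have d0: "(\<phi> has_real_derivative \<phi>1 y) (at y)" for y
  proof -
    have "((\<lambda>y. integral {1/2..1 + y\<^sup>2} f) has_real_derivative f (1 + y\<^sup>2) * (2 * y)) (at y)"
      by (rule DERIV_chain2[OF Fd]) (auto intro!: derivative_eq_intros)
    from DERIV_cdivide[OF this, of 2] show ?thesis unfolding \<phi>_def[abs_def] \<phi>1_def w_def by (simp add: mult.commute)
  qed
  have wd: "(w has_real_derivative w y * (2 * s * y / (1 + y\<^sup>2) + N * y / (1 + y\<^sup>2)\<^sup>2)) (at y)" for y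
  proof -
    have a: "((\<lambda>y. (1 + y\<^sup>2) powr s) has_real_derivative (1 + y\<^sup>2) powr s * (2 * s * y / (1 + y\<^sup>2))) (at y)"
    proof -
      have "((\<lambda>y. (1 + y\<^sup>2) powr s) has_real_derivative s * (1 + y\<^sup>2) powr (s - 1) * (2 * y)) (at y)"
        using P(2)[of y] by (auto intro!: derivative_eq_intros)
      moreover have "(1 + y\<^sup>2) powr (s - 1) = (1 + y\<^sup>2) powr s / (1 + y\<^sup>2)" using P[of y] by (simp add: powr_diff)
      ultimately show ?thesis by (simp add: mult_ac)
    qed
    have b: "((\<lambda>y. exp (- N / (2 * (1 + y\<^sup>2)))) has_real_derivative exp (- N / (2 * (1 + y\<^sup>2))) * (N * y / (1 + y\<^sup>2)\<^sup>2)) (at y)"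
    proof -
      have "((\<lambda>y. - N / (2 * (1 + y\<^sup>2))) has_real_derivative N * y / (1 + y\<^sup>2)\<^sup>2) (at y)"
        using P(3)[of y] by (auto intro!: derivative_eq_intros simp: power2_eq_square divide_simps) (simp add: algebra_simps)
      from DERIV_chain2[OF DERIV_exp this] show ?thesis .
    qed
    show ?thesis unfolding w_def[abs_def] f_def
      using DERIV_mult[OF a b] by (simp add: algebra_simps)
  qed
  have d1: "(\<phi>1 has_real_derivative \<phi>2 y) (at y)" for y
  proof -
    have "(\<phi>1 has_real_derivative 1 * w y + w y * (2 * s * y / (1 + y\<^sup>2) + N * y / (1 + y\<^sup>2)\<^sup>2) * y) (at y)"
      unfolding \<phi>1_def[abs_def] by (rule DERIV_mult[OF DERIV_ident wd])
    moreover have "1 * w y + w y * (2 * s * y / (1 + y\<^sup>2) + N * y / (1 + y\<^sup>2)\<^sup>2) * y = \<phi>2 y"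
    proof -
      define Q where "Q = 1 + y\<^sup>2"
      have Q: "Q \<noteq> 0" using P(3)[of y] by (simp add: Q_def)
      have y2: "y * y = Q - 1" by (simp add: Q_def power2_eq_square)
      have "1 * w y + w y * (2 * s * y / Q + N * y / Q\<^sup>2) * y = w y * (1 + 2 * s * (y * y) / Q + N * (y * y) / Q\<^sup>2)"
        by (simp add: algebra_simps)
      also have "\<dots> = w y * ((Q + 2 * s * (Q - 1)) * Q + N * (Q - 1)) / Q\<^sup>2"
        unfolding y2 using Q by (simp add: field_simps power2_eq_square)
      also have "Q + 2 * s * (Q - 1) = 1 + (q - 1) * (Q - 1)" by (simp add: s_def field_simps)
      finally show ?thesis unfolding \<phi>2_def Q_def by simp
    qed
    ultimately show ?thesis by simp
  qed
  have w0: "0 \<le> w y" for y by (simp add: w_def f0)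
  have wle: "w y \<le> (1 + y\<^sup>2) powr s" for y unfolding w_def by (rule fle) (rule P)
  have "continuous_on UNIV w" using wd DERIV_isCont continuous_at_imp_continuous_on by blast
  then have c\<phi>2: "continuous_on UNIV \<phi>2"
    unfolding \<phi>2_def[abs_def] by (intro continuous_intros) (use P(3) in auto)
  have \<phi>20: "0 \<le> \<phi>2 y" for y
    unfolding \<phi>2_def using w0 q N P(2)[of y] by (intro divide_nonneg_nonneg mult_nonneg_nonneg add_nonneg_nonneg) auto
  have s1: "s + 1 > 0" using q qs by linarith
  have b\<phi>: "\<bar>\<phi> y\<bar> \<le> (1 + y\<^sup>2) powr (q / 2) / (s + 1)" for y
  proof -
    have hi: "((\<lambda>\<rho>. \<rho> powr s) has_integral ((1 + y\<^sup>2) powr (s + 1) / (s + 1) - (1/2) powr (s + 1) / (s + 1))) {1/2..1 + y\<^sup>2}"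
    proof (rule fundamental_theorem_of_calculus)
      fix \<rho> :: real assume "\<rho> \<in> {1/2..1 + y\<^sup>2}"
      then have "\<rho> > 0" by auto
      then have "((\<lambda>\<rho>. \<rho> powr (s + 1) / (s + 1)) has_real_derivative \<rho> powr s) (at \<rho>)"
        using s1 by (auto intro!: derivative_eq_intros)
      then show "((\<lambda>\<rho>. \<rho> powr (s + 1) / (s + 1)) has_vector_derivative \<rho> powr s) (at \<rho> within {1/2..1 + y\<^sup>2})"
        by (rule has_vector_derivative_at_within[OF iffD1[OF has_real_derivative_iff_has_vector_derivative]])
    qed (use P(1)[of y] in linarith)
    have "integral {1/2..1 + y\<^sup>2} f \<le> (1 + y\<^sup>2) powr (s + 1) / (s + 1) - (1/2) powr (s + 1) / (s + 1)"
      by (rule has_integral_le[OF integrable_integral[OF integrable_continuous_real[OF fc]] hi]) (auto intro!: fle)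
    also have "\<dots> \<le> (1 + y\<^sup>2) powr (s + 1) / (s + 1)" using s1 by simp
    finally have "integral {1/2..1 + y\<^sup>2} f \<le> (1 + y\<^sup>2) powr (q / 2) / (s + 1)" by (simp add: qs)
    moreover have "0 \<le> integral {1/2..1 + y\<^sup>2} f" by (intro integral_nonneg integrable_continuous_real fc f0)
    ultimately show ?thesis unfolding \<phi>_def by linarith
  qed
  have b\<phi>1: "\<bar>\<phi>1 y\<bar> \<le> (1 + y\<^sup>2) powr ((q - 1) / 2)" for y
  proof -
    have "\<bar>y\<bar> \<le> sqrt (1 + y\<^sup>2)" by (rule real_le_rsqrt) simp
    then have "\<bar>y\<bar> * w y \<le> (1 + y\<^sup>2) powr (1/2) * (1 + y\<^sup>2) powr s"
      using P(2)[of y] w0 wle by (intro mult_mono) (auto simp: powr_half_sqrt)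
    also have "\<dots> = (1 + y\<^sup>2) powr ((q - 1) / 2)"
      unfolding powr_add[symmetric] by (rule arg_cong[of _ _ "\<lambda>z. (1 + y\<^sup>2) powr z"]) (simp add: s_def field_simps)
    finally show ?thesis using w0[of y] by (simp add: \<phi>1_def abs_mult)
  qed
  have b\<phi>2: "\<bar>\<phi>2 y\<bar> \<le> (q + N) * (1 + y\<^sup>2) powr (q / 2)" for y
  proof -
    define Q where "Q = 1 + y\<^sup>2"
    have Q: "Q \<ge> 1" using P(1)[of y] by (simp add: Q_def)
    have "(1 + (q - 1) * y\<^sup>2) * Q + N * y\<^sup>2 \<le> (q * Q) * Q + N * Q\<^sup>2"
    proof (intro add_mono mult_right_mono mult_left_mono)
      have "q * Q - (1 + (q - 1) * y\<^sup>2) = (q - 1) + y\<^sup>2" by (simp add: Q_def algebra_simps)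
      then show "1 + (q - 1) * y\<^sup>2 \<le> q * Q" using q zero_le_power2[of y] by linarith
      have "y\<^sup>2 \<le> Q" by (simp add: Q_def)
      also have "Q \<le> Q\<^sup>2" using Q by (simp add: power2_eq_square)
      finally show "y\<^sup>2 \<le> Q\<^sup>2" .
    qed (use Q N in auto)
    also have "\<dots> = (q + N) * Q\<^sup>2" by (simp add: power2_eq_square algebra_simps)
    finally have "((1 + (q - 1) * y\<^sup>2) * Q + N * y\<^sup>2) / Q\<^sup>2 \<le> q + N" using Q by (simp add: divide_le_eq)
    then have "w y * (((1 + (q - 1) * y\<^sup>2) * Q + N * y\<^sup>2) / Q\<^sup>2) \<le> Q powr s * (q + N)"
      using w0 wle[of y] q N Q by (intro mult_mono) (auto simp: Q_def)
    also have "Q powr s \<le> Q powr (q / 2)" using Q by (intro powr_mono) (auto simp: qs)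
    finally have "\<phi>2 y \<le> Q powr (q / 2) * (q + N)" unfolding \<phi>2_def Q_def using q N by (simp add: mult_right_mono)
    then show ?thesis using \<phi>20[of y] unfolding Q_def by (simp add: mult.commute)
  qed
  \<comment> \<open>The polynomial inequality is multiplied by \<open>w y / Q\<^sup>2\<close>. Its
    left side becomes \<open>c * (w y * Q)\<close>, which is at least
    \<open>c * exp (- N / 2)\<close> because \<open>Q \<ge> 1\<close> and \<open>s + 1 > 0\<close>;
    this is the uniform \<open>\<epsilon>\<close>.\<close>
  have low: "c * exp (- N / 2) \<le> c2 / 2 * ((lam * y + d)\<^sup>2 + k2) * \<phi>2 y - \<alpha> * y * \<phi>1 y" for y
  proof -
    define Q where "Q = 1 + y\<^sup>2"
    have Q: "Q \<ge> 1" using P(1)[of y] by (simp add: Q_def)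
    define A where "A = c2 / 2 * ((lam * y + d)\<^sup>2 + k2)"
    define Bq where "Bq = (1 + (q - 1) * y\<^sup>2) * Q + N * y\<^sup>2"
    have "c * Q ^ 3 \<le> A * Bq - \<alpha> * y\<^sup>2 * Q\<^sup>2" using poly[of y] by (simp add: Q_def A_def Bq_def)
    then have "w y / Q\<^sup>2 * (c * Q ^ 3) \<le> w y / Q\<^sup>2 * (A * Bq - \<alpha> * y\<^sup>2 * Q\<^sup>2)" using w0 by (intro mult_left_mono) auto
    also have "\<dots> = A * \<phi>2 y - \<alpha> * y * \<phi>1 y"
      unfolding \<phi>2_def \<phi>1_def Bq_def Q_def[symmetric] using Q by (simp add: right_diff_distrib power2_eq_square)
    also have "w y / Q\<^sup>2 * (c * Q ^ 3) = c * (w y * Q)" using Q by (simp add: power2_eq_square power3_eq_cube)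
    finally have "c * (w y * Q) \<le> A * \<phi>2 y - \<alpha> * y * \<phi>1 y" .
    moreover have "exp (- N / 2) \<le> w y * Q"
    proof -
      have "N / (2 * Q) \<le> N / 2" using N Q by (intro divide_left_mono) auto
      then have "exp (- N / 2) \<le> exp (- N / (2 * Q))" by simp
      also have "\<dots> \<le> Q powr (s + 1) * exp (- N / (2 * Q))" using ge_one_powr_ge_zero[OF Q, of "s + 1"] s1 by simp
      also have "\<dots> = w y * Q" using Q by (simp add: w_def f_def Q_def[symmetric] powr_add)
      finally show ?thesis .
    qed
    ultimately show ?thesis using c unfolding A_def by (meson mult_left_mono less_imp_le order_trans)
  qed
  define K where "K = 1 / (s + 1) + 1 + (q + N)"
  have K: "K > 0" "1 / (s + 1) \<le> K" "1 \<le> K" "q + N \<le> K" proof -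
    have "0 < 1 / (s + 1)" using s1 by simp
    then show "K > 0" "1 / (s + 1) \<le> K" "1 \<le> K" "q + N \<le> K" using q N unfolding K_def by linarith+
  qed
  show thesis
  proof (rule that[of "c * exp (- N / 2)" K \<phi> \<phi>1 \<phi>2])
    show "\<bar>\<phi> y\<bar> \<le> K * (1 + y\<^sup>2) powr (q / 2)" for y
      using b\<phi>[of y] mult_right_mono[OF K(2), of "(1 + y\<^sup>2) powr (q / 2)"] by simp
    show "\<bar>\<phi>1 y\<bar> \<le> K * (1 + y\<^sup>2) powr ((q - 1) / 2)" for y
      using b\<phi>1[of y] mult_right_mono[OF K(3), of "(1 + y\<^sup>2) powr ((q - 1) / 2)"] by simp
    show "\<bar>\<phi>2 y\<bar> \<le> K * (1 + y\<^sup>2) powr (q / 2)" for y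
      using b\<phi>2[of y] mult_right_mono[OF K(4), of "(1 + y\<^sup>2) powr (q / 2)"] by simp
  qed (use c K d0 d1 c\<phi>2 \<phi>20 low in auto)
qed

section \<open>The test function times a rational cutoff\<close>

lemma sum_outer_product_form:
  fixes a b u :: "real^'d" and Q :: "real^'d^'d"
  shows "(\<Sum>k\<in>UNIV. \<Sum>l\<in>UNIV. a $ k * b $ l * Q $ k $ l) = a \<bullet> (Q *v b)"
  by (simp add: inner_vec_def matrix_vector_mult_def sum_distrib_left mult_ac)

lemma sum_outer_product_square:
  fixes a b u :: "real^'d"
  shows "(\<Sum>k\<in>UNIV. \<Sum>l\<in>UNIV. a $ k * b $ l * (u $ k * u $ l)) = (a \<bullet> u) * (b \<bullet> u)"
  by (simp add: inner_vec_def sum_product mult_ac)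

text \<open>The cutoff is rational rather than compactly supported: the derivatives of
  \<open>chi\<close> are \<open>chi\<close> times explicit expressions in \<open>psi\<close> and
  \<open>x\<close>, so they can be compared with \<open>chi\<close> itself. \<open>\<kappa>\<close>
  is the squared radius and \<open>m\<close> the order of decay in
  \<open>x \<bullet> x\<close>.\<close>

locale cutoff_product =
  fixes \<phi> \<phi>1 \<phi>2 :: "real \<Rightarrow> real" and v :: "real^'d" and y0 \<kappa> :: real and m :: nat
  assumes d\<phi>: "\<And>y. (\<phi> has_real_derivative \<phi>1 y) (at y)" and d\<phi>1: "\<And>y. (\<phi>1 has_real_derivative \<phi>2 y) (at y)"
    and c\<phi>2: "continuous_on UNIV \<phi>2" and \<kappa>: "\<kappa> \<ge> 1" and nv: "norm v = 1"
begin

definition ell :: "real^'d \<Rightarrow> real" where "ell x = v \<bullet> x - y0"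

definition psi :: "real^'d \<Rightarrow> real" where "psi x = 1 / (\<kappa> + x \<bullet> x)"

definition chi :: "real^'d \<Rightarrow> real" where "chi x = (\<kappa> * psi x) ^ m"

definition PhiF :: "real^'d \<Rightarrow> real" where "PhiF x = \<phi> (ell x) * chi x"

definition gradF :: "real^'d \<Rightarrow> real^'d" where
  "gradF x = (\<phi>1 (ell x) * chi x) *\<^sub>R v - (2 * real m * \<phi> (ell x) * chi x * psi x) *\<^sub>R x"

text \<open>The mixed term is left unsymmetrised: one product with coefficient 4 stands for two with
  coefficient 2. This alters neither the quadratic form nor the contraction with a symmetric
  matrix.\<close>

definition hessF :: "'d \<Rightarrow> 'd \<Rightarrow> real^'d \<Rightarrow> real" where
  "hessF k l x = \<phi>2 (ell x) * chi x * (v $ k * v $ l) - 4 * real m * \<phi>1 (ell x) * chi x * psi x * (v $ k * x $ l)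
     + 4 * real m * (real m + 1) * \<phi> (ell x) * chi x * (psi x)\<^sup>2 * (x $ k * x $ l)
     - 2 * real m * \<phi> (ell x) * chi x * psi x * (if k = l then 1 else 0)"

lemma den_pos: "\<kappa> + x \<bullet> x > 0" for x :: "real^'d"
  using \<kappa> inner_ge_zero[of x] by linarith

lemma psi_pos: "0 < psi x" and psi_le: "psi x * (1 + x \<bullet> x) \<le> 1" and psi_le1: "psi x \<le> 1" and psi_kappa: "\<kappa> * psi x \<le> 1"
proof -
  show "0 < psi x" using den_pos[of x] by (simp add: psi_def)
  show "psi x * (1 + x \<bullet> x) \<le> 1" using den_pos[of x] \<kappa> by (simp add: psi_def)
  have "1 \<le> \<kappa> + x \<bullet> x" using \<kappa> inner_ge_zero[of x] by linarith
  then show "psi x \<le> 1" by (simp add: psi_def)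
  show "\<kappa> * psi x \<le> 1" using den_pos[of x] by (simp add: psi_def)
qed

lemma chi_pos: "0 < chi x" and chi_le1: "chi x \<le> 1"
  using psi_pos[of x] psi_kappa[of x] \<kappa> by (auto simp: chi_def intro!: power_le_one)

text \<open>Bernoulli's inequality for
  \<open>\<kappa> * psi x = 1 - psi x * (x \<bullet> x)\<close>. The weaker form with
  \<open>1 + x \<bullet> x\<close> matches the shape of the error terms in
  \<open>gen_op_lower\<close>.\<close>

lemma chi_lower: "1 - real m * (psi x * (1 + x \<bullet> x)) \<le> chi x"
proof -
  have e: "\<kappa> * psi x = 1 + - (psi x * (x \<bullet> x))" using den_pos[of x] by (simp add: psi_def field_simps)
  have "psi x * (x \<bullet> x) \<le> 1" using psi_le[of x] psi_pos[of x] by (simp add: distrib_left)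
  then have "1 + real m * - (psi x * (x \<bullet> x)) \<le> chi x"
    unfolding chi_def e by (intro Bernoulli_inequality) auto
  moreover have "real m * (psi x * (x \<bullet> x)) \<le> real m * (psi x * (1 + x \<bullet> x))"
    using psi_pos[of x] by (intro mult_left_mono) auto
  ultimately show ?thesis by linarith
qed

lemma ell_deriv: "((\<lambda>s. ell (x + s *\<^sub>R u)) has_real_derivative v \<bullet> u) (at s)"
  unfolding ell_def inner_add_right inner_scaleR_right by (auto intro!: derivative_eq_intros)

lemma inner_deriv: "((\<lambda>s. (x + s *\<^sub>R u) \<bullet> u) has_real_derivative u \<bullet> u) (at s)"
  unfolding inner_add_left inner_scaleR_left by (auto intro!: derivative_eq_intros)

lemma norm_sq_deriv: "((\<lambda>s. (x + s *\<^sub>R u) \<bullet> (x + s *\<^sub>R u)) has_real_derivative 2 * ((x + s *\<^sub>R u) \<bullet> u)) (at s)"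
  unfolding inner_add_left inner_add_right inner_scaleR_left inner_scaleR_right
  by (auto intro!: derivative_eq_intros simp: inner_commute algebra_simps)

lemma psi_deriv: "((\<lambda>s. psi (x + s *\<^sub>R u)) has_real_derivative - 2 * (psi (x + s *\<^sub>R u))\<^sup>2 * ((x + s *\<^sub>R u) \<bullet> u)) (at s)"
proof -
  have "((\<lambda>s. \<kappa> + (x + s *\<^sub>R u) \<bullet> (x + s *\<^sub>R u)) has_real_derivative 2 * ((x + s *\<^sub>R u) \<bullet> u)) (at s)"
    by (rule DERIV_cong[OF DERIV_add[OF DERIV_const norm_sq_deriv]]) simp
  from DERIV_inverse'[OF this] den_pos[of "x + s *\<^sub>R u"] show ?thesis
    unfolding psi_def by (simp add: inverse_eq_divide power2_eq_square algebra_simps)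
qed

lemma chi_deriv: "((\<lambda>s. chi (x + s *\<^sub>R u)) has_real_derivative - 2 * real m * chi (x + s *\<^sub>R u) * psi (x + s *\<^sub>R u) * ((x + s *\<^sub>R u) \<bullet> u)) (at s)"
proof -
  define z where "z = x + s *\<^sub>R u"
  have "((\<lambda>s. \<kappa> * psi (x + s *\<^sub>R u)) has_real_derivative \<kappa> * (- 2 * (psi z)\<^sup>2 * (z \<bullet> u))) (at s)"
    unfolding z_def by (rule DERIV_cmult[OF psi_deriv])
  from DERIV_power[OF this, of m]
  have a: "((\<lambda>s. chi (x + s *\<^sub>R u)) has_real_derivative real m * (\<kappa> * (- 2 * (psi z)\<^sup>2 * (z \<bullet> u)) * (\<kappa> * psi z) ^ (m - Suc 0))) (at s)"
    unfolding chi_def z_def by simp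
  have b: "real m * (\<kappa> * (- 2 * (psi z)\<^sup>2 * (z \<bullet> u)) * (\<kappa> * psi z) ^ (m - Suc 0)) = - 2 * real m * chi z * psi z * (z \<bullet> u)"
  \<comment> \<open>The exponent \<open>m - Suc 0\<close> is truncated at \<open>m = 0\<close>,
    where both sides vanish because of the factor \<open>real m\<close>.\<close>
  proof (cases "m = 0")
    case False
    then have pw: "chi z = \<kappa> * psi z * (\<kappa> * psi z) ^ (m - Suc 0)" unfolding chi_def by (simp add: power_eq_if)
    show ?thesis unfolding pw by (simp add: power2_eq_square algebra_simps)
  qed simp
  show ?thesis using DERIV_cong[OF a b] unfolding z_def .
qed

lemma PhiF_deriv: "((\<lambda>s. PhiF (x + s *\<^sub>R u)) has_real_derivative gradF (x + s *\<^sub>R u) \<bullet> u) (at s)"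
proof -
  have "((\<lambda>s. PhiF (x + s *\<^sub>R u)) has_real_derivative
      \<phi>1 (ell (x + s *\<^sub>R u)) * (v \<bullet> u) * chi (x + s *\<^sub>R u) +
      - 2 * real m * chi (x + s *\<^sub>R u) * psi (x + s *\<^sub>R u) * ((x + s *\<^sub>R u) \<bullet> u) * \<phi> (ell (x + s *\<^sub>R u))) (at s)"
    unfolding PhiF_def by (rule DERIV_mult[OF DERIV_chain2[OF d\<phi> ell_deriv] chi_deriv])
  then show ?thesis unfolding gradF_def inner_diff_left inner_scaleR_left by (simp add: algebra_simps)
qed

text \<open>\<open>Q\<close> is arbitrary because the formula serves twice: with the products
  \<open>u $ k * u $ l\<close> for derivatives along a line, and with the diffusion matrix in the
  generator.\<close>

lemma hessF_form:
  "(\<Sum>k\<in>UNIV. \<Sum>l\<in>UNIV. hessF k l x * Q k l) =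
    \<phi>2 (ell x) * chi x * (\<Sum>k\<in>UNIV. \<Sum>l\<in>UNIV. v $ k * v $ l * Q k l)
    - 4 * real m * \<phi>1 (ell x) * chi x * psi x * (\<Sum>k\<in>UNIV. \<Sum>l\<in>UNIV. v $ k * x $ l * Q k l)
    + 4 * real m * (real m + 1) * \<phi> (ell x) * chi x * (psi x)\<^sup>2 * (\<Sum>k\<in>UNIV. \<Sum>l\<in>UNIV. x $ k * x $ l * Q k l)
    - 2 * real m * \<phi> (ell x) * chi x * psi x * (\<Sum>k\<in>UNIV. Q k k)"
proof -
  have diag: "(\<Sum>k\<in>UNIV. Q k k) = (\<Sum>k\<in>UNIV. \<Sum>l\<in>UNIV. (if k = l then 1 else 0) * Q k l)"
    by (simp add: if_distrib[of "\<lambda>c. c * _"] cong: if_cong)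
  show ?thesis unfolding hessF_def diag
    by (simp only: left_diff_distrib distrib_right sum.distrib sum_subtractf sum_distrib_left mult.assoc)
qed

lemma gradF_deriv: "((\<lambda>s. gradF (x + s *\<^sub>R u) \<bullet> u) has_real_derivative
    (\<Sum>k\<in>UNIV. \<Sum>l\<in>UNIV. hessF k l (x + s *\<^sub>R u) * u $ k * u $ l)) (at s)"
proof -
  define z where "z = x + s *\<^sub>R u"
  have eq: "gradF y \<bullet> u = \<phi>1 (ell y) * chi y * (v \<bullet> u) - 2 * real m * (\<phi> (ell y) * chi y * (psi y * (y \<bullet> u)))" for y
    unfolding gradF_def inner_diff_left inner_scaleR_left by simp
  have a: "((\<lambda>s. \<phi>1 (ell (x + s *\<^sub>R u)) * chi (x + s *\<^sub>R u)) has_real_derivative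
      \<phi>2 (ell z) * (v \<bullet> u) * chi z + - 2 * real m * chi z * psi z * (z \<bullet> u) * \<phi>1 (ell z)) (at s)"
    unfolding z_def by (rule DERIV_mult[OF DERIV_chain2[OF d\<phi>1 ell_deriv] chi_deriv])
  have b: "((\<lambda>s. \<phi> (ell (x + s *\<^sub>R u)) * chi (x + s *\<^sub>R u)) has_real_derivative
      \<phi>1 (ell z) * (v \<bullet> u) * chi z + - 2 * real m * chi z * psi z * (z \<bullet> u) * \<phi> (ell z)) (at s)"
    unfolding z_def by (rule DERIV_mult[OF DERIV_chain2[OF d\<phi> ell_deriv] chi_deriv])
  have c: "((\<lambda>s. psi (x + s *\<^sub>R u) * ((x + s *\<^sub>R u) \<bullet> u)) has_real_derivative
      - 2 * (psi z)\<^sup>2 * (z \<bullet> u) * (z \<bullet> u) + u \<bullet> u * psi z) (at s)"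
    unfolding z_def by (rule DERIV_mult[OF psi_deriv inner_deriv])
  have "((\<lambda>s. gradF (x + s *\<^sub>R u) \<bullet> u) has_real_derivative
      (\<phi>2 (ell z) * (v \<bullet> u) * chi z + - 2 * real m * chi z * psi z * (z \<bullet> u) * \<phi>1 (ell z)) * (v \<bullet> u)
      - 2 * real m * ((\<phi>1 (ell z) * (v \<bullet> u) * chi z + - 2 * real m * chi z * psi z * (z \<bullet> u) * \<phi> (ell z)) * (psi z * (z \<bullet> u))
         + (- 2 * (psi z)\<^sup>2 * (z \<bullet> u) * (z \<bullet> u) + u \<bullet> u * psi z) * (\<phi> (ell z) * chi z))) (at s)"
    unfolding eq using DERIV_diff[OF DERIV_cmult_right[OF a, of "v \<bullet> u"] DERIV_cmult[OF DERIV_mult[OF b c], of "2 * real m"]]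
    unfolding z_def by simp
  moreover have "(\<Sum>k\<in>UNIV. \<Sum>l\<in>UNIV. hessF k l z * u $ k * u $ l) =
      (\<phi>2 (ell z) * (v \<bullet> u) * chi z + - 2 * real m * chi z * psi z * (z \<bullet> u) * \<phi>1 (ell z)) * (v \<bullet> u)
      - 2 * real m * ((\<phi>1 (ell z) * (v \<bullet> u) * chi z + - 2 * real m * chi z * psi z * (z \<bullet> u) * \<phi> (ell z)) * (psi z * (z \<bullet> u))
         + (- 2 * (psi z)\<^sup>2 * (z \<bullet> u) * (z \<bullet> u) + u \<bullet> u * psi z) * (\<phi> (ell z) * chi z))"
  proof -
    have "(\<Sum>k\<in>UNIV. \<Sum>l\<in>UNIV. hessF k l z * u $ k * u $ l) = (\<Sum>k\<in>UNIV. \<Sum>l\<in>UNIV. hessF k l z * (u $ k * u $ l))"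
      by (simp only: mult.assoc)
    also have "\<dots> = \<phi>2 (ell z) * chi z * ((v \<bullet> u) * (v \<bullet> u)) - 4 * real m * \<phi>1 (ell z) * chi z * psi z * ((v \<bullet> u) * (z \<bullet> u))
        + 4 * real m * (real m + 1) * \<phi> (ell z) * chi z * (psi z)\<^sup>2 * ((z \<bullet> u) * (z \<bullet> u))
        - 2 * real m * \<phi> (ell z) * chi z * psi z * (u \<bullet> u)"
      unfolding hessF_form sum_outer_product_square by (simp add: inner_vec_def)
    also have "\<dots> = (\<phi>2 (ell z) * (v \<bullet> u) * chi z + - 2 * real m * chi z * psi z * (z \<bullet> u) * \<phi>1 (ell z)) * (v \<bullet> u)
      - 2 * real m * ((\<phi>1 (ell z) * (v \<bullet> u) * chi z + - 2 * real m * chi z * psi z * (z \<bullet> u) * \<phi> (ell z)) * (psi z * (z \<bullet> u))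
         + (- 2 * (psi z)\<^sup>2 * (z \<bullet> u) * (z \<bullet> u) + u \<bullet> u * psi z) * (\<phi> (ell z) * chi z))"
      by algebra
    finally show ?thesis .
  qed
  ultimately show ?thesis unfolding z_def by simp
qed

lemma components_cont:
  "continuous_on UNIV (\<lambda>x. \<phi> (ell x))" "continuous_on UNIV (\<lambda>x. \<phi>1 (ell x))" "continuous_on UNIV (\<lambda>x. \<phi>2 (ell x))"
  "continuous_on UNIV psi" "continuous_on UNIV chi"
proof -
  have e: "continuous_on UNIV ell" unfolding ell_def[abs_def] by (intro continuous_intros)
  have "continuous_on UNIV \<phi>" "continuous_on UNIV \<phi>1"
    by (intro continuous_at_imp_continuous_on ballI DERIV_isCont[OF d\<phi>] DERIV_isCont[OF d\<phi>1])+
  then show "continuous_on UNIV (\<lambda>x. \<phi> (ell x))" "continuous_on UNIV (\<lambda>x. \<phi>1 (ell x))" "continuous_on UNIV (\<lambda>x. \<phi>2 (ell x))"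
    using c\<phi>2 by (auto intro!: continuous_on_compose2[OF _ e])
  show p: "continuous_on UNIV psi"
    unfolding psi_def[abs_def] using den_pos by (intro continuous_intros) (auto simp: less_imp_neq[symmetric])
  show "continuous_on UNIV chi" unfolding chi_def[abs_def] by (intro continuous_intros p)
qed

lemma PhiF_cont: "continuous_on UNIV PhiF"
  unfolding PhiF_def[abs_def] by (intro continuous_intros components_cont)

lemma gradF_cont: "continuous_on UNIV gradF"
  unfolding gradF_def[abs_def] by (intro continuous_intros components_cont)

lemma hessF_cont: "continuous_on UNIV (hessF k l)"
  unfolding hessF_def[abs_def] by (intro continuous_intros components_cont)

lemma norm_sq: "(norm x)\<^sup>2 = x \<bullet> x" for x :: "real^'d"
  by (simp add: power2_norm_eq_inner)

lemma norm_le_one_plus: "norm x \<le> 1 + x \<bullet> x" for x :: "real^'d"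
proof -
  have "2 * norm x \<le> 1 + (norm x)\<^sup>2" using sum_squares_bound[of 1 "norm x"] by simp
  then show ?thesis using norm_ge_zero[of x] unfolding norm_sq by linarith
qed

lemma psi_norm: "psi x * norm x \<le> 1"
  using mult_left_mono[OF norm_le_one_plus[of x], of "psi x"] psi_pos[of x] psi_le[of x] by linarith

lemma psi_component2: "(psi x)\<^sup>2 * \<bar>x $ k * x $ l\<bar> \<le> 1" and psi_component: "psi x * \<bar>v $ k * x $ l\<bar> \<le> 1"
proof -
  have "psi x * \<bar>x $ k\<bar> \<le> 1" for k
    using mult_left_mono[OF component_le_norm_cart[of x k], of "psi x"] psi_pos[of x] psi_norm[of x] by linarith
  note c = this
  have "(psi x * \<bar>x $ k\<bar>) * (psi x * \<bar>x $ l\<bar>) \<le> 1 * 1" using c psi_pos[of x] by (intro mult_mono) auto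
  then show "(psi x)\<^sup>2 * \<bar>x $ k * x $ l\<bar> \<le> 1" by (simp add: power2_eq_square abs_mult mult_ac)
  have "\<bar>v $ k\<bar> * (psi x * \<bar>x $ l\<bar>) \<le> 1 * 1"
    using c[of l] psi_pos[of x] component_le_norm_cart[of v k] nv by (intro mult_mono) auto
  then show "psi x * \<bar>v $ k * x $ l\<bar> \<le> 1" by (simp add: abs_mult mult_ac)
qed

end

text \<open>\<open>Q\<close> stands for \<open>S ** transpose S\<close>. The cutoff decays like the
  power \<open>- m\<close> of \<open>1 + x \<bullet> x\<close>; by \<open>mq\<close> this beats the
  growth of order \<open>q / 2\<close> of \<open>\<phi>\<close> and one further factor
  \<open>1 + x \<bullet> x\<close> from the coefficients. \<open>gen\<close> is the one-dimensional
  generator inequality, with \<open>r\<close> replaced by its lower bound.\<close>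

locale lyapunov_cutoff = cutoff_product \<phi> \<phi>1 \<phi>2 v y0 \<kappa> m
  for \<phi> \<phi>1 \<phi>2 :: "real \<Rightarrow> real" and v :: "real^'d" and y0 \<kappa> :: real and m :: nat +
  fixes q K \<alpha> \<epsilon> KG KR KC c2 lam d k2 :: real and G :: "real^'d \<Rightarrow> real^'d" and r :: "real^'d \<Rightarrow> real" and Q :: "real^'d^'d"
  assumes q: "q > 1" and mq: "q / 2 + 1 \<le> real m" and K: "K > 0" and \<epsilon>: "\<epsilon> > 0"
    and b\<phi>: "\<And>y. \<bar>\<phi> y\<bar> \<le> K * (1 + y\<^sup>2) powr (q / 2)" and b\<phi>1: "\<And>y. \<bar>\<phi>1 y\<bar> \<le> K * (1 + y\<^sup>2) powr ((q - 1) / 2)"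
    and b\<phi>2: "\<And>y. \<bar>\<phi>2 y\<bar> \<le> K * (1 + y\<^sup>2) powr (q / 2)" and \<phi>2_nonneg: "\<And>y. 0 \<le> \<phi>2 y"
    and gen: "\<And>y. \<epsilon> \<le> c2 / 2 * ((lam * y + d)\<^sup>2 + k2) * \<phi>2 y - \<alpha> * y * \<phi>1 y"
    and Gv: "\<And>x. G x \<bullet> v = - \<alpha> * (v \<bullet> x - y0)"
    and r_low: "\<And>x. (lam * (v \<bullet> x - y0) + d)\<^sup>2 + k2 \<le> (r x)\<^sup>2"
    and c2: "v \<bullet> (Q *v v) = c2" "c2 > 0"
    and G1: "\<And>x. norm (G x) \<le> KG * (1 + x \<bullet> x)" and G2: "\<And>x. norm (G x) * norm x \<le> KG * (1 + x \<bullet> x)"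
    and R1: "\<And>x. (r x)\<^sup>2 \<le> KR * (1 + x \<bullet> x)"
    and Q1: "\<And>x. \<bar>v \<bullet> (Q *v x)\<bar> \<le> KC * norm x" and Q2: "\<And>x. \<bar>x \<bullet> (Q *v x)\<bar> \<le> KC * (x \<bullet> x)"
    and Q3: "\<bar>\<Sum>k\<in>UNIV. Q $ k $ k\<bar> \<le> KC" and Q4: "\<And>k l. \<bar>Q $ k $ l\<bar> \<le> KC"
begin

text \<open>Converts bounds in the centred coordinate into bounds in \<open>x\<close>, through
  \<open>1 + (ell x)\<^sup>2 \<le> (2 + 2 * y0\<^sup>2) * (1 + x \<bullet> x)\<close>. It does not
  involve \<open>\<kappa>\<close>.\<close>

definition K1 :: real where "K1 = K * (2 + 2 * y0\<^sup>2) powr (q / 2)"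

definition Pq :: "real^'d \<Rightarrow> real" where "Pq x = (1 + x \<bullet> x) powr (q / 2)"

definition gen_op :: "real^'d \<Rightarrow> real" where
  "gen_op x = G x \<bullet> gradF x + (r x)\<^sup>2 / 2 * (\<Sum>k\<in>UNIV. \<Sum>l\<in>UNIV. hessF k l x * Q $ k $ l)"

lemma one_le_P: "1 \<le> 1 + x \<bullet> x" for x :: "real^'d" by simp

lemma Pq_ge1: "1 \<le> Pq x"
  unfolding Pq_def using q by (intro ge_one_powr_ge_zero) auto

lemma K1_pos: "K1 > 0"
proof -
  have "2 + 2 * y0\<^sup>2 > 0" by (simp add: add_pos_nonneg)
  then show ?thesis using K by (simp add: K1_def)
qed

lemma const_nonneg: "KG \<ge> 0" "KR \<ge> 0" "KC \<ge> 0"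
proof -
  have "norm (G 0) \<le> KG" "(r 0)\<^sup>2 \<le> KR" using G1[of 0] R1[of 0] by auto
  then show "KG \<ge> 0" "KR \<ge> 0" using norm_ge_zero[of "G 0"] zero_le_power2[of "r 0"] by linarith+
  show "KC \<ge> 0" using Q3 by linarith
qed

lemma ell_bound: "1 + (ell x)\<^sup>2 \<le> (2 + 2 * y0\<^sup>2) * (1 + x \<bullet> x)"
proof -
  have "\<bar>v \<bullet> x\<bar> \<le> norm x" using Cauchy_Schwarz_ineq2[of v x] nv by simp
  then have "(v \<bullet> x)\<^sup>2 \<le> x \<bullet> x" unfolding norm_sq[symmetric] using abs_le_square_iff[of "v \<bullet> x" "norm x"] by simp
  moreover have "(ell x)\<^sup>2 \<le> 2 * (v \<bullet> x)\<^sup>2 + 2 * y0\<^sup>2"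
    unfolding ell_def using sum_squares_bound[of "v \<bullet> x" "- y0"] by (simp add: power2_diff)
  moreover have "0 \<le> 2 * y0\<^sup>2 * (x \<bullet> x)" by simp
  moreover have "(2 + 2 * y0\<^sup>2) * (1 + x \<bullet> x) = 2 + 2 * (x \<bullet> x) + 2 * y0\<^sup>2 + 2 * y0\<^sup>2 * (x \<bullet> x)"
    by (simp add: algebra_simps)
  ultimately show ?thesis by linarith
qed

lemma ell_powr:
  assumes "0 \<le> s" "s \<le> q / 2"
  shows "K * (1 + (ell x)\<^sup>2) powr s \<le> K1 * (1 + x \<bullet> x) powr s"
proof -
  have p: "0 < 1 + (ell x)\<^sup>2" by (simp add: add_pos_nonneg)
  have y: "1 \<le> 2 + 2 * y0\<^sup>2" by (simp add: add_increasing2)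
  have "(1 + (ell x)\<^sup>2) powr s \<le> ((2 + 2 * y0\<^sup>2) * (1 + x \<bullet> x)) powr s"
    using assms p ell_bound by (intro powr_mono2) auto
  also have "\<dots> = (2 + 2 * y0\<^sup>2) powr s * (1 + x \<bullet> x) powr s" by (simp add: powr_mult)
  also have "\<dots> \<le> (2 + 2 * y0\<^sup>2) powr (q / 2) * (1 + x \<bullet> x) powr s"
    using assms y by (intro mult_right_mono powr_mono) auto
  finally show ?thesis using K by (simp add: K1_def mult.assoc)
qed

text \<open>\<open>\<phi>1\<close> grows one order less than \<open>\<phi>\<close>, which leaves
  room for the factor \<open>norm x\<close> in the last bound; that factor arises from the mixed
  term of the second derivative.\<close>

lemma phi_bounds:
  "\<bar>\<phi> (ell x)\<bar> \<le> K1 * Pq x" "\<bar>\<phi>1 (ell x)\<bar> \<le> K1 * Pq x" "\<bar>\<phi>2 (ell x)\<bar> \<le> K1 * Pq x" "\<bar>\<phi>1 (ell x)\<bar> * norm x \<le> K1 * Pq x"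
proof -
  show "\<bar>\<phi> (ell x)\<bar> \<le> K1 * Pq x" "\<bar>\<phi>2 (ell x)\<bar> \<le> K1 * Pq x"
    using order_trans[OF b\<phi> ell_powr[of "q / 2" x]] order_trans[OF b\<phi>2 ell_powr[of "q / 2" x]] q by (auto simp: Pq_def)
  have b: "\<bar>\<phi>1 (ell x)\<bar> \<le> K1 * (1 + x \<bullet> x) powr ((q - 1) / 2)"
    using q by (intro order_trans[OF b\<phi>1 ell_powr[of "(q - 1) / 2" x]]) auto
  also have "\<dots> \<le> K1 * Pq x" unfolding Pq_def using K1_pos one_le_P[of x] by (intro mult_left_mono powr_mono) auto
  finally show "\<bar>\<phi>1 (ell x)\<bar> \<le> K1 * Pq x" .
  have n: "norm x \<le> (1 + x \<bullet> x) powr (1/2)"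
  proof -
    have "norm x \<le> sqrt (1 + x \<bullet> x)" by (rule real_le_rsqrt) (simp add: norm_sq)
    then show ?thesis using one_le_P[of x] by (simp add: powr_half_sqrt)
  qed
  have "\<bar>\<phi>1 (ell x)\<bar> * norm x \<le> (K1 * (1 + x \<bullet> x) powr ((q - 1) / 2)) * (1 + x \<bullet> x) powr (1/2)"
    using b n K1_pos by (intro mult_mono) auto
  also have "\<dots> = K1 * Pq x"
    unfolding Pq_def mult.assoc powr_add[symmetric] by (simp add: diff_divide_distrib)
  finally show "\<bar>\<phi>1 (ell x)\<bar> * norm x \<le> K1 * Pq x" .
qed

lemma chi_decay: "Pq x * (1 + x \<bullet> x) * chi x \<le> \<kappa> ^ m"
proof -
  define P where "P = 1 + x \<bullet> x"
  have P: "P \<ge> 1" by (simp add: P_def)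
  have "\<kappa> * psi x \<le> \<kappa> / P"
    using psi_le[of x] \<kappa> P by (simp add: P_def[symmetric] field_simps)
  then have "chi x \<le> (\<kappa> / P) ^ m" unfolding chi_def using psi_pos[of x] \<kappa> by (intro power_mono) auto
  then have "Pq x * P * chi x \<le> Pq x * P * (\<kappa> / P) ^ m" using P Pq_ge1[of x] by (intro mult_left_mono) auto
  also have "\<dots> = P powr (q / 2 + 1) * (\<kappa> / P) ^ m" unfolding Pq_def P_def[symmetric] using P by (simp add: powr_add)
  also have "P powr (q / 2 + 1) * (\<kappa> / P) ^ m \<le> P powr (real m) * (\<kappa> / P) ^ m"
    using P \<kappa> mq by (intro mult_right_mono powr_mono) auto
  also have "\<dots> = \<kappa> ^ m" using P by (simp add: powr_realpow power_divide)
  finally show ?thesis unfolding P_def .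
qed

lemma chi_decay1: "Pq x * chi x \<le> \<kappa> ^ m"
proof -
  have "Pq x * 1 * chi x \<le> Pq x * (1 + x \<bullet> x) * chi x"
    using Pq_ge1[of x] chi_pos[of x] by (intro mult_right_mono mult_left_mono) auto
  then show ?thesis using chi_decay[of x] by simp
qed

lemma PhiF_bound: "\<bar>PhiF x\<bar> \<le> K1 * \<kappa> ^ m"
proof -
  have "\<bar>PhiF x\<bar> \<le> K1 * Pq x * chi x"
    unfolding PhiF_def abs_mult using phi_bounds(1)[of x] chi_pos[of x] by (simp add: mult_right_mono)
  also have "\<dots> \<le> K1 * \<kappa> ^ m" using chi_decay1[of x] K1_pos by (simp add: mult.assoc)
  finally show ?thesis .
qed

lemma gradF_bound: "norm (gradF x) \<le> (1 + 2 * real m) * K1 * (Pq x * chi x)"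
proof -
  have "norm (gradF x) \<le> norm ((\<phi>1 (ell x) * chi x) *\<^sub>R v) + norm ((2 * real m * \<phi> (ell x) * chi x * psi x) *\<^sub>R x)"
    unfolding gradF_def by (rule norm_triangle_ineq4)
  also have "\<dots> = \<bar>\<phi>1 (ell x)\<bar> * chi x + 2 * real m * (\<bar>\<phi> (ell x)\<bar> * (psi x * norm x)) * chi x"
    using nv chi_pos[of x] psi_pos[of x] by (simp add: abs_mult)
  also have "\<dots> \<le> (K1 * Pq x) * chi x + 2 * real m * (K1 * Pq x * 1) * chi x"
    using phi_bounds[of x] chi_pos[of x] psi_pos[of x] psi_norm[of x] K1_pos Pq_ge1[of x]
    by (intro add_mono mult_right_mono mult_left_mono mult_mono) auto
  also have "\<dots> = (1 + 2 * real m) * K1 * (Pq x * chi x)" by (simp add: algebra_simps)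
  finally show ?thesis .
qed

definition Km :: real where "Km = 1 + 4 * real m + 4 * real m * (real m + 1) + 2 * real m"

lemma Km_nonneg: "Km \<ge> 0"
  by (simp add: Km_def)

lemma hessF_bound: "\<bar>hessF k l x\<bar> \<le> Km * K1 * (Pq x * chi x)"
proof -
  define A where "A = K1 * Pq x * chi x"
  have A: "A \<ge> 0" using K1_pos Pq_ge1[of x] chi_pos[of x] by (simp add: A_def)
  have ph: "\<bar>\<phi> (ell x)\<bar> * chi x \<le> A" "\<bar>\<phi>1 (ell x)\<bar> * chi x \<le> A" "\<bar>\<phi>2 (ell x)\<bar> * chi x \<le> A"
    unfolding A_def using phi_bounds[of x] chi_pos[of x] by (auto intro!: mult_right_mono)
  have vv: "\<bar>v $ k * v $ l\<bar> \<le> 1"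
    using component_le_norm_cart[of v k] component_le_norm_cart[of v l] nv
    unfolding abs_mult by (intro mult_le_one) auto
  have "\<bar>\<phi>2 (ell x) * chi x * (v $ k * v $ l)\<bar> \<le> A"
    unfolding abs_mult[of _ "v $ k * v $ l"] using mult_mono[OF ph(3) vv A] chi_pos[of x] by (simp add: abs_mult)
  moreover have "\<bar>4 * real m * \<phi>1 (ell x) * chi x * psi x * (v $ k * x $ l)\<bar> \<le> 4 * real m * A"
  proof -
    have "(\<bar>\<phi>1 (ell x)\<bar> * chi x) * (psi x * \<bar>v $ k * x $ l\<bar>) \<le> A * 1"
      using ph psi_component[of x k l] A psi_pos[of x] chi_pos[of x] by (intro mult_mono) auto
    then have "4 * real m * ((\<bar>\<phi>1 (ell x)\<bar> * chi x) * (psi x * \<bar>v $ k * x $ l\<bar>)) \<le> 4 * real m * A"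
      by (intro mult_left_mono) auto
    then show ?thesis using psi_pos[of x] chi_pos[of x] by (simp add: abs_mult mult_ac)
  qed
  moreover have "\<bar>4 * real m * (real m + 1) * \<phi> (ell x) * chi x * (psi x)\<^sup>2 * (x $ k * x $ l)\<bar> \<le> 4 * real m * (real m + 1) * A"
  proof -
    have "(\<bar>\<phi> (ell x)\<bar> * chi x) * ((psi x)\<^sup>2 * \<bar>x $ k * x $ l\<bar>) \<le> A * 1"
      using ph psi_component2[of x k l] A chi_pos[of x] by (intro mult_mono) auto
    then have "4 * real m * (real m + 1) * ((\<bar>\<phi> (ell x)\<bar> * chi x) * ((psi x)\<^sup>2 * \<bar>x $ k * x $ l\<bar>)) \<le> 4 * real m * (real m + 1) * A"
      by (intro mult_left_mono) auto
    then show ?thesis using chi_pos[of x] by (simp add: abs_mult mult_ac)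
  qed
  moreover have "\<bar>2 * real m * \<phi> (ell x) * chi x * psi x * (if k = l then 1 else 0)\<bar> \<le> 2 * real m * A"
  proof -
    have "(\<bar>\<phi> (ell x)\<bar> * chi x) * (psi x * (if k = l then 1 else 0)) \<le> A * 1"
      using ph psi_le1[of x] A chi_pos[of x] psi_pos[of x] by (intro mult_mono) auto
    then have "2 * real m * ((\<bar>\<phi> (ell x)\<bar> * chi x) * (psi x * (if k = l then 1 else 0))) \<le> 2 * real m * A"
      by (intro mult_left_mono) auto
    then show ?thesis using psi_pos[of x] chi_pos[of x] by (simp add: abs_mult mult_ac)
  qed
  ultimately have "\<bar>hessF k l x\<bar> \<le> A + 4 * real m * A + 4 * real m * (real m + 1) * A + 2 * real m * A"
    unfolding hessF_def by linarith
  also have "\<dots> = Km * K1 * (Pq x * chi x)" by (simp add: Km_def A_def algebra_simps)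
  finally show ?thesis .
qed

text \<open>\<open>C\<close> depends on \<open>\<kappa>\<close> through \<open>\<kappa> ^ m\<close>;
  it only has to exist, so that Dynkin's formula applies. The estimate that is uniform in
  \<open>\<kappa>\<close> is \<open>gen_op_lower\<close>.\<close>

lemma all_bounds:
  obtains C where "\<And>x. \<bar>PhiF x\<bar> \<le> C" "\<And>x. norm (gradF x) \<le> C" "\<And>k l x. \<bar>hessF k l x\<bar> \<le> C"
    "\<And>x. \<bar>r x\<bar> * norm (gradF x) \<le> C" "\<And>x. \<bar>gen_op x\<bar> \<le> C"
proof -
  define H where "H = \<kappa> ^ m"
  have H: "H \<ge> 0" using \<kappa> by (simp add: H_def)
  define Ag where "Ag = (1 + 2 * real m) * K1"
  define Ah where "Ah = Km * K1"
  have A: "Ag \<ge> 0" "Ah \<ge> 0" "K1 \<ge> 0" using K1_pos Km_nonneg by (auto simp: Ag_def Ah_def)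
  define dd where "dd = real CARD('d)"
  define C where "C = K1 * H + Ag * H + Ah * H + (KR + 1) * (Ag * H) + KG * (Ag * H) + KR / 2 * (dd * (dd * (Ah * H * KC)))"
  note cn = const_nonneg
  have terms: "0 \<le> K1 * H" "0 \<le> Ag * H" "0 \<le> Ah * H" "0 \<le> (KR + 1) * (Ag * H)" "0 \<le> KG * (Ag * H)"
    "0 \<le> KR / 2 * (dd * (dd * (Ah * H * KC)))"
    using H A cn by (auto simp: dd_def)
  have gH: "norm (gradF x) \<le> Ag * (Pq x * chi x)" for x unfolding Ag_def by (rule gradF_bound)
  have hH: "\<bar>hessF k l x\<bar> \<le> Ah * (Pq x * chi x)" for k l x unfolding Ah_def by (rule hessF_bound)
  have d1: "Pq x * chi x \<le> H" for x unfolding H_def by (rule chi_decay1)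
  have d2: "(1 + x \<bullet> x) * (Pq x * chi x) \<le> H" for x using chi_decay[of x] by (simp add: H_def mult_ac)
  have g1: "norm (gradF x) \<le> Ag * H" for x using gH[of x] mult_left_mono[OF d1[of x] A(1)] by linarith
  have h1: "\<bar>hessF k l x\<bar> \<le> Ah * H" for k l x using hH[of k l x] mult_left_mono[OF d1[of x] A(2)] by linarith
  have g2: "(1 + x \<bullet> x) * norm (gradF x) \<le> Ag * H" for x
  proof -
    have "(1 + x \<bullet> x) * norm (gradF x) \<le> (1 + x \<bullet> x) * (Ag * (Pq x * chi x))" using gH[of x] by (intro mult_left_mono) auto
    also have "\<dots> = Ag * ((1 + x \<bullet> x) * (Pq x * chi x))" by simp
    also have "\<dots> \<le> Ag * H" using d2 A(1) by (intro mult_left_mono)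
    finally show ?thesis .
  qed
  have h2: "(1 + x \<bullet> x) * \<bar>hessF k l x\<bar> \<le> Ah * H" for k l x
  proof -
    have "(1 + x \<bullet> x) * \<bar>hessF k l x\<bar> \<le> (1 + x \<bullet> x) * (Ah * (Pq x * chi x))" using hH[of k l x] by (intro mult_left_mono) auto
    also have "\<dots> = Ah * ((1 + x \<bullet> x) * (Pq x * chi x))" by simp
    also have "\<dots> \<le> Ah * H" using d2 A(2) by (intro mult_left_mono)
    finally show ?thesis .
  qed
  have rg: "\<bar>r x\<bar> * norm (gradF x) \<le> (KR + 1) * (Ag * H)" for x
  proof -
    have "2 * \<bar>r x\<bar> \<le> 1 + (r x)\<^sup>2" using sum_squares_bound[of 1 "\<bar>r x\<bar>"] by simp
    then have "\<bar>r x\<bar> \<le> 1 + (r x)\<^sup>2" using abs_ge_zero[of "r x"] by linarith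
    also have "\<dots> \<le> (KR + 1) * (1 + x \<bullet> x)" proof -
      have "(KR + 1) * (1 + x \<bullet> x) = KR * (1 + x \<bullet> x) + 1 + x \<bullet> x" by (simp add: algebra_simps)
      then show ?thesis using R1[of x] inner_ge_zero[of x] by linarith
    qed
    finally have "\<bar>r x\<bar> * norm (gradF x) \<le> (KR + 1) * (1 + x \<bullet> x) * norm (gradF x)" by (intro mult_right_mono) auto
    also have "\<dots> = (KR + 1) * ((1 + x \<bullet> x) * norm (gradF x))" by simp
    also have "\<dots> \<le> (KR + 1) * (Ag * H)" using g2 cn by (intro mult_left_mono) auto
    finally show ?thesis .
  qed
  have Lb: "\<bar>gen_op x\<bar> \<le> KG * (Ag * H) + KR / 2 * (dd * (dd * (Ah * H * KC)))" for x
  proof -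
    have "\<bar>G x \<bullet> gradF x\<bar> \<le> norm (G x) * norm (gradF x)" by (rule Cauchy_Schwarz_ineq2)
    also have "\<dots> \<le> KG * (1 + x \<bullet> x) * norm (gradF x)" using G1 by (intro mult_right_mono) auto
    also have "\<dots> = KG * ((1 + x \<bullet> x) * norm (gradF x))" by simp
    also have "\<dots> \<le> KG * (Ag * H)" using g2 cn by (intro mult_left_mono) auto
    finally have a: "\<bar>G x \<bullet> gradF x\<bar> \<le> KG * (Ag * H)" .
    have "\<bar>(r x)\<^sup>2 / 2 * (\<Sum>k\<in>UNIV. \<Sum>l\<in>UNIV. hessF k l x * Q $ k $ l)\<bar> =
        (r x)\<^sup>2 / 2 * \<bar>\<Sum>k\<in>UNIV. \<Sum>l\<in>UNIV. hessF k l x * Q $ k $ l\<bar>" by (simp add: abs_mult)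
    also have "\<dots> \<le> KR * (1 + x \<bullet> x) / 2 * (\<Sum>k\<in>UNIV. \<Sum>l\<in>UNIV. \<bar>hessF k l x\<bar> * KC)"
    proof (intro mult_mono)
      show "\<bar>\<Sum>k\<in>UNIV. \<Sum>l\<in>UNIV. hessF k l x * Q $ k $ l\<bar> \<le> (\<Sum>k\<in>UNIV. \<Sum>l\<in>UNIV. \<bar>hessF k l x\<bar> * KC)"
        by (intro order_trans[OF sum_abs] sum_mono) (auto simp: abs_mult intro!: mult_left_mono Q4)
    qed (use R1[of x] cn in auto)
    also have "\<dots> = KR / 2 * (\<Sum>k\<in>UNIV. \<Sum>l\<in>UNIV. (1 + x \<bullet> x) * \<bar>hessF k l x\<bar> * KC)"
      by (simp add: sum_distrib_left mult_ac)
    also have "\<dots> \<le> KR / 2 * (\<Sum>k\<in>(UNIV::'d set). \<Sum>l\<in>(UNIV::'d set). Ah * H * KC)"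
      using h2 cn by (intro mult_left_mono sum_mono mult_right_mono) auto
    also have "\<dots> = KR / 2 * (dd * (dd * (Ah * H * KC)))" by (simp add: dd_def)
    finally show ?thesis unfolding gen_op_def using a by linarith
  qed
  show thesis
  proof (rule that[of C])
    show "\<bar>PhiF x\<bar> \<le> C" for x using PhiF_bound[of x] terms unfolding C_def H_def[symmetric] by linarith
    show "norm (gradF x) \<le> C" for x using g1[of x] terms unfolding C_def by linarith
    show "\<bar>hessF k l x\<bar> \<le> C" for k l x using h1[of k l x] terms unfolding C_def by linarith
    show "\<bar>r x\<bar> * norm (gradF x) \<le> C" for x using rg[of x] terms unfolding C_def by linarith
    show "\<bar>gen_op x\<bar> \<le> C" for x using Lb[of x] terms unfolding C_def by linarith
  qed
qed

text \<open>Collects the terms in which some derivative falls on the cutoff. It does not involve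
  \<open>\<kappa>\<close>, so \<open>\<kappa>\<close> can be chosen after it.\<close>

definition K2 :: real where
  "K2 = K1 * (2 * real m * KG + KR / 2 * KC * (4 * real m + 4 * real m * (real m + 1) + 2 * real m))"

text \<open>The generator of the product is \<open>chi\<close> times the generator of
  \<open>\<phi>\<close> along \<open>v\<close>, which is at least \<open>\<epsilon>\<close>, plus
  terms with a derivative of \<open>chi\<close>. These terms carry a factor \<open>psi\<close>, and
  \<open>1 - chi\<close> is bounded through one as well; hence the common factor
  \<open>psi x * (1 + x \<bullet> x)\<close>, which is small as long as \<open>x \<bullet> x\<close>
  is small against \<open>\<kappa>\<close>.\<close>

lemma gen_op_lower: "\<epsilon> - (\<epsilon> * real m + K2) * Pq x * (psi x * (1 + x \<bullet> x)) \<le> gen_op x"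
proof -
  define P where "P = 1 + x \<bullet> x"
  define A where "A = K1 * Pq x"
  note cn = const_nonneg
  have P: "P \<ge> 1" by (simp add: P_def)
  have A: "A \<ge> 0" using K1_pos Pq_ge1[of x] by (simp add: A_def)
  have ps: "psi x > 0" "chi x > 0" "chi x \<le> 1" by (auto simp: psi_pos chi_pos chi_le1)
  have xx: "psi x * (x \<bullet> x) \<le> 1" using psi_le[of x] ps by (simp add: distrib_left)
  have vQx: "\<bar>\<phi>1 (ell x)\<bar> * \<bar>v \<bullet> (Q *v x)\<bar> \<le> A * KC"
  proof -
    have "\<bar>\<phi>1 (ell x)\<bar> * \<bar>v \<bullet> (Q *v x)\<bar> \<le> \<bar>\<phi>1 (ell x)\<bar> * (KC * norm x)" using Q1 by (intro mult_left_mono) auto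
    also have "\<dots> = (\<bar>\<phi>1 (ell x)\<bar> * norm x) * KC" by simp
    also have "\<dots> \<le> A * KC" unfolding A_def using phi_bounds(4) cn by (intro mult_right_mono)
    finally show ?thesis .
  qed
  have xQx: "\<bar>\<phi> (ell x)\<bar> * (psi x * \<bar>x \<bullet> (Q *v x)\<bar>) \<le> A * KC"
  proof -
    have "psi x * \<bar>x \<bullet> (Q *v x)\<bar> \<le> psi x * (KC * (x \<bullet> x))" using Q2 ps by (intro mult_left_mono) auto
    also have "\<dots> = KC * (psi x * (x \<bullet> x))" by simp
    also have "\<dots> \<le> KC * 1" using xx cn by (intro mult_left_mono) auto
    finally show ?thesis unfolding A_def using phi_bounds(1)[of x] ps A cn by (intro mult_mono) (auto simp: A_def)
  qed
  have tr: "\<bar>\<phi> (ell x)\<bar> * \<bar>\<Sum>k\<in>UNIV. Q $ k $ k\<bar> \<le> A * KC"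
    unfolding A_def using phi_bounds(1)[of x] Q3 A cn by (intro mult_mono) (auto simp: A_def)
  have Gx: "\<bar>\<phi> (ell x)\<bar> * \<bar>G x \<bullet> x\<bar> \<le> A * (KG * P)"
    unfolding A_def P_def using phi_bounds(1)[of x] order_trans[OF Cauchy_Schwarz_ineq2 G2] A by (intro mult_mono) (auto simp: A_def)
  define T where "T = 4 * real m * (\<phi>1 (ell x) * (v \<bullet> (Q *v x))) - 4 * real m * (real m + 1) * (\<phi> (ell x) * (psi x * (x \<bullet> (Q *v x))))
      + 2 * real m * (\<phi> (ell x) * (\<Sum>k\<in>UNIV. Q $ k $ k))"
  define T0 where "T0 = 2 * real m * (\<phi> (ell x) * (G x \<bullet> x)) + (r x)\<^sup>2 / 2 * T"
  have form: "gen_op x = chi x * (c2 / 2 * (r x)\<^sup>2 * \<phi>2 (ell x) - \<alpha> * ell x * \<phi>1 (ell x)) - chi x * psi x * T0"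
  proof -
    have h: "(\<Sum>k\<in>UNIV. \<Sum>l\<in>UNIV. hessF k l x * Q $ k $ l) = \<phi>2 (ell x) * chi x * c2
      - 4 * real m * \<phi>1 (ell x) * chi x * psi x * (v \<bullet> (Q *v x))
      + 4 * real m * (real m + 1) * \<phi> (ell x) * chi x * (psi x)\<^sup>2 * (x \<bullet> (Q *v x))
      - 2 * real m * \<phi> (ell x) * chi x * psi x * (\<Sum>k\<in>UNIV. Q $ k $ k)"
      unfolding hessF_form sum_outer_product_form c2(1) ..
    have g: "G x \<bullet> gradF x = \<phi>1 (ell x) * chi x * (- \<alpha> * ell x) - 2 * real m * \<phi> (ell x) * chi x * psi x * (G x \<bullet> x)"
      unfolding gradF_def inner_diff_right inner_scaleR_right Gv ell_def ..
    show ?thesis unfolding gen_op_def h g T0_def T_def by (simp add: field_simps power2_eq_square)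
  qed
  \<comment> \<open>Convexity enters here: as \<open>\<phi>2\<close> is nonnegative,
    \<open>(r x)\<^sup>2\<close> may be replaced by its lower bound, which depends on
    \<open>ell x\<close> alone.\<close>
  have "\<epsilon> \<le> c2 / 2 * (r x)\<^sup>2 * \<phi>2 (ell x) - \<alpha> * ell x * \<phi>1 (ell x)"
  proof -
    have "c2 / 2 * ((lam * ell x + d)\<^sup>2 + k2) * \<phi>2 (ell x) \<le> c2 / 2 * (r x)\<^sup>2 * \<phi>2 (ell x)"
      using r_low[of x] c2(2) \<phi>2_nonneg unfolding ell_def[symmetric] by (intro mult_right_mono mult_left_mono) auto
    then show ?thesis using gen[of "ell x"] by linarith
  qed
  then have main: "chi x * \<epsilon> \<le> chi x * (c2 / 2 * (r x)\<^sup>2 * \<phi>2 (ell x) - \<alpha> * ell x * \<phi>1 (ell x))"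
    using ps by (intro mult_left_mono) auto
  have T: "\<bar>T\<bar> \<le> (4 * real m + 4 * real m * (real m + 1) + 2 * real m) * (A * KC)"
  proof -
    have "\<bar>T\<bar> \<le> 4 * real m * (\<bar>\<phi>1 (ell x)\<bar> * \<bar>v \<bullet> (Q *v x)\<bar>) + 4 * real m * (real m + 1) * (\<bar>\<phi> (ell x)\<bar> * (psi x * \<bar>x \<bullet> (Q *v x)\<bar>))
        + 2 * real m * (\<bar>\<phi> (ell x)\<bar> * \<bar>\<Sum>k\<in>UNIV. Q $ k $ k\<bar>)"
    proof -
      have "\<bar>a - b + c\<bar> \<le> \<bar>a\<bar> + \<bar>b\<bar> + \<bar>c\<bar>" for a b c :: real by linarith
      from order_trans[OF this] show ?thesis unfolding T_def using ps(1) by (simp add: abs_mult)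
    qed
    also have "\<dots> \<le> 4 * real m * (A * KC) + 4 * real m * (real m + 1) * (A * KC) + 2 * real m * (A * KC)"
      using vQx xQx tr by (intro add_mono mult_left_mono) auto
    finally show ?thesis by (simp add: algebra_simps)
  qed
  have "\<bar>T0\<bar> \<le> 2 * real m * (\<bar>\<phi> (ell x)\<bar> * \<bar>G x \<bullet> x\<bar>) + (r x)\<^sup>2 / 2 * \<bar>T\<bar>"
    unfolding T0_def by (rule order_trans[OF abs_triangle_ineq]) (simp add: abs_mult)
  also have "\<dots> \<le> 2 * real m * (A * (KG * P)) + KR * P / 2 * ((4 * real m + 4 * real m * (real m + 1) + 2 * real m) * (A * KC))"
  proof (rule add_mono)
    show "2 * real m * (\<bar>\<phi> (ell x)\<bar> * \<bar>G x \<bullet> x\<bar>) \<le> 2 * real m * (A * (KG * P))" using Gx by (intro mult_left_mono) auto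
    show "(r x)\<^sup>2 / 2 * \<bar>T\<bar> \<le> KR * P / 2 * ((4 * real m + 4 * real m * (real m + 1) + 2 * real m) * (A * KC))"
      by (rule mult_mono[OF _ T]) (use R1[of x] cn P in \<open>auto simp: P_def\<close>)
  qed
  also have "\<dots> = K2 * Pq x * P" by (simp add: K2_def A_def algebra_simps)
  finally have T0: "\<bar>T0\<bar> \<le> K2 * Pq x * P" .
  have K2: "K2 \<ge> 0" unfolding K2_def using K1_pos cn by (intro mult_nonneg_nonneg add_nonneg_nonneg) auto
  have "chi x * psi x * T0 \<le> 1 * psi x * (K2 * Pq x * P)"
  proof -
    have "chi x * psi x * T0 \<le> chi x * psi x * (K2 * Pq x * P)" using T0 ps by (intro mult_left_mono) auto
    also have "\<dots> \<le> 1 * psi x * (K2 * Pq x * P)" using ps K2 Pq_ge1[of x] P by (intro mult_right_mono) auto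
    finally show ?thesis .
  qed
  then have rem: "chi x * psi x * T0 \<le> K2 * Pq x * (psi x * P)" by (simp add: mult_ac)
  have "\<epsilon> - \<epsilon> * real m * (psi x * P) \<le> chi x * \<epsilon>"
    using mult_right_mono[OF chi_lower[of x], of \<epsilon>] \<epsilon> by (simp add: P_def algebra_simps)
  \<comment> \<open>\<open>Pq x \<ge> 1\<close> lets the loss from \<open>chi_lower\<close> be
    merged with the other errors.\<close>
  moreover have "\<epsilon> * real m * (psi x * P) \<le> \<epsilon> * real m * (psi x * P) * Pq x"
    using mult_left_mono[OF Pq_ge1[of x], of "\<epsilon> * real m * (psi x * P)"] \<epsilon> ps P by simp
  ultimately have "\<epsilon> - (\<epsilon> * real m + K2) * Pq x * (psi x * P) \<le> gen_op x"
    using main rem unfolding form by (simp add: algebra_simps)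
  then show ?thesis unfolding P_def .
qed

end

section \<open>Blow-up of moments\<close>

lemma one_plus_powr_le:
  fixes n :: real
  assumes "n \<ge> 0" "p > 0"
  shows "(1 + n\<^sup>2) powr (p / 2) \<le> 2 powr (p / 2) * (1 + n powr p)"
proof (cases "n \<le> 1")
  case True
  then have "n\<^sup>2 \<le> 1" using assms by (simp add: power_le_one)
  then have "(1 + n\<^sup>2) powr (p / 2) \<le> 2 powr (p / 2)" using assms by (intro powr_mono2) auto
  also have "\<dots> \<le> 2 powr (p / 2) * (1 + n powr p)" by simp
  finally show ?thesis .
next
  case False
  then have n: "n > 1" by simp
  then have "1 \<le> n\<^sup>2" by simp
  then have "(1 + n\<^sup>2) powr (p / 2) \<le> (2 * n\<^sup>2) powr (p / 2)" using assms by (intro powr_mono2) auto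
  also have "\<dots> = 2 powr (p / 2) * (n powr 2) powr (p / 2)" using n by (simp add: powr_mult)
  also have "(n powr 2) powr (p / 2) = n powr p" by (simp add: powr_powr)
  also have "2 powr (p / 2) * n powr p \<le> 2 powr (p / 2) * (1 + n powr p)" by (intro mult_left_mono) auto
  finally show ?thesis .
qed

text \<open>The left side is at most 1 and at most \<open>P / \<kappa>\<close> for
  \<open>P = 1 + x \<bullet> x\<close>, hence at most \<open>(P / \<kappa>) powr \<tau>\<close> by
  interpolation. A little extra growth in \<open>x\<close> thus buys a negative power of
  \<open>\<kappa>\<close>.\<close>

lemma (in cutoff_product) psi_powr_bound:
  assumes "0 < \<tau>" "\<tau> \<le> 1"
  shows "psi x * (1 + x \<bullet> x) \<le> (1 + x \<bullet> x) powr \<tau> * \<kappa> powr (- \<tau>)"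
proof -
  define P where "P = 1 + x \<bullet> x"
  have P: "P \<ge> 1" by (simp add: P_def)
  have "psi x * P \<le> (P / \<kappa>) powr \<tau>"
  proof (cases "P / \<kappa> \<ge> 1")
    case True
    then have "1 \<le> (P / \<kappa>) powr \<tau>" using assms by (intro ge_one_powr_ge_zero) auto
    then show ?thesis using psi_le[of x] by (simp add: P_def)
  next
    case False
    have "\<kappa> * psi x * P \<le> 1 * P" using psi_kappa[of x] P by (intro mult_right_mono) auto
    then have "psi x * P \<le> P / \<kappa>" using \<kappa> by (simp add: field_simps)
    also have "P / \<kappa> = (P / \<kappa>) powr 1" using P \<kappa> by simp
    also have "\<dots> \<le> (P / \<kappa>) powr \<tau>" using False assms P \<kappa> by (intro powr_mono') auto
    finally show ?thesis .
  qed
  also have "(P / \<kappa>) powr \<tau> = P powr \<tau> * \<kappa> powr (- \<tau>)"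
    using P \<kappa> by (simp add: powr_divide powr_minus_divide)
  finally show ?thesis unfolding P_def .
qed

context scalar_noise_sde begin

theorem moment_blowup:
  fixes v :: "real^'d" and y0 \<alpha> c2 lam d k2 p KG KR :: real
  assumes nv: "norm v = 1" and Gv: "\<And>x. G x \<bullet> v = - \<alpha> * (v \<bullet> x - y0)"
    and r_low: "\<And>x. (lam * (v \<bullet> x - y0) + d)\<^sup>2 + k2 \<le> (r x)\<^sup>2"
    and c2: "v \<bullet> ((S ** transpose S) *v v) = c2" "c2 > 0" and lam: "lam > 0" and k2: "k2 > 0" and \<alpha>: "\<alpha> \<ge> 0"
    and G1: "\<And>x. norm (G x) \<le> KG * (1 + x \<bullet> x)" and G2: "\<And>x. norm (G x) * norm x \<le> KG * (1 + x \<bullet> x)"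
    and R1: "\<And>x. (r x)\<^sup>2 \<le> KR * (1 + x \<bullet> x)"
    and gap: "\<alpha> < (p - 1) * c2 * lam\<^sup>2 / 2"
  shows "Limsup at_top (\<lambda>t. \<integral>\<^sup>+\<omega>. ennreal (norm (X t \<omega>) powr p) \<partial>M) = \<infinity>"
proof (rule ccontr)
  define LS where "LS = Limsup at_top (\<lambda>t. \<integral>\<^sup>+\<omega>. ennreal (norm (X t \<omega>) powr p) \<partial>M)"
  assume "Limsup at_top (\<lambda>t. \<integral>\<^sup>+\<omega>. ennreal (norm (X t \<omega>) powr p) \<partial>M) \<noteq> \<infinity>"
  then have "LS \<noteq> top" unfolding LS_def infinity_ennreal_def .
  then obtain l where l: "LS = ennreal l" "l \<ge> 0" by (cases LS) auto
  define C0 where "C0 = l + 1"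
  have C0: "C0 > 0" using l by (simp add: C0_def)
  have "Limsup at_top (\<lambda>t. \<integral>\<^sup>+\<omega>. ennreal (norm (X t \<omega>) powr p) \<partial>M) < ennreal C0"
    unfolding LS_def[symmetric] l(1) C0_def using l(2) by (simp add: ennreal_less_iff)
  \<comment> \<open>A finite limsup bounds the moments only from some time on; earlier times stay
    uncontrolled.\<close>
  from Limsup_lessD[OF this] obtain T0 where T0: "\<And>t. t \<ge> T0 \<Longrightarrow> (\<integral>\<^sup>+\<omega>. ennreal (norm (X t \<omega>) powr p) \<partial>M) < ennreal C0"
    by (auto simp: eventually_at_top_linorder)
  define T where "T = max 1 T0"
  have T: "T > 0" "T \<ge> T0" by (auto simp: T_def)
  have cl: "c2 * lam\<^sup>2 > 0" using c2 lam by simp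
  have p: "p > 1"
  proof (rule ccontr)
    assume "\<not> p > 1"
    then have "(p - 1) * (c2 * lam\<^sup>2) \<le> 0" using cl by (intro mult_nonpos_nonneg) auto
    then show False using gap \<alpha> by (simp add: mult.assoc)
  qed
  define C5 where "C5 = 2 powr (p / 2) * (1 + C0)"
  have C5: "C5 > 0" using C0 by (simp add: C5_def)
  have mom: "integrable M (\<lambda>\<omega>. (1 + X t \<omega> \<bullet> X t \<omega>) powr (p / 2))"
    "expectation (\<lambda>\<omega>. (1 + X t \<omega> \<bullet> X t \<omega>) powr (p / 2)) \<le> C5" if t: "t \<ge> T" for t
  proof -
    have [measurable]: "X t \<in> borel_measurable M" using t T by (intro X_measurable) auto
    have fin: "(\<integral>\<^sup>+\<omega>. ennreal (norm (X t \<omega>) powr p) \<partial>M) < ennreal C0" using t T by (intro T0) auto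
    then have i: "integrable M (\<lambda>\<omega>. norm (X t \<omega>) powr p)"
      by (intro integrableI_nonneg) (auto intro: less_trans)
    have "ennreal (expectation (\<lambda>\<omega>. norm (X t \<omega>) powr p)) < ennreal C0"
      using fin nn_integral_eq_integral[OF i] by simp
    then have e: "expectation (\<lambda>\<omega>. norm (X t \<omega>) powr p) \<le> C0" using C0 by (simp add: ennreal_less_iff)
    have le: "(1 + X t \<omega> \<bullet> X t \<omega>) powr (p / 2) \<le> 2 powr (p / 2) * (1 + norm (X t \<omega>) powr p)" for \<omega>
      using one_plus_powr_le[of "norm (X t \<omega>)" p] p by (simp add: power2_norm_eq_inner)
    have ib: "integrable M (\<lambda>\<omega>. 2 powr (p / 2) * (1 + norm (X t \<omega>) powr p))" using i by simp
    show int: "integrable M (\<lambda>\<omega>. (1 + X t \<omega> \<bullet> X t \<omega>) powr (p / 2))"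
      by (rule Bochner_Integration.integrable_bound[OF ib]) (use le in \<open>auto intro: order_trans[OF le abs_ge_self]\<close>)
    have "expectation (\<lambda>\<omega>. (1 + X t \<omega> \<bullet> X t \<omega>) powr (p / 2)) \<le> expectation (\<lambda>\<omega>. 2 powr (p / 2) * (1 + norm (X t \<omega>) powr p))"
      by (rule integral_mono[OF int ib]) (rule le)
    also have "\<dots> = 2 powr (p / 2) * (1 + expectation (\<lambda>\<omega>. norm (X t \<omega>) powr p))" using i by (simp add: prob_space)
    also have "\<dots> \<le> C5" unfolding C5_def using e by (intro mult_left_mono) auto
    finally show "expectation (\<lambda>\<omega>. (1 + X t \<omega> \<bullet> X t \<omega>) powr (p / 2)) \<le> C5" .
  qed
  \<comment> \<open>The critical exponent of these coefficients: for \<open>p = q0\<close> the two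
    sides of \<open>gap\<close> are equal.\<close>
  define q0 where "q0 = 1 + 2 * \<alpha> / (c2 * lam\<^sup>2)"
  have "2 * \<alpha> / (c2 * lam\<^sup>2) < p - 1" using cl gap by (subst pos_divide_less_eq) (auto simp: mult.assoc)
  then have q0: "q0 \<ge> 1" "q0 < p" using cl \<alpha> by (auto simp: q0_def)
  \<comment> \<open>Strictly between \<open>q0\<close> and \<open>p\<close>, so there is room on
    both sides; the maximum with \<open>p - 1\<close> ensures \<open>\<tau> \<le> 1\<close>.\<close>
  define q where "q = max ((q0 + p) / 2) (p - 1)"
  have q: "q0 < q" "q < p" "p - 1 \<le> q" using q0 by (auto simp: q_def less_max_iff_disj)
  have q1: "q > 1" using q0 q by simp
  \<comment> \<open>The growth \<open>(1 + x \<bullet> x) powr (q / 2)\<close> times the power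
    \<open>\<tau>\<close> lost in \<open>psi_powr_bound\<close> is then exactly the moment of order
    \<open>p\<close> under control.\<close>
  define \<tau> where "\<tau> = (p - q) / 2"
  have \<tau>: "0 < \<tau>" "\<tau> \<le> 1" using q by (auto simp: \<tau>_def)
  have gapq: "\<alpha> < (q - 1) * c2 * lam\<^sup>2 / 2"
  proof -
    have "2 * \<alpha> / (c2 * lam\<^sup>2) < q - 1" using q(1) by (simp add: q0_def)
    then have "2 * \<alpha> < (q - 1) * (c2 * lam\<^sup>2)" using cl by (subst (asm) pos_divide_less_eq)
    then show ?thesis by (simp add: mult.assoc)
  qed
  obtain \<phi> \<phi>1 \<phi>2 \<epsilon> K where \<epsilon>: "\<epsilon> > 0" and K: "K > 0" and d\<phi>: "\<And>y. (\<phi> has_real_derivative \<phi>1 y) (at y)"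
    and d\<phi>1: "\<And>y. (\<phi>1 has_real_derivative \<phi>2 y) (at y)" and c\<phi>2: "continuous_on UNIV \<phi>2" and \<phi>20: "\<And>y. 0 \<le> \<phi>2 y"
    and b\<phi>: "\<And>y. \<bar>\<phi> y\<bar> \<le> K * (1 + y\<^sup>2) powr (q / 2)" and b\<phi>1: "\<And>y. \<bar>\<phi>1 y\<bar> \<le> K * (1 + y\<^sup>2) powr ((q - 1) / 2)"
    and b\<phi>2: "\<And>y. \<bar>\<phi>2 y\<bar> \<le> K * (1 + y\<^sup>2) powr (q / 2)"
    and gen: "\<And>y. \<epsilon> \<le> c2 / 2 * ((lam * y + d)\<^sup>2 + k2) * \<phi>2 y - \<alpha> * y * \<phi>1 y"
    by (rule convex_test_function[OF q1 c2(2) lam k2 \<alpha> gapq, of d], rule that, assumption+)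
  obtain m :: nat where m: "q / 2 + 1 \<le> real m" using real_arch_simple by blast
  define Q where "Q = S ** transpose S"
  obtain BQ where BQ: "BQ > 0" "\<And>x. norm (Q *v x) \<le> norm x * BQ"
    using bounded_linear.pos_bounded[OF matrix_vector_mul_bounded_linear[of Q]] by blast
  define E where "E = (\<Sum>k\<in>UNIV. \<Sum>l\<in>UNIV. \<bar>Q $ k $ l\<bar>)"
  define KC where "KC = BQ + E"
  have ent: "\<bar>Q $ k $ l\<bar> \<le> E" for k l
  proof -
    have "\<bar>Q $ k $ l\<bar> \<le> (\<Sum>l\<in>UNIV. \<bar>Q $ k $ l\<bar>)" by (rule member_le_sum) auto
    also have "\<dots> \<le> E" unfolding E_def by (rule member_le_sum[of k UNIV "\<lambda>k. \<Sum>l\<in>UNIV. \<bar>Q $ k $ l\<bar>"]) (auto intro: sum_nonneg)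
    finally show ?thesis .
  qed
  have E0: "E \<ge> 0" unfolding E_def by (intro sum_nonneg) auto
  have tr: "\<bar>\<Sum>k\<in>UNIV. Q $ k $ k\<bar> \<le> E"
  proof -
    have "\<bar>\<Sum>k\<in>UNIV. Q $ k $ k\<bar> \<le> (\<Sum>k\<in>UNIV. \<bar>Q $ k $ k\<bar>)" by (rule sum_abs)
    also have "\<dots> \<le> E" unfolding E_def
    proof (rule sum_mono)
      show "\<bar>Q $ k $ k\<bar> \<le> (\<Sum>l\<in>UNIV. \<bar>Q $ k $ l\<bar>)" for k
        by (rule member_le_sum[of k UNIV "\<lambda>l. \<bar>Q $ k $ l\<bar>"]) auto
    qed
    finally show ?thesis .
  qed
  have Qn: "norm (Q *v x) \<le> KC * norm x" for x
    using BQ(2)[of x] mult_nonneg_nonneg[OF E0 norm_ge_zero[of x]] by (simp add: KC_def algebra_simps)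
  have Q1: "\<bar>v \<bullet> (Q *v x)\<bar> \<le> KC * norm x" for x
    using Cauchy_Schwarz_ineq2[of v "Q *v x"] nv Qn[of x] by simp
  have Q2: "\<bar>x \<bullet> (Q *v x)\<bar> \<le> KC * (x \<bullet> x)" for x
  proof -
    have "\<bar>x \<bullet> (Q *v x)\<bar> \<le> norm x * norm (Q *v x)" by (rule Cauchy_Schwarz_ineq2)
    also have "\<dots> \<le> norm x * (KC * norm x)" using Qn by (intro mult_left_mono) auto
    also have "\<dots> = KC * (x \<bullet> x)" unfolding power2_norm_eq_inner[symmetric] by (simp add: power2_eq_square)
    finally show ?thesis .
  qed
  \<comment> \<open>The constant \<open>K2\<close> of \<open>lyapunov_cutoff\<close>, written out in
    advance because the locale parameter \<open>\<kappa>\<close> is chosen in terms of it.\<close>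
  define k2c where "k2c = K * (2 + 2 * y0\<^sup>2) powr (q / 2) * (2 * real m * KG + KR / 2 * KC * (4 * real m + 4 * real m * (real m + 1) + 2 * real m))"
  define Z where "Z = 2 * C5 * (\<epsilon> * real m + k2c) / \<epsilon>"
  \<comment> \<open>Ensures \<open>\<kappa> powr \<tau> \<ge> Z\<close>, which makes the expected
    cutoff error at most \<open>\<epsilon> / 2\<close> when the moments are bounded by
    \<open>C5\<close>.\<close>
  define \<kappa> where "\<kappa> = max 1 (\<bar>Z\<bar> powr (1 / \<tau>))"
  have \<kappa>: "\<kappa> \<ge> 1" by (simp add: \<kappa>_def)
  have "\<bar>Z\<bar> = (\<bar>Z\<bar> powr (1 / \<tau>)) powr \<tau>" using \<tau> by (simp add: powr_powr)
  also have "\<dots> \<le> \<kappa> powr \<tau>" using \<tau> by (intro powr_mono2) (auto simp: \<kappa>_def)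
  finally have Z: "Z \<le> \<kappa> powr \<tau>" by simp
  have small: "(\<epsilon> * real m + k2c) * \<kappa> powr (- \<tau>) \<le> \<epsilon> / (2 * C5)"
  proof -
    have "(\<epsilon> * real m + k2c) = \<epsilon> / (2 * C5) * Z" using \<epsilon> C5 by (simp add: Z_def)
    also have "\<dots> \<le> \<epsilon> / (2 * C5) * \<kappa> powr \<tau>" using Z \<epsilon> C5 by (intro mult_left_mono) auto
    finally have "(\<epsilon> * real m + k2c) * \<kappa> powr (- \<tau>) \<le> \<epsilon> / (2 * C5) * \<kappa> powr \<tau> * \<kappa> powr (- \<tau>)"
      by (intro mult_right_mono) auto
    also have "\<dots> = \<epsilon> / (2 * C5) * \<kappa> powr (\<tau> + - \<tau>)" by (simp only: powr_add mult.assoc)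
    also have "\<dots> = \<epsilon> / (2 * C5)" using \<kappa> by simp
    finally show ?thesis .
  qed
  interpret ly: lyapunov_cutoff \<phi> \<phi>1 \<phi>2 v y0 \<kappa> m q K \<alpha> \<epsilon> KG KR KC c2 lam d k2 G r Q
  proof unfold_locales
    show "\<bar>Q $ k $ l\<bar> \<le> KC" for k l using ent[of k l] BQ(1) by (simp add: KC_def)
    show "\<bar>\<Sum>k\<in>UNIV. Q $ k $ k\<bar> \<le> KC" using tr BQ(1) by (simp add: KC_def)
    show "v \<bullet> (Q *v v) = c2" using c2 by (simp add: Q_def)
  qed (fact d\<phi> d\<phi>1 c\<phi>2 \<kappa> nv q1 m K \<epsilon> b\<phi> b\<phi>1 b\<phi>2 \<phi>20 gen Gv r_low c2(2) G1 G2 R1 Q1 Q2)+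
  have K2: "ly.K2 = k2c" by (simp add: ly.K2_def ly.K1_def k2c_def)
  have low: "\<epsilon> - \<epsilon> / (2 * C5) * (1 + x \<bullet> x) powr (p / 2) \<le> ly.gen_op x" for x
  proof -
    have k0: "0 \<le> \<epsilon> * real m + k2c"
      unfolding k2c_def using \<epsilon> K ly.const_nonneg by (intro add_nonneg_nonneg mult_nonneg_nonneg) auto
    have "(\<epsilon> * real m + k2c) * ly.Pq x * (ly.psi x * (1 + x \<bullet> x)) \<le>
        (\<epsilon> * real m + k2c) * ly.Pq x * ((1 + x \<bullet> x) powr \<tau> * \<kappa> powr (- \<tau>))"
      using k0 ly.Pq_ge1[of x] \<tau> by (intro mult_left_mono ly.psi_powr_bound mult_nonneg_nonneg) auto
    also have "\<dots> = ((\<epsilon> * real m + k2c) * \<kappa> powr (- \<tau>)) * (ly.Pq x * (1 + x \<bullet> x) powr \<tau>)" by (simp only: mult_ac)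
    also have "ly.Pq x * (1 + x \<bullet> x) powr \<tau> = (1 + x \<bullet> x) powr (p / 2)"
      unfolding ly.Pq_def powr_add[symmetric] by (simp add: \<tau>_def diff_divide_distrib)
    also have "((\<epsilon> * real m + k2c) * \<kappa> powr (- \<tau>)) * (1 + x \<bullet> x) powr (p / 2) \<le> \<epsilon> / (2 * C5) * (1 + x \<bullet> x) powr (p / 2)"
      using small by (intro mult_right_mono) auto
    finally show ?thesis using ly.gen_op_lower[of x] unfolding K2 by linarith
  qed
  obtain C where Cb: "\<And>x. \<bar>ly.PhiF x\<bar> \<le> C" "\<And>x. norm (ly.gradF x) \<le> C" "\<And>k l x. \<bar>ly.hessF k l x\<bar> \<le> C"
    "\<And>x. \<bar>r x\<bar> * norm (ly.gradF x) \<le> C" "\<And>x. \<bar>ly.gen_op x\<bar> \<le> C"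
    by (rule ly.all_bounds, rule that, assumption+)
  have L_eq: "ly.gen_op x = G x \<bullet> ly.gradF x + (r x)\<^sup>2 / 2 * (\<Sum>k\<in>UNIV. \<Sum>l\<in>UNIV. ly.hessF k l x * (S ** transpose S) $ k $ l)" for x
    by (simp only: ly.gen_op_def flip: Q_def)
  interpret tf: sde_test_function M F W X G r S x0 ly.PhiF ly.gradF ly.hessF C ly.gen_op
    by unfold_locales
      (rule ly.PhiF_deriv ly.gradF_deriv ly.PhiF_cont ly.gradF_cont ly.hessF_cont Cb L_eq)+
  define f where "f s = expectation (\<lambda>\<omega>. ly.gen_op (X s \<omega>))" for s
  have fc: "continuous_on {0..t} f" for t unfolding f_def[abs_def] by (rule tf.expectation_L_cont)
  have flow: "\<epsilon> / 2 \<le> f s" if s: "s \<ge> T" for s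
  proof -
    have s0: "s \<ge> 0" using s T by simp
    have iL: "integrable M (\<lambda>\<omega>. ly.gen_op (X s \<omega>))"
      by (rule integrable_const_bound[where B=C]) (use Cb(5) fX_measurable[OF tf.L_cont s0] in auto)
    have "\<epsilon> - \<epsilon> / (2 * C5) * expectation (\<lambda>\<omega>. (1 + X s \<omega> \<bullet> X s \<omega>) powr (p / 2)) =
        expectation (\<lambda>\<omega>. \<epsilon> - \<epsilon> / (2 * C5) * (1 + X s \<omega> \<bullet> X s \<omega>) powr (p / 2))"
      using mom(1)[OF s] by (simp add: prob_space)
    also have "\<dots> \<le> f s" unfolding f_def
      by (rule integral_mono[OF _ iL]) (use mom(1)[OF s] low in auto)
    finally have "\<epsilon> - \<epsilon> / (2 * C5) * expectation (\<lambda>\<omega>. (1 + X s \<omega> \<bullet> X s \<omega>) powr (p / 2)) \<le> f s" .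
    moreover have "\<epsilon> / (2 * C5) * expectation (\<lambda>\<omega>. (1 + X s \<omega> \<bullet> X s \<omega>) powr (p / 2)) \<le> \<epsilon> / (2 * C5) * C5"
      using mom(2)[OF s] \<epsilon> C5 by (intro mult_left_mono) auto
    moreover have "\<epsilon> / (2 * C5) * C5 = \<epsilon> / 2" using C5 by simp
    ultimately show ?thesis by linarith
  qed
  have C: "C \<ge> 0" by (rule tf.C_nonneg)
  \<comment> \<open>Makes \<open>(t - T) * (\<epsilon> / 2)\<close> exceed \<open>2 * C\<close>, the
    largest possible change of the expectation of a function bounded by \<open>C\<close>.\<close>
  define t where "t = T + 4 * C / \<epsilon> + 1"
  have t: "t > T" "t > 0" using T C \<epsilon> by (auto simp: t_def add_pos_nonneg intro: add_nonneg_pos)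
  have eb: "\<bar>expectation (\<lambda>\<omega>. ly.PhiF (X s \<omega>))\<bar> \<le> C" if "s > 0" for s
  proof -
    have "\<bar>expectation (\<lambda>\<omega>. ly.PhiF (X s \<omega>))\<bar> \<le> expectation (\<lambda>\<omega>. \<bar>ly.PhiF (X s \<omega>)\<bar>)" by (rule integral_abs_bound)
    also have "\<dots> \<le> expectation (\<lambda>\<omega>. C)"
    proof (rule integral_mono)
      show "integrable M (\<lambda>\<omega>. \<bar>ly.PhiF (X s \<omega>)\<bar>)"
        by (rule integrable_const_bound[where B=C]) (use Cb(1) fX_measurable[OF ly.PhiF_cont] that in auto)
    qed (use Cb(1) in auto)
    finally show ?thesis by (simp add: prob_space)
  qed
  \<comment> \<open>Dynkin's formula at \<open>T\<close> is subtracted from that at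
    \<open>t\<close>, because the lower bound on the expected generator is available only from
    \<open>T\<close> on.\<close>
  have "integral {0..T} f + integral {T..t} f = integral {0..t} f"
    using T t fc by (intro Henstock_Kurzweil_Integration.integral_combine integrable_continuous_real) auto
  then have "integral {T..t} f = expectation (\<lambda>\<omega>. ly.PhiF (X t \<omega>)) - expectation (\<lambda>\<omega>. ly.PhiF (X T \<omega>))"
    using tf.dynkin[OF t(2)] tf.dynkin[OF T(1)] unfolding f_def[abs_def] by simp
  then have up: "integral {T..t} f \<le> 2 * C" using eb[OF t(2)] eb[OF T(1)] by linarith
  have "integral {T..t} (\<lambda>_. \<epsilon> / 2) \<le> integral {T..t} f"
  proof (rule integral_le)
    show "f integrable_on {T..t}"
      by (rule integrable_continuous_real[OF continuous_on_subset[OF fc[of t]]]) (use T in auto)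
  qed (use flow in auto)
  then have "(t - T) * (\<epsilon> / 2) \<le> 2 * C" using up t by simp
  moreover have "(t - T) * (\<epsilon> / 2) = 2 * C + \<epsilon> / 2" using \<epsilon> by (simp add: t_def field_simps)
  ultimately show False using \<epsilon> by linarith
qed

end

section \<open>Homogenized SGD\<close>

lemma hsgd_diffusion_eq:
  fixes A :: "real^'d^'n"
  assumes "B \<ge> 1" "\<gamma> > 0"
  shows "hsgd_diffusion A b \<gamma> B x =
    norm (A *v x - b) *\<^sub>R ((\<gamma> / (real CARD('n) * sqrt (real B))) *\<^sub>R psd_sqrt (transpose A ** A))"
proof -
  let ?n = "real CARD('n)"
  define c where "c = norm (A *v x - b) / (?n * sqrt (real B))"
  have c: "c \<ge> 0" by (simp add: c_def)
  have "norm (A *v x - b) ^ 2 / (?n\<^sup>2 * real B) = c\<^sup>2"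
    by (simp add: c_def power_divide power_mult_distrib)
  then have "hsgd_diffusion A b \<gamma> B x = \<gamma> *\<^sub>R (c *\<^sub>R psd_sqrt (transpose A ** A))"
    unfolding hsgd_diffusion_def using psd_sqrt_scaleR[OF is_psd_sqrt_psd_sqrt_gram c, of A] by simp
  then show ?thesis by (simp add: c_def)
qed

text \<open>Pythagoras along the unit vector \<open>u = A v / lam\<close> of the column space. The
  component of the residual along \<open>u\<close> is the affine expression in
  \<open>v \<bullet> x\<close>. What is left after subtracting it is again of the form
  \<open>A *v y - b\<close>, so its norm is at least \<open>k\<close>.\<close>

lemma residual_norm_lower_bound:
  fixes A :: "real^'d^'n"
  assumes v: "norm v = 1" "(transpose A ** A) *v v = lam\<^sup>2 *\<^sub>R v" and lam: "lam > 0"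
    and k: "\<And>y. k \<le> norm (A *v y - b)" "k \<ge> 0"
  shows "(lam * (v \<bullet> x) - ((A *v v) \<bullet> b) / lam)\<^sup>2 + k\<^sup>2 \<le> (norm (A *v x - b))\<^sup>2"
proof -
  define w where "w = A *v x - b"
  define u where "u = (1 / lam) *\<^sub>R (A *v v)"
  have vv: "v \<bullet> v = 1" using v by (simp add: dot_square_norm)
  have "(A *v v) \<bullet> (A *v v) = lam\<^sup>2" using inner_gram[of v A v] v vv by simp
  then have uu: "u \<bullet> u = 1" using lam by (simp add: u_def power2_eq_square)
  have "(A *v v) \<bullet> (A *v x) = lam\<^sup>2 * (v \<bullet> x)"
    using inner_gram[of x A v] v by (simp add: inner_commute)
  then have uw: "u \<bullet> w = lam * (v \<bullet> x) - ((A *v v) \<bullet> b) / lam"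
    unfolding u_def w_def using lam by (simp add: inner_diff_right power2_eq_square diff_divide_distrib)
  have "w - (u \<bullet> w) *\<^sub>R u = A *v (x - ((u \<bullet> w) / lam) *\<^sub>R v) - b"
    unfolding u_def w_def by (simp add: matrix_vector_mult_diff_distrib matrix_vector_mult_scaleR)
  then have "k \<le> norm (w - (u \<bullet> w) *\<^sub>R u)" using k(1) by simp
  then have "k\<^sup>2 \<le> (norm (w - (u \<bullet> w) *\<^sub>R u))\<^sup>2" using k(2) by (intro power_mono)
  also have "\<dots> = w \<bullet> w - (u \<bullet> w)\<^sup>2"
    unfolding power2_norm_eq_inner using uu by (simp add: inner_diff_left inner_diff_right inner_commute power2_eq_square)
  finally show ?thesis unfolding uw[symmetric] w_def[symmetric] power2_norm_eq_inner by linarith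
qed

lemma hsgd_scalar_noise_sde:
  fixes A :: "real^'d^'n"
  assumes gamma: "\<gamma> > 0" and batch: "B \<ge> 1"
    and BM: "brownian_motion M F W" and sol: "hsgd_solution M F W A b \<delta> \<gamma> B x0 X"
  shows "scalar_noise_sde M F W X (\<lambda>x. - \<gamma> *\<^sub>R grad_f A b \<delta> x) (\<lambda>x. norm (A *v x - b))
    ((\<gamma> / (real CARD('n) * sqrt (real B))) *\<^sub>R psd_sqrt (transpose A ** A)) x0"
proof -
  let ?S = "(\<gamma> / (real CARD('n) * sqrt (real B))) *\<^sub>R psd_sqrt (transpose A ** A)"
  interpret brownian M F W by unfold_locales (rule BM)
  have mc: "continuous_on UNIV (\<lambda>x. Q *v x)" for Q :: "real^'k^'l"
    by (intro linear_continuous_on matrix_vector_mul_bounded_linear)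
  have rc: "continuous_on UNIV (\<lambda>x. A *v x - b)" by (intro continuous_intros mc)
  have gc: "continuous_on UNIV (\<lambda>x. - \<gamma> *\<^sub>R grad_f A b \<delta> x)"
    unfolding grad_f_def by (intro continuous_intros continuous_on_compose2[OF mc rc]) auto
  show ?thesis
  proof unfold_locales
    show "X t \<in> borel_measurable (F t)" if "0 \<le> t" for t using sol that by (simp add: hsgd_solution_def)
    show "X 0 \<omega> = x0" "continuous_on {0..} (\<lambda>t. X t \<omega>)" if "\<omega> \<in> space M" for \<omega>
      using sol that by (simp_all add: hsgd_solution_def)
    show "continuous_on UNIV (\<lambda>x. norm (A *v x - b))" by (intro continuous_intros rc)
    fix t e :: real assume t: "0 \<le> t" and e: "0 < e"
    have eq1: "ito_riemann_sum W (\<lambda>s \<omega>. hsgd_diffusion A b \<gamma> B (X s \<omega>)) t N \<omega> =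
        ?S *v (\<Sum>k<2^N. norm (A *v X (real k * t / 2^N) \<omega> - b) *\<^sub>R (W (real (Suc k) * t / 2^N) \<omega> - W (real k * t / 2^N) \<omega>))" for N \<omega>
      unfolding ito_riemann_sum_def hsgd_diffusion_eq[OF batch gamma]
      by (simp only: vec.sum matrix_vector_mult_scaleR scaleR_matrix_vector_assoc[symmetric])
    have eq2: "X t \<omega> - x0 + \<gamma> *\<^sub>R integral {0..t} (\<lambda>s. grad_f A b \<delta> (X s \<omega>)) =
        X t \<omega> - x0 - integral {0..t} (\<lambda>s. - \<gamma> *\<^sub>R grad_f A b \<delta> (X s \<omega>))" for \<omega>
      by (simp only: Henstock_Kurzweil_Integration.integral_cmul) simp
    have "(\<lambda>N. prob {\<omega>\<in>space M. e < norm (ito_riemann_sum W (\<lambda>s \<omega>. hsgd_diffusion A b \<gamma> B (X s \<omega>)) t N \<omega>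
        - (X t \<omega> - x0 + \<gamma> *\<^sub>R integral {0..t} (\<lambda>s. grad_f A b \<delta> (X s \<omega>))))}) \<longlonglongrightarrow> 0"
      using sol t e unfolding hsgd_solution_def by blast
    then show "(\<lambda>N. prob {\<omega>\<in>space M. e < norm (?S *v (\<Sum>k<2^N. norm (A *v X (real k * t / 2^N) \<omega> - b) *\<^sub>R
          (W (real (Suc k) * t / 2^N) \<omega> - W (real k * t / 2^N) \<omega>))
        - (X t \<omega> - x0 - integral {0..t} (\<lambda>s. - \<gamma> *\<^sub>R grad_f A b \<delta> (X s \<omega>))))}) \<longlonglongrightarrow> 0"
      unfolding eq1 eq2 .
  qed (rule gc)
qed

theorem theorem2:
  fixes A :: "real^'d^'n" and b :: "real^'n" and \<delta> \<gamma> :: real and B :: nat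
    and x0 :: "real^'d" and M :: "'a measure" and F :: "real \<Rightarrow> 'a measure"
    and W X :: "real \<Rightarrow> 'a \<Rightarrow> real^'d"
  assumes sv_pos: "\<forall>s\<in>singular_values A. s > 0"
    and b_notin: "b \<notin> range (\<lambda>x. A *v x)"
    and delta: "\<delta> \<ge> 0" and gamma: "\<gamma> > 0" and batch: "B \<ge> 1"
    and BM: "brownian_motion M F W"
    and sol: "hsgd_solution M F W A b \<delta> \<gamma> B x0 X"
  shows "tail_index M X \<le>
    ereal (1 + 2 * real CARD('n) * real B * ((top_singular_value A)\<^sup>2 + real CARD('n) * \<delta>)
              / (\<gamma> * (top_singular_value A) ^ 4))"
proof -
  define n where "n = real CARD('n)"
  define lam where "lam = top_singular_value A"
  have n: "n > 0" by (simp add: n_def)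
  have B: "real B > 0" using batch by simp
  obtain v where v: "norm v = 1" "(transpose A ** A) *v v = lam\<^sup>2 *\<^sub>R v" and lam_sv: "lam \<in> singular_values A"
    using top_singular_vector[of A] unfolding lam_def by metis
  have lam: "lam > 0" using sv_pos lam_sv by blast
  have vv: "v \<bullet> v = 1" using v by (simp add: dot_square_norm)
  define S0 where "S0 = psd_sqrt (transpose A ** A)"
  define sc where "sc = \<gamma> / (n * sqrt (real B))"
  define G where "G x = - \<gamma> *\<^sub>R grad_f A b \<delta> x" for x
  define r where "r x = norm (A *v x - b)" for x
  interpret scalar_noise_sde M F W X G r "sc *\<^sub>R S0" x0
    using hsgd_scalar_noise_sde[OF gamma batch BM sol] unfolding G_def[abs_def] r_def[abs_def] sc_def S0_def n_def .
  define \<alpha> where "\<alpha> = \<gamma> * (lam\<^sup>2 / n + \<delta>)"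
  have \<alpha>: "\<alpha> > 0" using gamma lam n delta by (simp add: \<alpha>_def add_pos_nonneg)
  \<comment> \<open>The value of \<open>v \<bullet> x\<close> at which the drift along
    \<open>v\<close> vanishes.\<close>
  define y0 where "y0 = \<gamma> * ((A *v v) \<bullet> b) / (n * \<alpha>)"
  \<comment> \<open>The quadratic form of the diffusion matrix at \<open>v\<close>, which is an
    eigenvector of the Gram matrix for \<open>lam\<^sup>2\<close>.\<close>
  define c2 where "c2 = sc\<^sup>2 * lam\<^sup>2"
  have sc: "sc > 0" using gamma n B by (simp add: sc_def)
  have c2: "c2 > 0" using sc lam by (simp add: c2_def)
  have Q: "v \<bullet> ((sc *\<^sub>R S0 ** transpose (sc *\<^sub>R S0)) *v v) = c2"
  proof -
    have "transpose S0 = S0" "S0 ** S0 = transpose A ** A"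
      using is_psd_sqrt_psd_sqrt_gram[of A] unfolding is_psd_sqrt_def S0_def by auto
    note S0 = this
    have "sc *\<^sub>R S0 ** transpose (sc *\<^sub>R S0) = sc\<^sup>2 *\<^sub>R (S0 ** S0)"
      by (simp add: transpose_scalar S0(1) scalar_matrix_assoc matrix_scalar_ac power2_eq_square)
    then have "sc *\<^sub>R S0 ** transpose (sc *\<^sub>R S0) = sc\<^sup>2 *\<^sub>R (transpose A ** A)" unfolding S0(2) .
    then show ?thesis using v vv by (simp add: scaleR_matrix_vector_assoc[symmetric] c2_def)
  qed
  have Gv: "G x \<bullet> v = - \<alpha> * (v \<bullet> x - y0)" for x
  proof -
    have "(transpose A *v (A *v x - b)) \<bullet> v = (A *v x - b) \<bullet> (A *v v)"
      by (simp add: dot_lmul_matrix transpose_matrix_vector)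
    also have "\<dots> = lam\<^sup>2 * (v \<bullet> x) - (A *v v) \<bullet> b"
    proof -
      have "(A *v x) \<bullet> (A *v v) = lam\<^sup>2 * (v \<bullet> x)" using inner_gram[of x A v] v by (simp add: inner_commute)
      then show ?thesis unfolding inner_diff_left by (simp add: inner_commute)
    qed
    finally have gv: "grad_f A b \<delta> x \<bullet> v = (1 / n) * (lam\<^sup>2 * (v \<bullet> x) - (A *v v) \<bullet> b) + \<delta> * (v \<bullet> x)"
      unfolding grad_f_def by (simp add: inner_add_left n_def inner_commute[of x v])
    have "G x \<bullet> v = - \<gamma> * (grad_f A b \<delta> x \<bullet> v)" by (simp add: G_def)
    then have "G x \<bullet> v = - (\<alpha> * (v \<bullet> x)) + \<gamma> * ((A *v v) \<bullet> b) / n"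
      unfolding gv \<alpha>_def by (simp add: algebra_simps diff_divide_distrib)
    moreover have "\<alpha> * y0 = \<gamma> * ((A *v v) \<bullet> b) / n" using \<alpha> by (simp add: y0_def)
    ultimately show ?thesis by (simp add: right_diff_distrib)
  qed
  \<comment> \<open>The column space is closed, so \<open>b\<close> outside it has positive
    distance; this keeps the noise from vanishing anywhere.\<close>
  define k where "k = infdist b (range (\<lambda>x. A *v x))"
  have "closed (range (\<lambda>x. A *v x))"
    by (intro closed_subspace linear_subspace_image) auto
  then have k: "k > 0" unfolding k_def using b_notin infdist_pos_not_in_closed by blast
  have kle: "k \<le> norm (A *v y - b)" for y
    unfolding k_def using infdist_le[of "A *v y" "range (\<lambda>x. A *v x)" b] by (simp add: dist_norm norm_minus_commute)
  \<comment> \<open>Compensates the centring at \<open>y0\<close>, so that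
    \<open>lam * (v \<bullet> x - y0) + d\<close> is the affine expression of
    \<open>residual_norm_lower_bound\<close>.\<close>
  define d where "d = lam * y0 - ((A *v v) \<bullet> b) / lam"
  have r_low: "(lam * (v \<bullet> x - y0) + d)\<^sup>2 + k\<^sup>2 \<le> (r x)\<^sup>2" for x
  proof -
    have "lam * (v \<bullet> x - y0) + d = lam * (v \<bullet> x) - ((A *v v) \<bullet> b) / lam" by (simp add: d_def algebra_simps)
    then show ?thesis using residual_norm_lower_bound[OF v lam kle, of x] k unfolding r_def by simp
  qed
  obtain a where a: "a > 0" "\<And>x. norm (A *v x) \<le> norm x * a"
    using bounded_linear.pos_bounded[OF matrix_vector_mul_bounded_linear[of A]] by blast
  obtain a' where a': "a' > 0" "\<And>x. norm (transpose A *v x) \<le> norm x * a'"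
    using bounded_linear.pos_bounded[OF matrix_vector_mul_bounded_linear[of "transpose A"]] by blast
  have r_lin: "r x \<le> (a + norm b) * (1 + norm x)" for x
  proof -
    have "r x \<le> norm (A *v x) + norm b" unfolding r_def by (rule norm_triangle_ineq4)
    also have "\<dots> \<le> norm x * a + norm b" using a by simp
    also have "\<dots> \<le> (a + norm b) * (1 + norm x)" using a by (simp add: algebra_simps)
    finally show ?thesis .
  qed
  define g where "g = \<gamma> * (1 / n * ((a + norm b) * a') + \<delta>)"
  have g0: "g \<ge> 0" using gamma n a a' delta by (simp add: g_def)
  have G_lin: "norm (G x) \<le> g * (1 + norm x)" for x
  proof -
    have "norm (grad_f A b \<delta> x) \<le> 1 / n * norm (transpose A *v (A *v x - b)) + \<delta> * norm x"
      unfolding grad_f_def using delta n by (intro order_trans[OF norm_triangle_ineq]) (simp add: n_def)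
    also have "\<dots> \<le> 1 / n * ((a + norm b) * (1 + norm x) * a') + \<delta> * (1 + norm x)"
    proof (intro add_mono mult_left_mono)
      have "norm (transpose A *v (A *v x - b)) \<le> r x * a'" unfolding r_def by (rule a')
      also have "\<dots> \<le> (a + norm b) * (1 + norm x) * a'" using r_lin a' by (intro mult_right_mono) auto
      finally show "norm (transpose A *v (A *v x - b)) \<le> (a + norm b) * (1 + norm x) * a'" .
    qed (use n delta in auto)
    finally have "\<gamma> * norm (grad_f A b \<delta> x) \<le> \<gamma> * (1 / n * ((a + norm b) * (1 + norm x) * a') + \<delta> * (1 + norm x))"
      using gamma by (intro mult_left_mono) auto
    also have "\<dots> = g * (1 + norm x)" by (simp add: g_def algebra_simps add_divide_distrib)
    finally show ?thesis unfolding G_def using gamma by simp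
  qed
  have sq: "(1 + norm x) \<le> 2 * (1 + x \<bullet> x)" "(1 + norm x) * norm x \<le> 2 * (1 + x \<bullet> x)" "(1 + norm x)\<^sup>2 \<le> 2 * (1 + x \<bullet> x)" for x :: "real^'d"
  proof -
    have "2 * norm x \<le> 1 + x \<bullet> x" using sum_squares_bound[of 1 "norm x"] by (simp add: power2_norm_eq_inner)
    moreover have "norm x * norm x = x \<bullet> x" by (simp add: power2_norm_eq_inner[symmetric] power2_eq_square)
    moreover have "0 \<le> norm x" "0 \<le> x \<bullet> x" by auto
    ultimately show "(1 + norm x) \<le> 2 * (1 + x \<bullet> x)" "(1 + norm x) * norm x \<le> 2 * (1 + x \<bullet> x)" "(1 + norm x)\<^sup>2 \<le> 2 * (1 + x \<bullet> x)"
      unfolding power2_eq_square distrib_right distrib_left by linarith+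
  qed
  have G1: "norm (G x) \<le> (2 * g) * (1 + x \<bullet> x)" for x
    using G_lin[of x] mult_left_mono[OF sq(1)[of x] g0] by linarith
  have G2: "norm (G x) * norm x \<le> (2 * g) * (1 + x \<bullet> x)" for x
  proof -
    have "norm (G x) * norm x \<le> g * (1 + norm x) * norm x" using G_lin by (intro mult_right_mono) auto
    also have "\<dots> = g * ((1 + norm x) * norm x)" by simp
    also have "\<dots> \<le> g * (2 * (1 + x \<bullet> x))" using sq(2) g0 by (rule mult_left_mono)
    finally show ?thesis by (simp add: algebra_simps)
  qed
  have R1: "(r x)\<^sup>2 \<le> (2 * (a + norm b)\<^sup>2) * (1 + x \<bullet> x)" for x
  proof -
    have "(r x)\<^sup>2 \<le> ((a + norm b) * (1 + norm x))\<^sup>2" using r_lin by (intro power_mono) (simp_all add: r_def)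
    also have "\<dots> = (a + norm b)\<^sup>2 * (1 + norm x)\<^sup>2" by (rule power_mult_distrib)
    also have "\<dots> \<le> (a + norm b)\<^sup>2 * (2 * (1 + x \<bullet> x))" using sq(3) by (intro mult_left_mono) auto
    finally show ?thesis by (simp add: algebra_simps)
  qed
  \<comment> \<open>With \<open>\<alpha>\<close> and \<open>c2\<close> inserted, this is
    \<open>1 + 2 * \<alpha> / (c2 * lam\<^sup>2)\<close>, the exponent at which the condition
    \<open>gap\<close> of \<open>moment_blowup\<close> becomes an equality.\<close>
  define \<eta> where "\<eta> = 1 + 2 * n * real B * (lam\<^sup>2 + n * \<delta>) / (\<gamma> * lam ^ 4)"
  have eta: "\<alpha> = (\<eta> - 1) * c2 * lam\<^sup>2 / 2"
  proof -
    have sc2: "sc\<^sup>2 = \<gamma>\<^sup>2 / (n\<^sup>2 * real B)" by (simp add: sc_def power_divide power_mult_distrib)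
    show ?thesis unfolding \<eta>_def c2_def \<alpha>_def sc2 using gamma lam n B
      by (simp add: field_simps power2_eq_square power4_eq_xxxx)
  qed
  have "p \<le> \<eta>" if p: "0 \<le> p" and fin: "Limsup at_top (\<lambda>t::real. \<integral>\<^sup>+ \<omega>. ennreal (pow_nn (norm (X t \<omega>)) p) \<partial>M) < \<infinity>" for p
  proof (rule ccontr)
    assume "\<not> p \<le> \<eta>"
    then have "\<eta> - 1 < p - 1" by simp
    then have "(\<eta> - 1) * (c2 * lam\<^sup>2 / 2) < (p - 1) * (c2 * lam\<^sup>2 / 2)" using c2 lam by (intro mult_strict_right_mono) auto
    moreover have "(z - 1) * (c2 * lam\<^sup>2 / 2) = (z - 1) * c2 * lam\<^sup>2 / 2" for z by simp
    ultimately have gap: "\<alpha> < (p - 1) * c2 * lam\<^sup>2 / 2" unfolding eta by (simp only:)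
    \<comment> \<open>\<open>pow_nn\<close> unfolds to \<open>powr\<close> only for nonzero
      exponents. At \<open>p = 0\<close> the gap would make \<open>\<alpha>\<close>
      negative.\<close>
    have "p \<noteq> 0"
    proof
      assume "p = 0"
      then have "\<alpha> < - (c2 * lam\<^sup>2 / 2)" using gap by simp
      moreover have "0 < c2 * lam\<^sup>2 / 2" using c2 lam by simp
      ultimately show False using \<alpha> by linarith
    qed
    moreover have "Limsup at_top (\<lambda>t. \<integral>\<^sup>+\<omega>. ennreal (norm (X t \<omega>) powr p) \<partial>M) = \<infinity>"
      by (rule moment_blowup[OF v(1) Gv r_low Q c2 lam _ _ G1 G2 R1 gap]) (use k \<alpha> in auto)
    ultimately show False using fin by (simp add: pow_nn_def)
  qed
  then show ?thesis unfolding tail_index_def \<eta>_def n_def lam_def by (intro Sup_least) auto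
qed

end
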